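(* Let $\beta=0$. Then for every sequence $(N_n)_{n\in\mathbb{N}}$ of positive integers with $(\log N_n)^2\,n^{-1}\to\infty$ as $n\to\infty$, the finite dimensional distributions of the process $$\Bigl(n^{-1}(N_n\log N_n)^{-\frac12}\,S^{(N_n,n)}_t\Bigr)_{t\in\mathbb{R}_+}$$ converge weakly, as $n\to\infty$, to those of the process $(W_{\lambda\psi_1}\,t)_{t\in\mathbb{R}_+}$, where $W_{\lambda\psi_1}$ is a random variable (not depending on $t$) having a normal distribution with mean $0$ and variance $\lambda\psi_1$.
   Context: Notation: $\mathbb{N}=\{1,2,\dots\}$, $\mathbb{Z}_+=\{0,1,2,\dots\}$, $\mathbb{R}_+=[0,\infty)$, $\lfloor\cdot\rfloor$ is the integer part, $\log$ is the natural logarithm. (The assumption on $(N_n)$ forces $N_n\to\infty$, so the scaling factor is well defined for all large $n$.) Mixing distribution: $\alpha$ is a random variable with values in $(0,1)$ having a probability density of the form $\psi(x)(1-x)^\beta$, $x\in(0,1)$, where $\psi$ is a function on $(0,1)$ having a limit $\lim_{x\uparrow1}\psi(x)=\psi_1\in(0,\infty)$ (for $\beta=0$ the density is $\psi$ itself). Randomized INAR(1) process with Poisson innovations: let $\lambda\in(0,\infty)$. On some probability space, let $\alpha$ be a random variable with values in $(0,1)$ having the probability density $\psi(x)(1-x)^\beta$, $x\in(0,1)$, where $\lim_{x\uparrow1}\psi(x)=\psi_1\in(0,\infty)$, and let $\{X_0,\ \xi_{k,j},\ \varepsilon_k : k,j\in\mathbb{N}\}$ be random variables which are conditionally independent given $\alpha$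 and satisfy, for $k,j\in\mathbb{N}$: $\mathbb{P}(\xi_{k,j}=1\mid\alpha)=\alpha=1-\mathbb{P}(\xi_{k,j}=0\mid\alpha)$; conditionally on $\alpha$, $\varepsilon_k$ is Poisson distributed with parameter $\lambda$; conditionally on $\alpha$, $X_0$ is Poisson distributed with parameter $\lambda/(1-\alpha)$. Define $X_k:=\sum_{j=1}^{X_{k-1}}\xi_{k,j}+\varepsilon_k$, $k\in\mathbb{N}$ (with $\sum_{j=1}^0:=0$). Conditionally on $\alpha$, $(X_k)_{k\in\mathbb{Z}_+}$ is a strictly stationary INAR(1) process and $\mathbb{E}(X_k\mid\alpha)=\lambda/(1-\alpha)$. Aggregated process: let $(\alpha^{(j)},(X^{(j)}_k)_{k\in\mathbb{Z}_+})$, $j\in\mathbb{N}$, be independent copies of $(\alpha,(X_k)_{k\in\mathbb{Z}_+})$. For $N,n\in\mathbb{N}$ put $$S^{(N,n)}_t:=\sum_{j=1}^N\sum_{k=1}^{\lfloor nt\rfloor}\Bigl(X^{(j)}_k-\frac{\lambda}{1-\alpha^{(j)}}\Bigr),\qquad t\in\mathbb{R}_+.$$ *)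

theory Defs
  imports "HOL-Probability.Probability"
begin

definition cond_prob_given :: "'a measure \<Rightarrow> 'a measure \<Rightarrow> 'a set \<Rightarrow> 'a \<Rightarrow> real" where
  "cond_prob_given M F A = real_cond_exp M F (indicator A)"

definition generated_by :: "'a measure \<Rightarrow> ('a \<Rightarrow> real) \<Rightarrow> 'a measure" where
  "generated_by M Y = vimage_algebra (space M) Y borel"

definition cond_indep_vars ::
  "'a measure \<Rightarrow> 'a measure \<Rightarrow> 'b measure \<Rightarrow> ('i \<Rightarrow> 'a \<Rightarrow> 'b) \<Rightarrow> 'i set \<Rightarrow> bool" where
  "cond_indep_vars M F N Y I \<longleftrightarrow>
     (\<forall>i\<in>I. Y i \<in> M \<rightarrow>\<^sub>M N) \<and>
     (\<forall>J A. finite J \<longrightarrow> J \<subseteq> I \<longrightarrow> (\<forall>i\<in>J. A i \<in> sets N) \<longrightarrow>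
        (AE \<omega> in M. cond_prob_given M F {x \<in> space M. \<forall>i\<in>J. Y i x \<in> A i} \<omega>
           = (\<Prod>i\<in>J. cond_prob_given M F {x \<in> space M. Y i x \<in> A i} \<omega>)))"

datatype inar_index = Initial | Offspring nat nat | Innovation nat

fun inar_input ::
  "('a \<Rightarrow> nat) \<Rightarrow> (nat \<Rightarrow> nat \<Rightarrow> 'a \<Rightarrow> nat) \<Rightarrow> (nat \<Rightarrow> 'a \<Rightarrow> nat) \<Rightarrow> inar_index \<Rightarrow> 'a \<Rightarrow> nat" where
  "inar_input X0 \<xi> \<epsilon> Initial = X0"
| "inar_input X0 \<xi> \<epsilon> (Offspring k j) = \<xi> k j"
| "inar_input X0 \<xi> \<epsilon> (Innovation k) = \<epsilon> k"

text \<open>Offspring and innovations are indexed from 1: the values \<open>\<xi> 0 j\<close>, \<open>\<xi> k 0\<close>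
  and \<open>\<epsilon> 0\<close> are never used.\<close>

definition inar_indices :: "inar_index set" where
  "inar_indices = {Initial} \<union> {Offspring k j | k j. 1 \<le> k \<and> 1 \<le> j} \<union> {Innovation k | k. 1 \<le> k}"

primrec inar1 ::
  "('a \<Rightarrow> nat) \<Rightarrow> (nat \<Rightarrow> nat \<Rightarrow> 'a \<Rightarrow> nat) \<Rightarrow> (nat \<Rightarrow> 'a \<Rightarrow> nat) \<Rightarrow> nat \<Rightarrow> 'a \<Rightarrow> nat" where
  "inar1 X0 \<xi> \<epsilon> 0 \<omega> = X0 \<omega>"
| "inar1 X0 \<xi> \<epsilon> (Suc k) \<omega> = (\<Sum>j = 1..inar1 X0 \<xi> \<epsilon> k \<omega>. \<xi> (Suc k) j \<omega>) + \<epsilon> (Suc k) \<omega>"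

locale randomized_inar1 = prob_space M
  for M :: "'a measure" +
  fixes lam \<beta> \<psi>1 :: real and \<psi> :: "real \<Rightarrow> real"
    and \<alpha> :: "'a \<Rightarrow> real" and X0 :: "'a \<Rightarrow> nat"
    and \<xi> :: "nat \<Rightarrow> nat \<Rightarrow> 'a \<Rightarrow> nat" and \<epsilon> :: "nat \<Rightarrow> 'a \<Rightarrow> nat"
  assumes lambda_pos: "0 < lam"
    and alpha_range: "\<And>\<omega>. \<omega> \<in> space M \<Longrightarrow> \<alpha> \<omega> \<in> {0<..<1}"
    and psi_nonneg: "\<And>x. x \<in> {0<..<1} \<Longrightarrow> 0 \<le> \<psi> x"
    and alpha_density:
      "distributed M lborel \<alpha> (\<lambda>x. ennreal (\<psi> x * (1 - x) powr \<beta> * indicator {0<..<1} x))"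
    and psi1_pos: "0 < \<psi>1"
    and psi_limit: "(\<psi> \<longlongrightarrow> \<psi>1) (at_left 1)"
    and cond_indep:
      "cond_indep_vars M (generated_by M \<alpha>) (count_space UNIV) (inar_input X0 \<xi> \<epsilon>) inar_indices"
    and offspring_1: "\<And>k j. 1 \<le> k \<Longrightarrow> 1 \<le> j \<Longrightarrow>
      AE \<omega> in M. cond_prob_given M (generated_by M \<alpha>) {x \<in> space M. \<xi> k j x = 1} \<omega> = \<alpha> \<omega>"
    and offspring_0: "\<And>k j. 1 \<le> k \<Longrightarrow> 1 \<le> j \<Longrightarrow>
      AE \<omega> in M. cond_prob_given M (generated_by M \<alpha>) {x \<in> space M. \<xi> k j x = 0} \<omega> = 1 - \<alpha> \<omega>"
    and innovation_Poisson: "\<And>k m. 1 \<le> k \<Longrightarrow>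
      AE \<omega> in M. cond_prob_given M (generated_by M \<alpha>) {x \<in> space M. \<epsilon> k x = m} \<omega>
        = pmf (poisson_pmf lam) m"
    and initial_Poisson: "\<And>m.
      AE \<omega> in M. cond_prob_given M (generated_by M \<alpha>) {x \<in> space M. X0 x = m} \<omega>
        = pmf (poisson_pmf (lam / (1 - \<alpha> \<omega>))) m"

definition path_space :: "(real \<times> (nat \<Rightarrow> nat)) measure" where
  "path_space = borel \<Otimes>\<^sub>M (\<Pi>\<^sub>M k\<in>UNIV. count_space UNIV)"

text \<open>The copies are indexed by \<open>j \<ge> 1\<close> and may live on a probability space other than
  the one carrying the original pair.\<close>

definition independent_copies ::
  "'b measure \<Rightarrow> (nat \<Rightarrow> 'b \<Rightarrow> real) \<Rightarrow> (nat \<Rightarrow> nat \<Rightarrow> 'b \<Rightarrow> nat)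
    \<Rightarrow> 'a measure \<Rightarrow> ('a \<Rightarrow> real) \<Rightarrow> (nat \<Rightarrow> 'a \<Rightarrow> nat) \<Rightarrow> bool" where
  "independent_copies P a X M \<alpha> Y \<longleftrightarrow>
     prob_space P \<and>
     prob_space.indep_vars P (\<lambda>_. path_space) (\<lambda>j \<omega>. (a j \<omega>, \<lambda>k. X j k \<omega>)) {1..} \<and>
     (\<forall>j\<ge>1. distr P path_space (\<lambda>\<omega>. (a j \<omega>, \<lambda>k. X j k \<omega>))
            = distr M path_space (\<lambda>\<omega>. (\<alpha> \<omega>, \<lambda>k. Y k \<omega>)))"

definition aggregated ::
  "real \<Rightarrow> (nat \<Rightarrow> 'b \<Rightarrow> real) \<Rightarrow> (nat \<Rightarrow> nat \<Rightarrow> 'b \<Rightarrow> nat) \<Rightarrow> nat \<Rightarrow> nat \<Rightarrow> real \<Rightarrow> 'b \<Rightarrow> real" where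
  "aggregated lam a X N n t \<omega> =
     (\<Sum>j = 1..N. \<Sum>k = 1..nat \<lfloor>real n * t\<rfloor>. real (X j k \<omega>) - lam / (1 - a j \<omega>))"

definition weak_conv_in :: "'c topology \<Rightarrow> (nat \<Rightarrow> 'c measure) \<Rightarrow> 'c measure \<Rightarrow> bool" where
  "weak_conv_in T \<mu> \<nu> \<longleftrightarrow>
     (\<forall>f. continuous_map T euclideanreal f \<and> bounded (f ` topspace T) \<longrightarrow>
        (\<lambda>n. integral\<^sup>L (\<mu> n) f) \<longlonglongrightarrow> integral\<^sup>L \<nu> f)"

text \<open>The space of \<open>d\<close>-vectors is represented by functions on \<open>{..<d}\<close> that are \<open>undefined\<close> elsewhere,
  so that the dimension can be quantified over.\<close>

definition fin_dim_distr ::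
  "'b measure \<Rightarrow> (real \<Rightarrow> 'b \<Rightarrow> real) \<Rightarrow> nat \<Rightarrow> (nat \<Rightarrow> real) \<Rightarrow> (nat \<Rightarrow> real) measure" where
  "fin_dim_distr P Z d t = distr P (\<Pi>\<^sub>M i\<in>{..<d}. borel) (\<lambda>\<omega>. \<lambda>i\<in>{..<d}. Z (t i) \<omega>)"

definition fin_dim_conv ::
  "'b measure \<Rightarrow> (nat \<Rightarrow> real \<Rightarrow> 'b \<Rightarrow> real) \<Rightarrow> 'c measure \<Rightarrow> (real \<Rightarrow> 'c \<Rightarrow> real) \<Rightarrow> bool" where
  "fin_dim_conv P Z Q L \<longleftrightarrow>
     (\<forall>d t. (\<forall>i<d. 0 \<le> t i) \<longrightarrow>
        weak_conv_in (product_topology (\<lambda>_. euclideanreal) {..<d})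
          (\<lambda>n. fin_dim_distr P (Z n) d t) (fin_dim_distr Q L d t))"

end

theory Submission
  imports Defs "HOL-Real_Asymp.Real_Asymp"
begin

text \<open>Since \<open>log N\<close> dominates \<open>log n\<close>, the sum is governed by copies with \<open>1 - \<alpha>\<close> much smaller than \<open>1/n\<close>,
  whose path hardly moves before time \<open>n\<close>. Write \<open>S\<^sub>t\<close> as \<open>\<lfloor>nt\<rfloor>\<close> times the sum of the initial
  values \<open>X\<^sub>0 - \<lambda>/(1 - \<alpha>)\<close> plus the sum of the displacements \<open>X\<^sub>k - X\<^sub>0\<close>.

  Given \<open>\<alpha>\<close>, one step removes a Poisson(\<open>\<lambda>\<close>) number of deaths and adds a Poisson(\<open>\<lambda>\<close>) number of
  innovations, so displacements have mean 0 and second moment at most of order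
  \<open>min (k\<^sup>2) (1/(1 - \<alpha>))\<close>; as \<open>1 - \<alpha>\<close> has bounded density near 0, the unconditional second moment
  is \<open>O(log k)\<close> and the displacement part vanishes in \<open>L\<^sup>2\<close>.

  The centred initial values have infinite variance, but their characteristic function is
  \<open>E exp (- z/(1 - \<alpha>))\<close> with \<open>z = \<lambda>(1 + iu - e\<^sup>i\<^sup>u)\<close>, and
  \<open>1 - E exp (- z/(1 - \<alpha>)) \<approx> z E[1/(1 - \<alpha>); 1 - \<alpha> \<ge> s] \<approx> \<psi>\<^sub>1 z log (1/s)\<close>. With \<open>s = 1/(N log N)\<close> this
  gives the normal limit with variance \<open>\<lambda>\<psi>\<^sub>1\<close> under the scaling \<open>(N log N)\<^sup>-\<^sup>1\<^sup>/\<^sup>2\<close>.\<close>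

section \<open>Conditional laws given the thinning parameter\<close>

text \<open>The conditional law given \<alpha> is never built as a kernel: the hypotheses speak of
  single events, each up to its own null set, so an event is paired with a weight function of
  \<alpha> (\<open>has_cond_prob\<close>), and integer-valued inputs let countable disjoint unions
  do the rest. Poisson deaths come from thinning: a Poisson(\<open>lam / (1 - p)\<close>) population
  splits into independent survivors of rate \<open>p * lam / (1 - p)\<close> and deaths of rate
  \<open>lam\<close>; adding the innovations restores the first rate, which is stationarity. For
  \<beta> = 0 neither \<open>X0\<close> nor its conditional mean is integrable. Hence means are
  taken of increments only, and second moments are carried in \<open>ennreal\<close> under an
  arbitrary weight \<open>h\<close> of \<alpha>, which later truncates. The choice of s balances two
  errors, O(s) from the tail and |z|^2 / s from the Taylor remainder: for arguments of order (N log
  N)^(-1/2) both are O(s), N s tends to 0, and N s log (1/s) tends to 1. For displacements log k is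
  weakened to a square root, which makes the relative variance of order sqrt n / log N, the form in
  which the growth hypothesis controls it.\<close>

context randomized_inar1
begin

lemma alpha_measurable [measurable]: "\<alpha> \<in> borel_measurable M"
  using distributed_measurable[OF alpha_density] by simp

lemma subalgebra_generated: "subalgebra M (generated_by M \<alpha>)"
  unfolding subalgebra_def generated_by_def
  by (auto simp: sets_vimage_algebra2)

lemma sigma_finite_generated: "sigma_finite_subalgebra M (generated_by M \<alpha>)"
proof -
  have "finite_measure (restr_to_subalg M (generated_by M \<alpha>))"
    using emeasure_restr_to_subalg[OF subalgebra_generated, of "space M"]
      subalgebra_generated sets.top[of "generated_by M \<alpha>"]
    by (intro finite_measureI) (simp add: space_restr_to_subalg subalgebra_def emeasure_space_1)
  then show ?thesis
    using subalgebra_generated by (auto simp: sigma_finite_subalgebra_def finite_measure_def)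
qed

lemma Int_vimage_alpha_sets [measurable]:
  assumes "E \<in> sets M" "B \<in> sets borel"
  shows "E \<inter> \<alpha> -` B \<in> sets M"
proof -
  have "E \<inter> \<alpha> -` B = E \<inter> (\<alpha> -` B \<inter> space M)"
    using sets.sets_into_space[OF assms(1)] by auto
  then show ?thesis using assms by auto
qed

text \<open>\<open>w (\<alpha> \<omega>)\<close> is a version of the conditional probability of
  \<open>E\<close>, encoded by the defining integral identity over \<alpha>-events. In
  \<open>ennreal\<close> this passes to countable disjoint unions without integrability conditions,
  and \<open>w\<close> lives on the real line rather than on \<open>M\<close>.\<close>

definition has_cond_prob :: "'a set \<Rightarrow> (real \<Rightarrow> ennreal) \<Rightarrow> bool" where
  "has_cond_prob E w \<longleftrightarrow> E \<in> sets M \<and> w \<in> borel_measurable borel \<and>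
     (\<forall>B\<in>sets borel. emeasure M (E \<inter> \<alpha> -` B) = (\<integral>\<^sup>+\<omega>. w (\<alpha> \<omega>) * indicator B (\<alpha> \<omega>) \<partial>M))"

text \<open>Testing on preimages of Borel sets under \<alpha>, which make up
  \<open>generated_by M \<alpha>\<close>, is the defining property of a conditional expectation.
  Nonnegativity is asked on (0,1), the range of \<alpha>; elsewhere \<open>v\<close> may take either
  sign.\<close>

lemma has_cond_prob_of_AE:
  fixes v :: "real \<Rightarrow> real"
  assumes E: "E \<in> sets M" and [measurable]: "v \<in> borel_measurable borel"
    and nonneg: "\<And>p. 0 < p \<Longrightarrow> p < 1 \<Longrightarrow> 0 \<le> v p"
    and AE: "AE \<omega> in M. cond_prob_given M (generated_by M \<alpha>) E \<omega> = v (\<alpha> \<omega>)"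
  shows "has_cond_prob E (\<lambda>p. ennreal (v p))"
  unfolding has_cond_prob_def
proof (intro conjI ballI E)
  fix B :: "real set" assume B[measurable]: "B \<in> sets borel"
  interpret S: sigma_finite_subalgebra M "generated_by M \<alpha>" by (rule sigma_finite_generated)
  let ?B = "\<alpha> -` B \<inter> space M"
  have B': "?B \<in> sets (generated_by M \<alpha>)"
    using B by (auto simp: generated_by_def sets_vimage_algebra2)
  have int_E: "integrable M (indicator E :: 'a \<Rightarrow> real)" using E by (simp add: emeasure_eq_measure)
  have int: "integrable M (real_cond_exp M (generated_by M \<alpha>) (indicator E))"
    by (rule S.real_cond_exp_int(1)[OF int_E])
  have AE': "AE \<omega> in M. real_cond_exp M (generated_by M \<alpha>) (indicator E) \<omega> = v (\<alpha> \<omega>)"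
    using AE by (simp add: cond_prob_given_def)
  have int_v: "integrable M (\<lambda>\<omega>. v (\<alpha> \<omega>))"
    using AE' int by (subst integrable_cong_AE[where g="real_cond_exp M (generated_by M \<alpha>) (indicator E)"]) auto
  have int_vB: "integrable M (\<lambda>\<omega>. v (\<alpha> \<omega>) * indicator B (\<alpha> \<omega>))"
    by (rule Bochner_Integration.integrable_bound[OF int_v]) (auto simp: indicator_def)
  have "measure M (E \<inter> ?B) = (LINT \<omega>:?B|M. indicator E \<omega>)"
    using E sets.sets_into_space[OF E]
    by (simp add: set_lebesgue_integral_def indicator_inter_arith[symmetric] Int_absorb2 Int_commute)
  also have "\<dots> = (LINT \<omega>:?B|M. real_cond_exp M (generated_by M \<alpha>) (indicator E) \<omega>)"
    by (rule S.real_cond_exp_intA[OF int_E B'])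
  also have "\<dots> = (\<integral>\<omega>. v (\<alpha> \<omega>) * indicator B (\<alpha> \<omega>) \<partial>M)"
    unfolding set_lebesgue_integral_def using AE'
    by (intro integral_cong_AE) (auto simp: indicator_def)
  finally have "emeasure M (E \<inter> ?B) = ennreal \<dots>" by (simp add: emeasure_eq_measure)
  also have "\<dots> = (\<integral>\<^sup>+\<omega>. ennreal (v (\<alpha> \<omega>) * indicator B (\<alpha> \<omega>)) \<partial>M)"
    using nonneg alpha_range by (intro nn_integral_eq_integral[symmetric] int_vB AE_I2) (auto simp: indicator_def)
  also have "\<dots> = (\<integral>\<^sup>+\<omega>. ennreal (v (\<alpha> \<omega>)) * indicator B (\<alpha> \<omega>) \<partial>M)"
    by (intro nn_integral_cong) (auto simp: indicator_def)
  also have "E \<inter> ?B = E \<inter> \<alpha> -` B" using sets.sets_into_space[OF E] by auto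
  finally show "emeasure M (E \<inter> \<alpha> -` B) = (\<integral>\<^sup>+\<omega>. ennreal (v (\<alpha> \<omega>)) * indicator B (\<alpha> \<omega>) \<partial>M)" .
qed simp

text \<open>An event may be changed on a null set, and a weight off (0,1), where \<alpha> takes no
  value. Both freedoms are used: the combinatorial descriptions of survivors and deaths hold almost
  surely only, and the closed forms of the weights hold only for \<open>0 < p < 1\<close>.\<close>

lemma has_cond_prob_cong:
  assumes "has_cond_prob E w" and [measurable]: "E' \<in> sets M"
    and "AE \<omega> in M. \<omega> \<in> E \<longleftrightarrow> \<omega> \<in> E'"
    and [measurable]: "w' \<in> borel_measurable borel"
    and "\<And>p. 0 < p \<Longrightarrow> p < 1 \<Longrightarrow> w p = w' p"
  shows "has_cond_prob E' w'"
  unfolding has_cond_prob_def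
proof (intro conjI ballI)
  fix B :: "real set" assume [measurable]: "B \<in> sets borel"
  have [measurable]: "E \<in> sets M" using assms(1) by (simp add: has_cond_prob_def)
  have "emeasure M (E' \<inter> \<alpha> -` B) = emeasure M (E \<inter> \<alpha> -` B)"
    using assms(3) by (auto intro!: emeasure_eq_AE)
  also have "\<dots> = (\<integral>\<^sup>+\<omega>. w' (\<alpha> \<omega>) * indicator B (\<alpha> \<omega>) \<partial>M)"
    using assms(1,5) alpha_range unfolding has_cond_prob_def
    by (auto intro!: nn_integral_cong simp: indicator_def)
  finally show "emeasure M (E' \<inter> \<alpha> -` B) = (\<integral>\<^sup>+\<omega>. w' (\<alpha> \<omega>) * indicator B (\<alpha> \<omega>) \<partial>M)" .
qed fact+

lemma has_cond_prob_UN: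
  fixes E :: "nat \<Rightarrow> 'a set"
  assumes "\<And>i. has_cond_prob (E i) (w i)" and "disjoint_family E"
  shows "has_cond_prob (\<Union>i. E i) (\<lambda>p. \<Sum>i. w i p)"
  unfolding has_cond_prob_def
proof (intro conjI ballI)
  have [measurable]: "E i \<in> sets M" "w i \<in> borel_measurable borel" for i
    using assms(1)[of i] by (auto simp: has_cond_prob_def)
  show "(\<Union>i. E i) \<in> sets M" "(\<lambda>p. \<Sum>i. w i p) \<in> borel_measurable borel" by measurable
  fix B :: "real set" assume [measurable]: "B \<in> sets borel"
  have "emeasure M ((\<Union>i. E i) \<inter> \<alpha> -` B) = emeasure M (\<Union>i. E i \<inter> \<alpha> -` B)"
    by simp
  also have "\<dots> = (\<Sum>i. emeasure M (E i \<inter> \<alpha> -` B))"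
    using assms(2) by (intro suminf_emeasure[symmetric])
      (auto simp: disjoint_family_on_def)
  also have "\<dots> = (\<Sum>i. \<integral>\<^sup>+\<omega>. w i (\<alpha> \<omega>) * indicator B (\<alpha> \<omega>) \<partial>M)"
    using assms(1) by (simp add: has_cond_prob_def)
  also have "\<dots> = (\<integral>\<^sup>+\<omega>. (\<Sum>i. w i (\<alpha> \<omega>)) * indicator B (\<alpha> \<omega>) \<partial>M)"
    by (subst nn_integral_suminf[symmetric]) (auto)
  finally show "emeasure M ((\<Union>i. E i) \<inter> \<alpha> -` B) = (\<integral>\<^sup>+\<omega>. (\<Sum>i. w i (\<alpha> \<omega>)) * indicator B (\<alpha> \<omega>) \<partial>M)" .
qed

lemma has_cond_prob_finite_UN:
  assumes "finite I" "\<And>i. i \<in> I \<Longrightarrow> has_cond_prob (E i) (w i)" and "disjoint_family_on E I"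
  shows "has_cond_prob (\<Union>i\<in>I. E i) (\<lambda>p. \<Sum>i\<in>I. w i p)"
  unfolding has_cond_prob_def
proof (intro conjI ballI)
  have [measurable]: "E i \<in> sets M" "w i \<in> borel_measurable borel" if "i \<in> I" for i
    using assms(2)[OF that] by (auto simp: has_cond_prob_def)
  show "(\<Union>i\<in>I. E i) \<in> sets M" "(\<lambda>p. \<Sum>i\<in>I. w i p) \<in> borel_measurable borel"
    using assms(1) by (auto intro!: borel_measurable_sum)
  fix B :: "real set" assume B[measurable]: "B \<in> sets borel"
  have "emeasure M ((\<Union>i\<in>I. E i) \<inter> \<alpha> -` B) = emeasure M (\<Union>i\<in>I. E i \<inter> \<alpha> -` B)"
    by simp
  also have "\<dots> = (\<Sum>i\<in>I. emeasure M (E i \<inter> \<alpha> -` B))"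
    using assms(1,3) by (intro sum_emeasure[symmetric])
      (auto simp: disjoint_family_on_def)
  also have "\<dots> = (\<Sum>i\<in>I. \<integral>\<^sup>+\<omega>. w i (\<alpha> \<omega>) * indicator B (\<alpha> \<omega>) \<partial>M)"
    using assms(2) B by (auto simp: has_cond_prob_def intro!: sum.cong)
  also have "\<dots> = (\<integral>\<^sup>+\<omega>. (\<Sum>i\<in>I. w i (\<alpha> \<omega>)) * indicator B (\<alpha> \<omega>) \<partial>M)"
    by (subst nn_integral_sum[symmetric]) (auto simp: sum_distrib_right)
  finally show "emeasure M ((\<Union>i\<in>I. E i) \<inter> \<alpha> -` B) = (\<integral>\<^sup>+\<omega>. (\<Sum>i\<in>I. w i (\<alpha> \<omega>)) * indicator B (\<alpha> \<omega>) \<partial>M)" .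
qed

text \<open>\<open>has_cond_prob\<close> says that two measures on the line agree on Borel sets:
  \<open>M\<close> restricted to \<open>E\<close> and \<open>M\<close> weighted by \<open>w\<close>,
  both pushed forward by \<alpha>. As an equality of measures this yields integrals of arbitrary
  functions of \<alpha>, nonnegative or complex.\<close>

lemma has_cond_prob_distr:
  assumes "has_cond_prob E w"
  shows "distr (density M (indicator E)) borel \<alpha> = distr (density M (\<lambda>\<omega>. w (\<alpha> \<omega>))) borel \<alpha>"
proof (rule measure_eqI)
  have [measurable]: "E \<in> sets M" "w \<in> borel_measurable borel"
    using assms by (auto simp: has_cond_prob_def)
  fix B assume "B \<in> sets (distr (density M (indicator E)) borel \<alpha>)"
  then have B[measurable]: "B \<in> sets borel" by simp
  have *: "E \<inter> (\<alpha> -` B \<inter> space M) = E \<inter> \<alpha> -` B"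
    using sets.sets_into_space[of "E" M] by auto
  have "emeasure (distr (density M (indicator E)) borel \<alpha>) B = emeasure M (E \<inter> \<alpha> -` B)"
    unfolding *[symmetric] by (simp add: emeasure_distr emeasure_density indicator_inter_arith[symmetric])
  also have "\<dots> = (\<integral>\<^sup>+\<omega>. w (\<alpha> \<omega>) * indicator (\<alpha> -` B \<inter> space M) \<omega> \<partial>M)"
    using assms B unfolding has_cond_prob_def by (auto intro!: nn_integral_cong simp: indicator_def)
  finally show "emeasure (distr (density M (indicator E)) borel \<alpha>) B
      = emeasure (distr (density M (\<lambda>\<omega>. w (\<alpha> \<omega>))) borel \<alpha>) B"
    by (simp add: emeasure_distr emeasure_density)
qed simp

lemma has_cond_prob_nn_integral:
  assumes E: "has_cond_prob E w" and [measurable]: "g \<in> borel_measurable borel"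
  shows "(\<integral>\<^sup>+\<omega>. g (\<alpha> \<omega>) * indicator E \<omega> \<partial>M) = (\<integral>\<^sup>+\<omega>. g (\<alpha> \<omega>) * w (\<alpha> \<omega>) \<partial>M)"
proof -
  have [measurable]: "E \<in> sets M" "w \<in> borel_measurable borel"
    using assms by (auto simp: has_cond_prob_def)
  have "(\<integral>\<^sup>+p. g p \<partial>distr (density M (indicator E)) borel \<alpha>)
      = (\<integral>\<^sup>+p. g p \<partial>distr (density M (\<lambda>\<omega>. w (\<alpha> \<omega>))) borel \<alpha>)"
    by (simp add: has_cond_prob_distr[OF E])
  then show ?thesis
    by (simp add: nn_integral_distr nn_integral_density mult.commute)
qed

lemma has_cond_prob_integral:
  fixes g :: "real \<Rightarrow> complex"
  assumes E: "has_cond_prob E (\<lambda>p. ennreal (v p))" and [measurable]: "g \<in> borel_measurable borel"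
    and [measurable]: "v \<in> borel_measurable borel" and v: "\<And>p. 0 < p \<Longrightarrow> p < 1 \<Longrightarrow> 0 \<le> v p"
  shows "(\<integral>\<omega>. indicator E \<omega> *\<^sub>R g (\<alpha> \<omega>) \<partial>M) = (\<integral>\<omega>. v (\<alpha> \<omega>) *\<^sub>R g (\<alpha> \<omega>) \<partial>M)"
proof -
  have [measurable]: "E \<in> sets M" using assms by (auto simp: has_cond_prob_def)
  have "(\<integral>p. g p \<partial>distr (density M (\<lambda>x. ennreal (indicator E x))) borel \<alpha>)
      = (\<integral>p. g p \<partial>distr (density M (\<lambda>\<omega>. ennreal (v (\<alpha> \<omega>)))) borel \<alpha>)"
    by (simp add: has_cond_prob_distr[OF E] ennreal_indicator)
  then show ?thesis
    using v alpha_range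
    by (subst (asm) (1 2) integral_distr; (subst (asm) (1 2) integral_density)?) auto
qed

end

section \<open>The Markov structure of the conditioned process\<close>

text \<open>The Poisson weight as a total function of the rate: it stays Borel measurable in
  \<open>p\<close> when the rate is \<open>lam / (1 - p)\<close> on the whole line, whereas the
  formula for \<open>poisson_pmf\<close> is tied to a positive rate.\<close>

definition poi :: "nat \<Rightarrow> real \<Rightarrow> real" where
  "poi x r = r ^ x / fact x * exp (- r)"

lemma poi_measurable [measurable]: "poi x \<in> borel_measurable borel"
  unfolding poi_def by measurable

lemma poi_nonneg: "0 \<le> r \<Longrightarrow> 0 \<le> poi x r"
  by (simp add: poi_def)

lemma poi_sums: "(\<lambda>x. poi x r) sums 1"
proof -
  have "(\<lambda>x. exp (-r) * (r ^ x /\<^sub>R fact x)) sums (exp (-r) * exp r)"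
    by (intro sums_mult exp_converges)
  then show ?thesis by (simp add: poi_def exp_minus field_simps)
qed

lemma suminf_ennreal_poi:
  assumes "0 \<le> r" "0 \<le> c"
  shows "(\<Sum>x. ennreal (c * poi x r)) = ennreal c"
proof -
  have "(\<lambda>x. c * poi x r) sums (c * 1)" by (intro sums_mult poi_sums)
  then show ?thesis using assms
    by (subst suminf_ennreal_eq[where x=c]) (auto simp: poi_nonneg)
qed

text \<open>Poisson splitting: if each member of a Poisson(\<open>l / (1 - p)\<close>) population
  survives with probability \<open>p\<close>, survivors \<open>m\<close> and deaths \<open>r\<close>
  are independent Poisson. The death rate is \<open>(1 - p) * l / (1 - p) = l\<close>, free of
  \<open>p\<close>.\<close>

lemma poi_thinning:
  assumes "0 < p" "p < 1"
  shows "real ((m + r) choose m) * (poi (m + r) (l / (1 - p)) * (p ^ m * (1 - p) ^ r))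
    = poi m (p * l / (1 - p)) * poi r l"
proof -
  have "exp (- (l / (1 - p))) = exp (- (p * l / (1 - p))) * exp (- l)"
    using assms by (subst exp_add[symmetric]) (simp add: field_simps)
  moreover have "real ((m + r) choose m) = fact (m + r) / (fact m * fact r)"
    by (subst binomial_fact) auto
  ultimately show ?thesis
    using assms by (simp add: poi_def power_add power_mult_distrib power_divide field_simps)
qed

text \<open>The binomial theorem; it is applied to the survivors and innovations of one
  step.\<close>

lemma poi_convolution: "(\<Sum>m\<le>z. poi m a * poi (z - m) b) = poi z (a + b)"
proof -
  have "(\<Sum>m\<le>z. poi m a * poi (z - m) b)
      = (\<Sum>m\<le>z. of_nat (z choose m) * a ^ m * b ^ (z - m)) * (exp (-a) * exp (-b) / fact z)"
    unfolding sum_distrib_right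
    by (intro sum.cong refl) (simp add: poi_def binomial_fact field_simps)
  also have "\<dots> = poi z (a + b)"
    by (simp add: binomial_ring[symmetric] poi_def exp_add[symmetric])
  finally show ?thesis .
qed

text \<open>The inputs that \<open>inar1\<close> has not read up to time \<open>k\<close>. The step
  from \<open>k\<close> to \<open>Suc k\<close> reads index \<open>Suc k\<close>, hence the strict
  inequalities; \<open>Initial\<close> is already read at time 0.\<close>

definition inputs_after :: "nat \<Rightarrow> inar_index set" where
  "inputs_after k = {Offspring k' j | k' j. k < k' \<and> 1 \<le> j} \<union> {Innovation k' | k'. k < k'}"

lemma inputs_after_subset: "inputs_after k \<subseteq> inar_indices"
  by (auto simp: inputs_after_def inar_indices_def)

lemma inputs_after_Suc: "inputs_after (Suc k) \<subseteq> inputs_after k"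
  by (auto simp: inputs_after_def)

context randomized_inar1
begin

section \<open>Joint conditional law of finitely many inputs\<close>

abbreviation input :: "inar_index \<Rightarrow> 'a \<Rightarrow> nat" where "input \<equiv> inar_input X0 \<xi> \<epsilon>"
abbreviation X :: "nat \<Rightarrow> 'a \<Rightarrow> nat" where "X \<equiv> inar1 X0 \<xi> \<epsilon>"

fun input_prob :: "inar_index \<Rightarrow> real \<Rightarrow> nat \<Rightarrow> real" where
  "input_prob Initial p v = poi v (lam / (1 - p))"
| "input_prob (Offspring k j) p v = (if v = 1 then p else if v = 0 then 1 - p else 0)"
| "input_prob (Innovation k) p v = poi v lam"

lemma input_prob_measurable [measurable]: "(\<lambda>p. input_prob i p v) \<in> borel_measurable borel"
  by (cases i) auto

lemma input_prob_nonneg: "0 < p \<Longrightarrow> p < 1 \<Longrightarrow> 0 \<le> input_prob i p v"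
  using lambda_pos by (cases i) (auto simp: poi_nonneg)

lemma input_measurable: "i \<in> inar_indices \<Longrightarrow> input i \<in> M \<rightarrow>\<^sub>M count_space UNIV"
  using cond_indep by (auto simp: cond_indep_vars_def)

lemma input_measurable' [measurable]:
  "X0 \<in> M \<rightarrow>\<^sub>M count_space UNIV"
  "1 \<le> k \<Longrightarrow> 1 \<le> j \<Longrightarrow> \<xi> k j \<in> M \<rightarrow>\<^sub>M count_space UNIV"
  "1 \<le> k \<Longrightarrow> \<epsilon> k \<in> M \<rightarrow>\<^sub>M count_space UNIV"
  using input_measurable[of Initial] input_measurable[of "Offspring k j"]
    input_measurable[of "Innovation k"]
  by (simp_all add: inar_indices_def)

lemma input_event_sets:
  assumes "finite J" "J \<subseteq> inar_indices"
  shows "{\<omega> \<in> space M. \<forall>i\<in>J. input i \<omega> = y i} \<in> sets M"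
proof -
  have "{\<omega> \<in> space M. input i \<omega> = y i} \<in> sets M" if "i \<in> J" for i
    using measurable_sets[OF input_measurable, of i "{y i}"] that assms
    by (auto simp: vimage_def Int_def conj_commute)
  then show ?thesis
    using assms(1) by (intro sets.sets_Collect_finite_All) auto
qed

text \<open>Conditional independence factorises the joint event, and each factor is a one-variable
  law. The bound \<open>y (Offspring k j) \<le> 1\<close> reflects that offspring probabilities are
  given for the values 0 and 1 only; that no other value occurs is derived from this in
  \<open>AE_offspring_binary\<close>.\<close>

lemma has_cond_prob_inputs:
  assumes J: "finite J" "J \<subseteq> inar_indices"
    and y: "\<And>k j. Offspring k j \<in> J \<Longrightarrow> y (Offspring k j) \<le> 1"
  shows "has_cond_prob {\<omega> \<in> space M. \<forall>i\<in>J. input i \<omega> = y i} (\<lambda>p. ennreal (\<Prod>i\<in>J. input_prob i p (y i)))"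
proof (rule has_cond_prob_of_AE)
  show "{\<omega> \<in> space M. \<forall>i\<in>J. input i \<omega> = y i} \<in> sets M"
    by (rule input_event_sets[OF J])
  have single: "AE \<omega> in M. cond_prob_given M (generated_by M \<alpha>) {x \<in> space M. input i x = y i} \<omega>
      = input_prob i (\<alpha> \<omega>) (y i)" if "i \<in> J" for i
  proof (cases i)
    case Initial
    show ?thesis using initial_Poisson[of "y i"] AE_space
    proof eventually_elim
      case (elim \<omega>)
      then show ?case using lambda_pos alpha_range[of \<omega>] by (simp add: Initial poi_def)
    qed
  next
    case (Offspring k j)
    then have kj: "1 \<le> k" "1 \<le> j" using that J by (auto simp: inar_indices_def)
    have "y i = 0 \<or> y i = 1" using y[of k j] that Offspring by auto
    then show ?thesis using offspring_1[OF kj] offspring_0[OF kj] Offspring by auto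
  next
    case (Innovation k)
    then have k: "1 \<le> k" using that J by (auto simp: inar_indices_def)
    show ?thesis using innovation_Poisson[OF k, of "y i"] lambda_pos
      by (simp add: Innovation poi_def pmf_poisson)
  qed
  have "AE \<omega> in M. cond_prob_given M (generated_by M \<alpha>) {x \<in> space M. \<forall>i\<in>J. input i x \<in> {y i}} \<omega>
      = (\<Prod>i\<in>J. cond_prob_given M (generated_by M \<alpha>) {x \<in> space M. input i x \<in> {y i}} \<omega>)"
    using cond_indep[unfolded cond_indep_vars_def, THEN conjunct2, rule_format, of J "\<lambda>i. {y i}"] J by simp
  moreover have "AE \<omega> in M. \<forall>i\<in>J. cond_prob_given M (generated_by M \<alpha>) {x \<in> space M. input i x = y i} \<omega>
      = input_prob i (\<alpha> \<omega>) (y i)"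
    using J(1) single by (simp add: AE_finite_all)
  ultimately show "AE \<omega> in M. cond_prob_given M (generated_by M \<alpha>) {x \<in> space M. \<forall>i\<in>J. input i x = y i} \<omega>
      = (\<Prod>i\<in>J. input_prob i (\<alpha> \<omega>) (y i))"
    by eventually_elim auto
  show "0 \<le> (\<Prod>i\<in>J. input_prob i p (y i))" if "0 < p" "p < 1" for p
    using that by (intro prod_nonneg input_prob_nonneg)
qed measurable

lemma has_cond_prob_emeasure:
  "has_cond_prob E w \<Longrightarrow> emeasure M E = (\<integral>\<^sup>+\<omega>. w (\<alpha> \<omega>) \<partial>M)"
  unfolding has_cond_prob_def by (auto dest!: bspec[where x=UNIV])

text \<open>The conditional probabilities of 0 and 1 are \<open>1 - \<alpha> \<omega>\<close> and
  \<open>\<alpha> \<omega>\<close>, which add up to 1; integrating over \<alpha> gives the value set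
  {0, 1} full probability, and the countably many pairs \<open>k\<close>, \<open>j\<close> share one
  null set.\<close>

lemma AE_offspring_binary: "AE \<omega> in M. \<forall>k\<ge>1. \<forall>j\<ge>1. \<xi> k j \<omega> = 0 \<or> \<xi> k j \<omega> = 1"
proof -
  have "AE \<omega> in M. 1 \<le> k \<and> 1 \<le> j \<longrightarrow> \<xi> k j \<omega> = 0 \<or> \<xi> k j \<omega> = 1" for k j :: nat
  proof (cases "1 \<le> k \<and> 1 \<le> j")
    case True
    then have kj: "1 \<le> k" "1 \<le> j" by auto
    define E where "E v = {\<omega> \<in> space M. \<xi> k j \<omega> = v}" for v :: nat
    have E_sets [measurable]: "E v \<in> sets M" for v
      unfolding E_def using kj by measurable
    have E: "has_cond_prob (E v) (\<lambda>p. ennreal (if v = 1 then p else 1 - p))" if "v \<le> 1" for v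
    proof (rule has_cond_prob_cong)
      show "has_cond_prob {\<omega> \<in> space M. \<forall>i\<in>{Offspring k j}. input i \<omega> = v}
          (\<lambda>p. ennreal (\<Prod>i\<in>{Offspring k j}. input_prob i p v))"
        using kj that by (intro has_cond_prob_inputs) (auto simp: inar_indices_def)
      show "E v \<in> sets M" by measurable
    qed (use that in \<open>auto simp: E_def\<close>)
    have "emeasure M (E 0 \<union> E 1) = emeasure M (E 0) + emeasure M (E 1)"
      by (rule plus_emeasure[symmetric, OF E_sets E_sets]) (auto simp: E_def)
    also have "\<dots> = (\<integral>\<^sup>+\<omega>. ennreal (1 - \<alpha> \<omega>) + ennreal (\<alpha> \<omega>) \<partial>M)"
      using E[of 0] E[of 1] by (subst nn_integral_add) (simp_all add: has_cond_prob_emeasure)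
    also have "\<dots> = (\<integral>\<^sup>+\<omega>. 1 \<partial>M)"
      using alpha_range by (intro nn_integral_cong) (auto simp flip: ennreal_plus simp: less_imp_le)
    finally have "prob (E 0 \<union> E 1) = 1" by (simp add: emeasure_space_1 measure_def)
    then have "AE \<omega> in M. \<omega> \<in> E 0 \<union> E 1"
      by (subst (asm) prob_eq_1) auto
    then show ?thesis by eventually_elim (auto simp: E_def)
  qed auto
  then have "AE \<omega> in M. \<forall>k j. 1 \<le> k \<and> 1 \<le> j \<longrightarrow> \<xi> k j \<omega> = 0 \<or> \<xi> k j \<omega> = 1"
    by (simp add: AE_all_countable)
  then show ?thesis by eventually_elim blast
qed

section \<open>One step as survivors, deaths and innovations\<close>

definition survivors :: "nat \<Rightarrow> 'a \<Rightarrow> nat" where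
  "survivors k \<omega> = card {j \<in> {1..X k \<omega>}. \<xi> (Suc k) j \<omega> = 1}"

text \<open>Counted on its own and not as \<open>X k - survivors k\<close>: the two counts are
  complementary only almost surely, where all offspring values are 0 or 1.\<close>

definition deaths :: "nat \<Rightarrow> 'a \<Rightarrow> nat" where
  "deaths k \<omega> = card {j \<in> {1..X k \<omega>}. \<xi> (Suc k) j \<omega> = 0}"

lemma AE_survivors:
  "AE \<omega> in M. survivors k \<omega> + deaths k \<omega> = X k \<omega> \<and> X (Suc k) \<omega> = survivors k \<omega> + \<epsilon> (Suc k) \<omega>"
  using AE_offspring_binary
proof eventually_elim
  fix \<omega> assume bin: "\<forall>k\<ge>1. \<forall>j\<ge>1. \<xi> k j \<omega> = 0 \<or> \<xi> k j \<omega> = 1"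
  have "survivors k \<omega> + deaths k \<omega> = card {1..X k \<omega>}"
  proof -
    have "{1..X k \<omega>} = {j \<in> {1..X k \<omega>}. \<xi> (Suc k) j \<omega> = 1} \<union> {j \<in> {1..X k \<omega>}. \<xi> (Suc k) j \<omega> = 0}"
    proof (intro set_eqI iffI)
      fix j assume "j \<in> {1..X k \<omega>}"
      then show "j \<in> {j \<in> {1..X k \<omega>}. \<xi> (Suc k) j \<omega> = 1} \<union> {j \<in> {1..X k \<omega>}. \<xi> (Suc k) j \<omega> = 0}"
        using bin[rule_format, of "Suc k" j] by auto
    qed auto
    from arg_cong[OF this, of card] show ?thesis
      unfolding survivors_def deaths_def by (subst (asm) card_Un_disjoint) auto
  qed
  moreover have "(\<Sum>j = 1..X k \<omega>. \<xi> (Suc k) j \<omega>) = (\<Sum>j = 1..X k \<omega>. if \<xi> (Suc k) j \<omega> = 1 then 1 else 0)"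
  proof (intro sum.cong refl)
    fix j assume "j \<in> {1..X k \<omega>}"
    then show "\<xi> (Suc k) j \<omega> = (if \<xi> (Suc k) j \<omega> = 1 then 1 else 0)"
      using bin[rule_format, of "Suc k" j] by auto
  qed
  ultimately show "survivors k \<omega> + deaths k \<omega> = X k \<omega> \<and> X (Suc k) \<omega> = survivors k \<omega> + \<epsilon> (Suc k) \<omega>"
    by (simp add: survivors_def sum.inter_filter[symmetric])
qed

lemma X_measurable [measurable]: "X k \<in> M \<rightarrow>\<^sub>M count_space UNIV"
proof (induction k)
  case (Suc k)
  \<comment> \<open>The number of summands is random: fixing its value leaves a finite sum, and the
    countably many values are glued together.\<close>
  have "(\<lambda>\<omega>. (\<lambda>x \<omega>. \<Sum>j = 1..x. \<xi> (Suc k) j \<omega>) (X k \<omega>) \<omega>) \<in> M \<rightarrow>\<^sub>M count_space UNIV"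
    by (rule measurable_compose_countable'[OF _ Suc]) (auto intro!: measurable_sum_nat)
  then show ?case by simp
qed simp


lemma survivors_measurable [measurable]: "survivors k \<in> M \<rightarrow>\<^sub>M count_space UNIV"
proof -
  have "(\<lambda>\<omega>. (\<lambda>x \<omega>. \<Sum>j = 1..x. if \<xi> (Suc k) j \<omega> = 1 then 1 else 0 :: nat) (X k \<omega>) \<omega>) \<in> M \<rightarrow>\<^sub>M count_space UNIV"
    by (rule measurable_compose_countable'[OF _ X_measurable])
       (auto intro!: measurable_sum_nat measurable_If)
  then show ?thesis by (simp add: survivors_def[abs_def] sum.inter_filter[symmetric])
qed

lemma deaths_measurable [measurable]: "deaths k \<in> M \<rightarrow>\<^sub>M count_space UNIV"
proof -
  have "(\<lambda>\<omega>. (\<lambda>x \<omega>. \<Sum>j = 1..x. if \<xi> (Suc k) j \<omega> = 0 then 1 else 0 :: nat) (X k \<omega>) \<omega>) \<in> M \<rightarrow>\<^sub>M count_space UNIV"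
    by (rule measurable_compose_countable'[OF _ X_measurable])
       (auto intro!: measurable_sum_nat measurable_If)
  then show ?thesis by (simp add: deaths_def[abs_def] sum.inter_filter[symmetric])
qed

text \<open>Finitely many inputs of later steps are carried along: their conditional independence of
  \<open>X k\<close> is what the induction on \<open>k\<close> consumes at each step.\<close>

definition future_law :: "nat \<Rightarrow> bool" where
  "future_law k \<longleftrightarrow> (\<forall>J y x. finite J \<longrightarrow> J \<subseteq> inputs_after k \<longrightarrow>
     (\<forall>k j. Offspring k j \<in> J \<longrightarrow> y (Offspring k j) \<le> 1) \<longrightarrow>
     has_cond_prob {\<omega> \<in> space M. X k \<omega> = x \<and> (\<forall>i\<in>J. input i \<omega> = y i)}
       (\<lambda>p. ennreal (poi x (lam / (1 - p)) * (\<Prod>i\<in>J. input_prob i p (y i)))))"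

text \<open>\<open>X 0\<close> is itself the input \<open>Initial\<close>, so the joint event is an
  input event with one more coordinate.\<close>

lemma future_law_0: "future_law 0"
  unfolding future_law_def
proof (intro allI impI)
  fix J y and x :: nat
  assume J: "finite J" "J \<subseteq> inputs_after 0"
    and y: "\<forall>k j. Offspring k j \<in> J \<longrightarrow> y (Offspring k j) \<le> (1::nat)"
  have notin: "Initial \<notin> J" using J by (auto simp: inputs_after_def)
  have eq: "{\<omega> \<in> space M. X 0 \<omega> = x \<and> (\<forall>i\<in>J. input i \<omega> = y i)}
      = {\<omega> \<in> space M. \<forall>i\<in>insert Initial J. input i \<omega> = (y(Initial := x)) i}"
    using notin by auto
  have "poi x (lam / (1 - p)) * (\<Prod>i\<in>J. input_prob i p (y i))
      = (\<Prod>i\<in>insert Initial J. input_prob i p ((y(Initial := x)) i))" for p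
  proof -
    have "(\<Prod>i\<in>J. input_prob i p (y i)) = (\<Prod>i\<in>J. input_prob i p ((y(Initial := x)) i))"
      using notin by (intro prod.cong) auto
    then show ?thesis using J(1) notin by simp
  qed
  moreover have "insert Initial J \<subseteq> inar_indices"
    using J(2) inputs_after_subset[of 0] by (auto simp: inar_indices_def)
  ultimately show "has_cond_prob {\<omega> \<in> space M. X 0 \<omega> = x \<and> (\<forall>i\<in>J. input i \<omega> = y i)}
       (\<lambda>p. ennreal (poi x (lam / (1 - p)) * (\<Prod>i\<in>J. input_prob i p (y i))))"
    unfolding eq using J y by (simp only:) (intro has_cond_prob_inputs, auto)
qed

text \<open>The event is partitioned by the set \<open>S\<close> of the \<open>m\<close> survivors
  among \<open>m + r\<close> individuals. Each pattern fixes \<open>X k\<close> and finitely many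
  later inputs, so \<open>future_law k\<close> applies; all patterns have the same weight, their
  number is a binomial coefficient, and \<open>poi_thinning\<close> factorises the product.\<close>

lemma survivors_deaths_law:
  assumes k: "future_law k" and J: "finite J" "J \<subseteq> inputs_after k"
    and notin: "\<And>j. Offspring (Suc k) j \<notin> J"
    and y: "\<And>k j. Offspring k j \<in> J \<Longrightarrow> y (Offspring k j) \<le> 1"
  shows "has_cond_prob {\<omega> \<in> space M. survivors k \<omega> = m \<and> deaths k \<omega> = r \<and> (\<forall>i\<in>J. input i \<omega> = y i)}
       (\<lambda>p. ennreal (poi m (p * lam / (1 - p)) * poi r lam * (\<Prod>i\<in>J. input_prob i p (y i))))"
proof -
  define I where "I = {S. S \<subseteq> {1..m + r} \<and> card S = m}"
  define K where "K = Offspring (Suc k) ` {1..m + r}"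
  \<comment> \<open>The prescribed values \<open>y\<close>, overwritten at step \<open>Suc k\<close>
    by the survival pattern \<open>S\<close>.\<close>
  define yS where "yS S i = (case i of Offspring k' j \<Rightarrow> if k' = Suc k then if j \<in> S then 1 else 0 else y i | _ \<Rightarrow> y i)"
    for S i
  define E where "E S = {\<omega> \<in> space M. X k \<omega> = m + r \<and> (\<forall>i\<in>J \<union> K. input i \<omega> = yS S i)}" for S
  have finI: "finite I" unfolding I_def by (rule finite_subset[of _ "Pow {1..m+r}"]) auto
  have yS_J: "yS S i = y i" if "i \<in> J" for S i
    using that notin by (auto simp: yS_def split: inar_index.split)
  have disj: "J \<inter> K = {}" using notin by (auto simp: K_def)
  have E: "has_cond_prob (E S) (\<lambda>p. ennreal (poi (m + r) (lam / (1 - p)) * (\<Prod>i\<in>J \<union> K. input_prob i p (yS S i))))"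
    if "S \<in> I" for S
    unfolding E_def
  proof (rule k[unfolded future_law_def, rule_format])
    show "finite (J \<union> K)" using J by (auto simp: K_def)
    show "J \<union> K \<subseteq> inputs_after k" using J by (auto simp: K_def inputs_after_def)
    show "yS S (Offspring k' j) \<le> 1" if "Offspring k' j \<in> J \<union> K" for k' j
      using that y[of k' j] by (auto simp: yS_def K_def)
  qed
  have prod_K: "(\<Prod>i\<in>J \<union> K. input_prob i p (yS S i)) = p ^ m * (1 - p) ^ r * (\<Prod>i\<in>J. input_prob i p (y i))"
    if S: "S \<in> I" for S p
  proof -
    have "(\<Prod>i\<in>K. input_prob i p (yS S i)) = (\<Prod>j = 1..m + r. if j \<in> S then p else 1 - p)"
      unfolding K_def by (subst prod.reindex) (auto simp: inj_on_def yS_def intro!: prod.cong)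
    also have "\<dots> = (\<Prod>j\<in>S. p) * (\<Prod>j\<in>{1..m + r} - S. 1 - p)"
      using S by (subst prod.If_cases) (auto simp: I_def Int_absorb1 Diff_eq)
    also have "\<dots> = p ^ m * (1 - p) ^ r"
      using S by (auto simp: I_def card_Diff_subset finite_subset[of S "{1..m+r}"])
    finally have "(\<Prod>i\<in>K. input_prob i p (yS S i)) = p ^ m * (1 - p) ^ r" .
    moreover have "(\<Prod>i\<in>J. input_prob i p (yS S i)) = (\<Prod>i\<in>J. input_prob i p (y i))"
      by (intro prod.cong) (auto simp: yS_J)
    ultimately show ?thesis
      using J disj by (subst prod.union_disjoint) (auto simp: K_def)
  qed
  have E_iff: "\<omega> \<in> E S \<longleftrightarrow> \<omega> \<in> space M \<and> X k \<omega> = m + r \<and> (\<forall>i\<in>J. input i \<omega> = y i) \<and>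
      (\<forall>j\<in>{1..m + r}. \<xi> (Suc k) j \<omega> = (if j \<in> S then 1 else 0))" for \<omega> S
  proof -
    have "(\<forall>i\<in>J. input i \<omega> = yS S i) \<longleftrightarrow> (\<forall>i\<in>J. input i \<omega> = y i)" by (simp add: yS_J)
    moreover have "(\<forall>i\<in>K. input i \<omega> = yS S i)
        \<longleftrightarrow> (\<forall>j\<in>{1..m + r}. \<xi> (Suc k) j \<omega> = (if j \<in> S then 1 else 0))"
      by (simp add: K_def yS_def)
    ultimately show ?thesis by (auto simp: E_def ball_Un)
  qed
  have disjE: "disjoint_family_on E I"
  proof (unfold disjoint_family_on_def, intro ballI impI)
    fix S S' assume S: "S \<in> I" "S' \<in> I" "S \<noteq> S'"
    then obtain j where "(j \<in> S) \<noteq> (j \<in> S')" by blast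
    moreover have "S \<subseteq> {1..m + r}" "S' \<subseteq> {1..m + r}" using S by (auto simp: I_def)
    ultimately have j: "j \<in> {1..m + r}" "(j \<in> S) \<noteq> (j \<in> S')" by blast+
    show "E S \<inter> E S' = {}"
    proof (rule ccontr)
      assume "E S \<inter> E S' \<noteq> {}"
      then obtain \<omega> where "\<omega> \<in> E S" "\<omega> \<in> E S'" by auto
      then have "\<xi> (Suc k) j \<omega> = (if j \<in> S then 1 else 0)" "\<xi> (Suc k) j \<omega> = (if j \<in> S' then 1 else 0)"
        using j(1) unfolding E_iff by blast+
      then show False using j(2) by (auto split: if_splits)
    qed
  qed
  have "has_cond_prob (\<Union>S\<in>I. E S)
      (\<lambda>p. \<Sum>S\<in>I. ennreal (poi (m + r) (lam / (1 - p)) * (\<Prod>i\<in>J \<union> K. input_prob i p (yS S i))))"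
    by (rule has_cond_prob_finite_UN[OF finI E disjE])
  then show ?thesis
  proof (rule has_cond_prob_cong)
    have "{\<omega> \<in> space M. survivors k \<omega> = m \<and> deaths k \<omega> = r \<and> (\<forall>i\<in>J. input i \<omega> = y i)}
        = {\<omega> \<in> space M. survivors k \<omega> = m \<and> deaths k \<omega> = r} \<inter> {\<omega> \<in> space M. \<forall>i\<in>J. input i \<omega> = y i}"
      by auto
    also have "\<dots> \<in> sets M"
      using J inputs_after_subset[of k] by (intro sets.Int input_event_sets) auto
    finally show "{\<omega> \<in> space M. survivors k \<omega> = m \<and> deaths k \<omega> = r \<and> (\<forall>i\<in>J. input i \<omega> = y i)} \<in> sets M" .
    \<comment> \<open>Reading a pattern off \<omega> needs offspring values in {0, 1}, hence
      agreement up to a null set only.\<close>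
    show "AE \<omega> in M. \<omega> \<in> (\<Union>S\<in>I. E S) \<longleftrightarrow>
      \<omega> \<in> {\<omega> \<in> space M. survivors k \<omega> = m \<and> deaths k \<omega> = r \<and> (\<forall>i\<in>J. input i \<omega> = y i)}"
      using AE_survivors[of k] AE_offspring_binary
    proof eventually_elim
      fix \<omega> assume X: "survivors k \<omega> + deaths k \<omega> = X k \<omega> \<and> X (Suc k) \<omega> = survivors k \<omega> + \<epsilon> (Suc k) \<omega>"
        and bin: "\<forall>k\<ge>1. \<forall>j\<ge>1. \<xi> k j \<omega> = 0 \<or> \<xi> k j \<omega> = 1"
      show "\<omega> \<in> (\<Union>S\<in>I. E S) \<longleftrightarrow>
        \<omega> \<in> {\<omega> \<in> space M. survivors k \<omega> = m \<and> deaths k \<omega> = r \<and> (\<forall>i\<in>J. input i \<omega> = y i)}"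
      proof
        assume "\<omega> \<in> (\<Union>S\<in>I. E S)"
        then obtain S where S: "S \<subseteq> {1..m + r}" "card S = m" "\<omega> \<in> E S" by (auto simp: I_def)
        have "{j \<in> {1..X k \<omega>}. \<xi> (Suc k) j \<omega> = 1} = S"
        proof (intro set_eqI iffI)
          fix j assume "j \<in> {j \<in> {1..X k \<omega>}. \<xi> (Suc k) j \<omega> = 1}"
          then have "j \<in> {1..m+r}" "\<xi> (Suc k) j \<omega> = 1" using S(3) by (auto simp: E_iff)
          then show "j \<in> S" using S(3) unfolding E_iff by (metis zero_neq_one)
        next
          fix j assume "j \<in> S"
          then show "j \<in> {j \<in> {1..X k \<omega>}. \<xi> (Suc k) j \<omega> = 1}"
            using S unfolding E_iff by auto
        qed
        then have "survivors k \<omega> = m" using S(2) by (simp add: survivors_def)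
        then show "\<omega> \<in> {\<omega> \<in> space M. survivors k \<omega> = m \<and> deaths k \<omega> = r \<and> (\<forall>i\<in>J. input i \<omega> = y i)}"
          using X S(3) by (auto simp: E_iff)
      next
        assume \<omega>: "\<omega> \<in> {\<omega> \<in> space M. survivors k \<omega> = m \<and> deaths k \<omega> = r \<and> (\<forall>i\<in>J. input i \<omega> = y i)}"
        define S where "S = {j \<in> {1..X k \<omega>}. \<xi> (Suc k) j \<omega> = 1}"
        have "S \<in> I" using \<omega> X by (auto simp: I_def S_def survivors_def)
        moreover have "\<forall>j\<in>{1..m + r}. \<xi> (Suc k) j \<omega> = (if j \<in> S then 1 else 0)"
        proof
          fix j assume j: "j \<in> {1..m + r}"
          then have "j \<in> S \<longleftrightarrow> \<xi> (Suc k) j \<omega> = 1" using \<omega> X by (simp add: S_def)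
          then show "\<xi> (Suc k) j \<omega> = (if j \<in> S then 1 else 0)"
            using bin[rule_format, of "Suc k" j] j by auto
        qed
        then have "\<omega> \<in> E S" using \<omega> X by (simp add: E_iff)
        ultimately show "\<omega> \<in> (\<Union>S\<in>I. E S)" by blast
      qed
    qed
    show "(\<Sum>S\<in>I. ennreal (poi (m + r) (lam / (1 - p)) * (\<Prod>i\<in>J \<union> K. input_prob i p (yS S i))))
       = ennreal (poi m (p * lam / (1 - p)) * poi r lam * (\<Prod>i\<in>J. input_prob i p (y i)))"
      if p: "0 < p" "p < 1" for p
    proof -
      define c where "c = poi (m + r) (lam / (1 - p)) * (p ^ m * (1 - p) ^ r * (\<Prod>i\<in>J. input_prob i p (y i)))"
      have c: "0 \<le> c" unfolding c_def
        using p lambda_pos by (intro mult_nonneg_nonneg prod_nonneg poi_nonneg zero_le_power input_prob_nonneg) auto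
      have "(\<Sum>S\<in>I. ennreal (poi (m + r) (lam / (1 - p)) * (\<Prod>i\<in>J \<union> K. input_prob i p (yS S i))))
          = of_nat (card I) * ennreal c"
        by (simp add: prod_K c_def)
      also have "card I = (m + r) choose m"
        unfolding I_def using n_subsets[of "{1..m+r}" m] by simp
      also have "of_nat ((m + r) choose m) * ennreal c = ennreal (real ((m + r) choose m) * c)"
        using c by (simp add: ennreal_mult ennreal_of_nat_eq_real_of_nat)
      also have "real ((m + r) choose m) * c = poi m (p * lam / (1 - p)) * poi r lam * (\<Prod>i\<in>J. input_prob i p (y i))"
        using poi_thinning[OF p, of m r lam] unfolding c_def by (simp only: mult.assoc[symmetric])
      finally show ?thesis .
    qed
    show "(\<lambda>p. ennreal (poi m (p * lam / (1 - p)) * poi r lam * (\<Prod>i\<in>J. input_prob i p (y i)))) \<in> borel_measurable borel"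
      by measurable
  qed
qed

text \<open>Deaths are summed out, and survivors plus the innovation form a Poisson convolution of
  rate \<open>p * lam / (1 - p) + lam = lam / (1 - p)\<close>. This identity is the stationarity of
  the process, and it is why the statement of \<open>future_law\<close> reproduces itself.\<close>

lemma future_law_Suc:
  assumes k: "future_law k"
  shows "future_law (Suc k)"
  unfolding future_law_def
proof (intro allI impI)
  fix J y and z :: nat
  assume J: "finite J" "J \<subseteq> inputs_after (Suc k)"
    and y: "\<forall>k j. Offspring k j \<in> J \<longrightarrow> y (Offspring k j) \<le> (1::nat)"
  define \<pi> where "\<pi> p = (\<Prod>i\<in>J. input_prob i p (y i))" for p
  have [measurable]: "\<pi> \<in> borel_measurable borel" unfolding \<pi>_def by measurable
  have \<pi>: "0 \<le> \<pi> p" if "0 < p" "p < 1" for p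
    using that by (auto simp: \<pi>_def intro!: prod_nonneg input_prob_nonneg)
  have notin: "Innovation (Suc k) \<notin> J" using J by (auto simp: inputs_after_def)
  define F where "F m r e = {\<omega> \<in> space M. survivors k \<omega> = m \<and> deaths k \<omega> = r \<and> \<epsilon> (Suc k) \<omega> = e \<and> (\<forall>i\<in>J. input i \<omega> = y i)}"
    for m r e
  have F: "has_cond_prob (F m r e)
       (\<lambda>p. ennreal (poi m (p * lam / (1 - p)) * poi r lam * (poi e lam * \<pi> p)))" for m r e
  proof -
    let ?J = "insert (Innovation (Suc k)) J" and ?y = "y(Innovation (Suc k) := e)"
    have eq: "F m r e = {\<omega> \<in> space M. survivors k \<omega> = m \<and> deaths k \<omega> = r \<and> (\<forall>i\<in>?J. input i \<omega> = ?y i)}"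
      using notin unfolding F_def by auto
    have prod_eq: "poi e lam * \<pi> p = (\<Prod>i\<in>?J. input_prob i p (?y i))" for p
    proof -
      have "\<pi> p = (\<Prod>i\<in>J. input_prob i p (?y i))"
        unfolding \<pi>_def using notin by (intro prod.cong) auto
      then show ?thesis using J(1) notin by simp
    qed
    show ?thesis
      unfolding eq prod_eq
      by (rule survivors_deaths_law[OF k])
         (use J y inputs_after_Suc[of k] in \<open>auto simp: inputs_after_def\<close>)
  qed
  \<comment> \<open>Exactly \<open>m\<close> survivors and any number of deaths. The innovation must
    supply \<open>z - m\<close>; the subtraction is a true one because only \<open>m \<le> z\<close>
    is used below.\<close>
  define G where "G m = (\<Union>r. F m r (z - m))" for m
  have G: "has_cond_prob (G m) (\<lambda>p. \<Sum>r. ennreal (poi m (p * lam / (1 - p)) * poi r lam * (poi (z - m) lam * \<pi> p)))" for m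
    unfolding G_def by (rule has_cond_prob_UN[OF F]) (auto simp: disjoint_family_on_def F_def)
  have "has_cond_prob (\<Union>m\<in>{..z}. G m)
      (\<lambda>p. \<Sum>m\<le>z. \<Sum>r. ennreal (poi m (p * lam / (1 - p)) * poi r lam * (poi (z - m) lam * \<pi> p)))"
    by (rule has_cond_prob_finite_UN[OF _ G]) (auto simp: disjoint_family_on_def G_def F_def)
  then show "has_cond_prob {\<omega> \<in> space M. X (Suc k) \<omega> = z \<and> (\<forall>i\<in>J. input i \<omega> = y i)}
       (\<lambda>p. ennreal (poi z (lam / (1 - p)) * (\<Prod>i\<in>J. input_prob i p (y i))))"
    unfolding \<pi>_def[symmetric]
  proof (rule has_cond_prob_cong)
    have "{\<omega> \<in> space M. X (Suc k) \<omega> = z \<and> (\<forall>i\<in>J. input i \<omega> = y i)}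
        = {\<omega> \<in> space M. X (Suc k) \<omega> = z} \<inter> {\<omega> \<in> space M. \<forall>i\<in>J. input i \<omega> = y i}"
      by auto
    also have "\<dots> \<in> sets M"
      using J inputs_after_subset[of "Suc k"] measurable_sets[OF X_measurable, of "{z}" "Suc k"]
      by (intro sets.Int input_event_sets) (auto simp: vimage_def Int_def conj_commute simp del: inar1.simps)
    finally show "{\<omega> \<in> space M. X (Suc k) \<omega> = z \<and> (\<forall>i\<in>J. input i \<omega> = y i)} \<in> sets M" .
    show "AE \<omega> in M. \<omega> \<in> (\<Union>m\<in>{..z}. G m) \<longleftrightarrow>
      \<omega> \<in> {\<omega> \<in> space M. X (Suc k) \<omega> = z \<and> (\<forall>i\<in>J. input i \<omega> = y i)}"
      using AE_survivors[of k]
      by eventually_elim (auto simp: G_def F_def simp del: inar1.simps)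
    show "(\<Sum>m\<le>z. \<Sum>r. ennreal (poi m (p * lam / (1 - p)) * poi r lam * (poi (z - m) lam * \<pi> p)))
        = ennreal (poi z (lam / (1 - p)) * \<pi> p)" if p: "0 < p" "p < 1" for p
    proof -
      have nn: "0 \<le> p * lam / (1 - p)" using p lambda_pos by auto
      have "(\<Sum>m\<le>z. \<Sum>r. ennreal (poi m (p * lam / (1 - p)) * poi r lam * (poi (z - m) lam * \<pi> p)))
          = (\<Sum>m\<le>z. \<Sum>r. ennreal ((poi m (p * lam / (1 - p)) * poi (z - m) lam * \<pi> p) * poi r lam))"
        by (simp only: mult_ac)
      also have "\<dots> = (\<Sum>m\<le>z. ennreal (poi m (p * lam / (1 - p)) * poi (z - m) lam * \<pi> p))"
        using p lambda_pos nn \<pi> by (intro sum.cong refl suminf_ennreal_poi) (auto intro!: mult_nonneg_nonneg poi_nonneg)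
      also have "\<dots> = ennreal (\<Sum>m\<le>z. poi m (p * lam / (1 - p)) * poi (z - m) lam * \<pi> p)"
        using p lambda_pos nn \<pi> by (intro sum_ennreal) (auto intro!: mult_nonneg_nonneg poi_nonneg)
      also have "(\<Sum>m\<le>z. poi m (p * lam / (1 - p)) * poi (z - m) lam * \<pi> p) = poi z (p * lam / (1 - p) + lam) * \<pi> p"
        by (simp add: poi_convolution[symmetric] sum_distrib_right)
      also have "p * lam / (1 - p) + lam = lam / (1 - p)" using p by (simp add: field_simps)
      finally show ?thesis .
    qed
  qed measurable
qed

lemma future_law: "future_law k"
  by (induction k) (auto intro: future_law_0 future_law_Suc)

lemma X_law: "has_cond_prob {\<omega> \<in> space M. X k \<omega> = x} (\<lambda>p. ennreal (poi x (lam / (1 - p))))"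
  using future_law[of k, unfolded future_law_def, rule_format, of "{}" "\<lambda>_. 0" x] by simp

text \<open>The rate does not involve \<open>p\<close>: this keeps second moments of increments
  bounded uniformly in \<alpha>, however close \<alpha> is to 1.\<close>

lemma deaths_law: "has_cond_prob {\<omega> \<in> space M. deaths k \<omega> = r} (\<lambda>p. ennreal (poi r lam))"
proof -
  have *: "has_cond_prob {\<omega> \<in> space M. survivors k \<omega> = m \<and> deaths k \<omega> = r}
      (\<lambda>p. ennreal (poi m (p * lam / (1 - p)) * poi r lam))" for m
    using survivors_deaths_law[OF future_law[of k], of "{}" "\<lambda>_. 0" m r] by simp
  have "has_cond_prob (\<Union>m. {\<omega> \<in> space M. survivors k \<omega> = m \<and> deaths k \<omega> = r})
      (\<lambda>p. \<Sum>m. ennreal (poi m (p * lam / (1 - p)) * poi r lam))"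
    by (rule has_cond_prob_UN[OF *]) (auto simp: disjoint_family_on_def)
  then show ?thesis
  proof (rule has_cond_prob_cong)
    show "{\<omega> \<in> space M. deaths k \<omega> = r} \<in> sets M" by measurable
    show "(\<Sum>m. ennreal (poi m (p * lam / (1 - p)) * poi r lam)) = ennreal (poi r lam)" if "0 < p" "p < 1" for p
    proof -
      have "0 \<le> p * lam / (1 - p)" "0 \<le> poi r lam" using that lambda_pos by (auto simp: poi_nonneg)
      from suminf_ennreal_poi[OF this] show ?thesis by (simp only: mult.commute)
    qed
  qed auto
qed

lemma innovation_law: "1 \<le> k \<Longrightarrow> has_cond_prob {\<omega> \<in> space M. \<epsilon> k \<omega> = r} (\<lambda>p. ennreal (poi r lam))"
  using has_cond_prob_inputs[of "{Innovation k}" "\<lambda>_. r"]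
  by (simp add: inar_indices_def)

end

section \<open>Conditional moments and the characteristic function\<close>

text \<open>An index shift that lowers factorial moments: iterated, it yields the mean
  \<open>r\<close> and the second factorial moment \<open>r\<^sup>2\<close>.\<close>

lemma Suc_mult_poi: "real (Suc x) * poi (Suc x) r = r * poi x r"
  by (simp add: poi_def divide_simps del: of_nat_Suc)

lemma sums_mult_poi: "(\<lambda>x. real x * poi x r) sums r"
proof -
  have "(\<lambda>x. real (Suc x) * poi (Suc x) r) sums (r * 1)"
    unfolding Suc_mult_poi by (intro sums_mult poi_sums)
  then show ?thesis by (subst (asm) sums_Suc_iff) simp
qed

lemma sums_mult_poi2: "(\<lambda>x. real x * (real x - 1) * poi x r) sums r\<^sup>2"
proof -
  have "real (Suc x) * (real (Suc x) - 1) * poi (Suc x) r = r * (real x * poi x r)" for x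
  proof -
    have "real (Suc x) * (real (Suc x) - 1) * poi (Suc x) r = real x * (real (Suc x) * poi (Suc x) r)" by simp
    then show ?thesis unfolding Suc_mult_poi by simp
  qed
  then have "(\<lambda>x. real (Suc x) * (real (Suc x) - 1) * poi (Suc x) r) sums (r * r)"
    by (simp only:) (intro sums_mult sums_mult_poi)
  then show ?thesis by (subst (asm) sums_Suc_iff) (simp add: power2_eq_square)
qed

lemma sums_square_poi: "(\<lambda>x. (real x)\<^sup>2 * poi x r) sums (r\<^sup>2 + r)"
  using sums_add[OF sums_mult_poi2[of r] sums_mult_poi[of r]]
  by (simp add: algebra_simps power2_eq_square)

lemma sums_variance_poi: "(\<lambda>x. (real x - r)\<^sup>2 * poi x r) sums r"
proof -
  have "(\<lambda>x. (real x)\<^sup>2 * poi x r - 2 * r * (real x * poi x r) + r\<^sup>2 * poi x r) sums ((r\<^sup>2 + r) - 2 * r * r + r\<^sup>2 * 1)"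
    by (intro sums_add sums_diff sums_mult sums_square_poi sums_mult_poi poi_sums)
  then show ?thesis by (simp add: algebra_simps power2_eq_square)
qed

lemma power2_diff_le: "(a - b)\<^sup>2 \<le> 2 * a\<^sup>2 + 2 * (b::real)\<^sup>2"
  using zero_le_power2[of "a + b"] unfolding power2_diff power2_sum by linarith

lemma suminf_ennreal_sums:
  assumes "f sums (s::real)" "\<And>x. 0 \<le> f x"
  shows "(\<Sum>x. ennreal (f x)) = ennreal s"
  using assms by (intro suminf_ennreal_eq)

context randomized_inar1
begin

text \<open>Splitting by the countably many values of \<open>K\<close> leaves events with known
  weights, so conditional expectations are computed without a conditional distribution.
  \<open>f\<close> may depend on \<alpha> too, as centring at
  \<open>lam / (1 - \<alpha> \<omega>)\<close> requires.\<close>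

lemma nn_integral_cond_law:
  fixes K :: "'a \<Rightarrow> nat" and f :: "nat \<Rightarrow> real \<Rightarrow> ennreal"
  assumes [measurable]: "K \<in> M \<rightarrow>\<^sub>M count_space UNIV"
    and law: "\<And>x. has_cond_prob {\<omega> \<in> space M. K \<omega> = x} (w x)"
    and [measurable]: "\<And>x. f x \<in> borel_measurable borel"
  shows "(\<integral>\<^sup>+\<omega>. f (K \<omega>) (\<alpha> \<omega>) \<partial>M) = (\<integral>\<^sup>+\<omega>. (\<Sum>x. f x (\<alpha> \<omega>) * w x (\<alpha> \<omega>)) \<partial>M)"
proof -
  have [measurable]: "w x \<in> borel_measurable borel" for x
    using law[of x] by (simp add: has_cond_prob_def)
  let ?E = "\<lambda>x. {\<omega> \<in> space M. K \<omega> = x}"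
  have "(\<integral>\<^sup>+\<omega>. f (K \<omega>) (\<alpha> \<omega>) \<partial>M) = (\<integral>\<^sup>+\<omega>. (\<Sum>x. f x (\<alpha> \<omega>) * indicator (?E x) \<omega>) \<partial>M)"
  proof (intro nn_integral_cong)
    fix \<omega> assume "\<omega> \<in> space M"
    then show "f (K \<omega>) (\<alpha> \<omega>) = (\<Sum>x. f x (\<alpha> \<omega>) * indicator (?E x) \<omega>)"
      by (subst suminf_finite[of "{K \<omega>}"]) auto
  qed
  also have "\<dots> = (\<Sum>x. \<integral>\<^sup>+\<omega>. f x (\<alpha> \<omega>) * indicator (?E x) \<omega> \<partial>M)"
    by (rule nn_integral_suminf) measurable
  also have "\<dots> = (\<Sum>x. \<integral>\<^sup>+\<omega>. f x (\<alpha> \<omega>) * w x (\<alpha> \<omega>) \<partial>M)"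
    by (intro suminf_cong has_cond_prob_nn_integral law) measurable
  also have "\<dots> = (\<integral>\<^sup>+\<omega>. (\<Sum>x. f x (\<alpha> \<omega>) * w x (\<alpha> \<omega>)) \<partial>M)"
    by (rule nn_integral_suminf[symmetric]) measurable
  finally show ?thesis .
qed

text \<open>The weight \<open>h\<close> is there to restrict \<alpha> later: indicators of a region
  turn a conditional moment into a truncated one.\<close>

lemma nn_integral_cond_poi:
  fixes K :: "'a \<Rightarrow> nat" and f :: "nat \<Rightarrow> real \<Rightarrow> real" and h :: "real \<Rightarrow> ennreal"
  assumes K: "K \<in> M \<rightarrow>\<^sub>M count_space UNIV"
    and law: "\<And>x. has_cond_prob {\<omega> \<in> space M. K \<omega> = x} (\<lambda>p. ennreal (poi x (\<rho> p)))"
    and \<rho>: "\<And>p. 0 < p \<Longrightarrow> p < 1 \<Longrightarrow> 0 \<le> \<rho> p"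
    and [measurable]: "\<And>x. f x \<in> borel_measurable borel" "h \<in> borel_measurable borel"
    and f: "\<And>x p. 0 \<le> f x p"
    and s: "\<And>p. 0 < p \<Longrightarrow> p < 1 \<Longrightarrow> (\<lambda>x. f x p * poi x (\<rho> p)) sums s p"
  shows "(\<integral>\<^sup>+\<omega>. h (\<alpha> \<omega>) * ennreal (f (K \<omega>) (\<alpha> \<omega>)) \<partial>M) = (\<integral>\<^sup>+\<omega>. h (\<alpha> \<omega>) * ennreal (s (\<alpha> \<omega>)) \<partial>M)"
proof -
  have "(\<integral>\<^sup>+\<omega>. h (\<alpha> \<omega>) * ennreal (f (K \<omega>) (\<alpha> \<omega>)) \<partial>M)
      = (\<integral>\<^sup>+\<omega>. (\<Sum>x. h (\<alpha> \<omega>) * ennreal (f x (\<alpha> \<omega>)) * ennreal (poi x (\<rho> (\<alpha> \<omega>)))) \<partial>M)"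
    by (rule nn_integral_cond_law[OF K law]) measurable
  also have "\<dots> = (\<integral>\<^sup>+\<omega>. h (\<alpha> \<omega>) * ennreal (s (\<alpha> \<omega>)) \<partial>M)"
  proof (intro nn_integral_cong)
    fix \<omega> assume "\<omega> \<in> space M"
    then have a: "0 < \<alpha> \<omega>" "\<alpha> \<omega> < 1" using alpha_range by auto
    have "(\<Sum>x. h (\<alpha> \<omega>) * ennreal (f x (\<alpha> \<omega>)) * ennreal (poi x (\<rho> (\<alpha> \<omega>))))
        = h (\<alpha> \<omega>) * (\<Sum>x. ennreal (f x (\<alpha> \<omega>) * poi x (\<rho> (\<alpha> \<omega>))))"
      using f a \<rho> by (simp add: ennreal_mult poi_nonneg mult.assoc)
    also have "(\<Sum>x. ennreal (f x (\<alpha> \<omega>) * poi x (\<rho> (\<alpha> \<omega>)))) = ennreal (s (\<alpha> \<omega>))"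
      using f a \<rho> by (intro suminf_ennreal_sums s) (auto simp: poi_nonneg)
    finally show "(\<Sum>x. h (\<alpha> \<omega>) * ennreal (f x (\<alpha> \<omega>)) * ennreal (poi x (\<rho> (\<alpha> \<omega>))))
      = h (\<alpha> \<omega>) * ennreal (s (\<alpha> \<omega>))" .
  qed
  finally show ?thesis .
qed

text \<open>The conditional variance of a Poisson variable is its rate. The identity is stated in
  \<open>ennreal\<close> because for \<beta> = 0 and \<open>h\<close> constantly 1 both sides are
  infinite: the density of \<alpha> tends to \<open>\<psi>1 > 0\<close>, and
  \<open>1 / (1 - x)\<close> is not integrable at 1.\<close>

lemma X_variance:
  assumes [measurable]: "h \<in> borel_measurable borel"
  shows "(\<integral>\<^sup>+\<omega>. h (\<alpha> \<omega>) * ennreal ((real (X k \<omega>) - lam / (1 - \<alpha> \<omega>))\<^sup>2) \<partial>M)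
    = (\<integral>\<^sup>+\<omega>. h (\<alpha> \<omega>) * ennreal (lam / (1 - \<alpha> \<omega>)) \<partial>M)"
  using lambda_pos
  by (intro nn_integral_cond_poi[OF X_measurable X_law, where f="\<lambda>x p. (real x - lam / (1 - p))\<^sup>2"] sums_variance_poi) auto

lemma deaths_square:
  assumes [measurable]: "h \<in> borel_measurable borel"
  shows "(\<integral>\<^sup>+\<omega>. h (\<alpha> \<omega>) * ennreal ((real (deaths k \<omega>))\<^sup>2) \<partial>M)
    = (\<integral>\<^sup>+\<omega>. h (\<alpha> \<omega>) * ennreal (lam\<^sup>2 + lam) \<partial>M)"
  using lambda_pos
  by (intro nn_integral_cond_poi[OF deaths_measurable deaths_law, where f="\<lambda>x p. (real x)\<^sup>2"] sums_square_poi) auto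

lemma innovation_square:
  assumes [measurable]: "h \<in> borel_measurable borel" and "1 \<le> k"
  shows "(\<integral>\<^sup>+\<omega>. h (\<alpha> \<omega>) * ennreal ((real (\<epsilon> k \<omega>))\<^sup>2) \<partial>M)
    = (\<integral>\<^sup>+\<omega>. h (\<alpha> \<omega>) * ennreal (lam\<^sup>2 + lam) \<partial>M)"
  using lambda_pos assms(2)
  by (intro nn_integral_cond_poi[OF _ innovation_law[OF assms(2)], where f="\<lambda>x p. (real x)\<^sup>2"] sums_square_poi) auto

lemma has_bochner_integral_poi:
  assumes [measurable]: "K \<in> M \<rightarrow>\<^sub>M count_space UNIV"
    and "\<And>x. has_cond_prob {\<omega> \<in> space M. K \<omega> = x} (\<lambda>p. ennreal (poi x lam))"
  shows "has_bochner_integral M (\<lambda>\<omega>. real (K \<omega>)) lam"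
proof (rule has_bochner_integral_nn_integral)
  have "(\<integral>\<^sup>+\<omega>. 1 * ennreal (real (K \<omega>)) \<partial>M) = (\<integral>\<^sup>+\<omega>. 1 * ennreal lam \<partial>M)"
    using lambda_pos
    by (intro nn_integral_cond_poi[OF assms, where f="\<lambda>x p. real x" and h="\<lambda>_. 1"] sums_mult_poi) auto
  then show "(\<integral>\<^sup>+\<omega>. ennreal (real (K \<omega>)) \<partial>M) = ennreal lam"
    by (simp add: emeasure_space_1)
qed (use lambda_pos in auto)

section \<open>Increments and displacements\<close>

lemma AE_increment: "AE \<omega> in M. real (X (Suc k) \<omega>) - real (X k \<omega>) = real (\<epsilon> (Suc k) \<omega>) - real (deaths k \<omega>)"
  using AE_survivors[of k] by eventually_elim linarith

text \<open>Survivors cancel in \<open>X (Suc k) - X k\<close>, leaving innovations minus deaths,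
  two variables with the same integrable Poisson(\<open>lam\<close>) law.\<close>

lemma increment_mean: "has_bochner_integral M (\<lambda>\<omega>. real (X (Suc k) \<omega>) - real (X k \<omega>)) 0"
proof -
  have "has_bochner_integral M (\<lambda>\<omega>. real (\<epsilon> (Suc k) \<omega>) - real (deaths k \<omega>)) (lam - lam)"
    by (intro has_bochner_integral_diff has_bochner_integral_poi innovation_law deaths_law) auto
  then show ?thesis
    using AE_increment[of k]
    by (subst has_bochner_integral_cong_AE[where g="\<lambda>\<omega>. real (\<epsilon> (Suc k) \<omega>) - real (deaths k \<omega>)"])
       (auto simp del: inar1.simps)
qed

text \<open>For \<beta> = 0 the variables \<open>X k\<close> and \<open>X 0\<close> are not
  integrable, so mean 0 cannot be obtained by subtracting equal means; it comes from telescoping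
  integrable increments.\<close>

lemma displacement_mean: "has_bochner_integral M (\<lambda>\<omega>. real (X k \<omega>) - real (X 0 \<omega>)) 0"
proof -
  have "has_bochner_integral M (\<lambda>\<omega>. \<Sum>i<k. real (X (Suc i) \<omega>) - real (X i \<omega>)) (\<Sum>i<k. 0)"
    by (intro has_bochner_integral_sum increment_mean)
  moreover have "(\<Sum>i<k. real (X (Suc i) \<omega>) - real (X i \<omega>)) = real (X k \<omega>) - real (X 0 \<omega>)" for \<omega>
    by (rule sum_lessThan_telescope)
  ultimately show ?thesis by (simp del: inar1.simps)
qed

lemma increment_square_le:
  assumes [measurable]: "h \<in> borel_measurable borel"
  shows "(\<integral>\<^sup>+\<omega>. h (\<alpha> \<omega>) * ennreal ((real (X (Suc k) \<omega>) - real (X k \<omega>))\<^sup>2) \<partial>M)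
    \<le> ennreal (2 * (lam\<^sup>2 + lam)) * (\<integral>\<^sup>+\<omega>. h (\<alpha> \<omega>) \<partial>M)"
proof -
  have "(\<integral>\<^sup>+\<omega>. h (\<alpha> \<omega>) * ennreal ((real (X (Suc k) \<omega>) - real (X k \<omega>))\<^sup>2) \<partial>M)
    \<le> (\<integral>\<^sup>+\<omega>. h (\<alpha> \<omega>) * ennreal ((real (\<epsilon> (Suc k) \<omega>))\<^sup>2) + h (\<alpha> \<omega>) * ennreal ((real (deaths k \<omega>))\<^sup>2) \<partial>M)"
  proof (rule nn_integral_mono_AE)
    show "AE \<omega> in M. h (\<alpha> \<omega>) * ennreal ((real (X (Suc k) \<omega>) - real (X k \<omega>))\<^sup>2)
      \<le> h (\<alpha> \<omega>) * ennreal ((real (\<epsilon> (Suc k) \<omega>))\<^sup>2) + h (\<alpha> \<omega>) * ennreal ((real (deaths k \<omega>))\<^sup>2)"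
      using AE_increment[of k]
    proof eventually_elim
      case (elim \<omega>)
      \<comment> \<open>Both counts are nonnegative, so the cross term of the square is at most
        0.\<close>
      have "(real (\<epsilon> (Suc k) \<omega>) - real (deaths k \<omega>))\<^sup>2 \<le> (real (\<epsilon> (Suc k) \<omega>))\<^sup>2 + (real (deaths k \<omega>))\<^sup>2"
        by (simp add: power2_diff)
      then have "h (\<alpha> \<omega>) * ennreal ((real (\<epsilon> (Suc k) \<omega>) - real (deaths k \<omega>))\<^sup>2)
          \<le> h (\<alpha> \<omega>) * ennreal ((real (\<epsilon> (Suc k) \<omega>))\<^sup>2 + (real (deaths k \<omega>))\<^sup>2)"
        by (intro mult_left_mono ennreal_leI) auto
      then show ?case unfolding elim by (simp add: distrib_left)
    qed
  qed
  also have "\<dots> = (\<integral>\<^sup>+\<omega>. h (\<alpha> \<omega>) * ennreal (lam\<^sup>2 + lam) \<partial>M) + (\<integral>\<^sup>+\<omega>. h (\<alpha> \<omega>) * ennreal (lam\<^sup>2 + lam) \<partial>M)"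
    by (subst nn_integral_add) (auto simp: deaths_square innovation_square)
  also have "\<dots> = ennreal (2 * (lam\<^sup>2 + lam)) * (\<integral>\<^sup>+\<omega>. h (\<alpha> \<omega>) \<partial>M)"
  proof -
    have "ennreal (2 * (lam\<^sup>2 + lam)) = ennreal (lam\<^sup>2 + lam) + ennreal (lam\<^sup>2 + lam)"
      using lambda_pos by (subst ennreal_plus[symmetric]) auto
    then show ?thesis by (simp add: nn_integral_multc distrib_left mult.commute)
  qed
  finally show ?thesis .
qed

text \<open>Cauchy-Schwarz over \<open>k\<close> increments of uniformly bounded second moment. The
  bound does not degrade as \<alpha> approaches 1, where the stationary variance blows up.\<close>

lemma displacement_square_le:
  assumes [measurable]: "h \<in> borel_measurable borel"
  shows "(\<integral>\<^sup>+\<omega>. h (\<alpha> \<omega>) * ennreal ((real (X k \<omega>) - real (X 0 \<omega>))\<^sup>2) \<partial>M)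
    \<le> ennreal (2 * (lam\<^sup>2 + lam) * (real k)\<^sup>2) * (\<integral>\<^sup>+\<omega>. h (\<alpha> \<omega>) \<partial>M)"
proof -
  let ?d = "\<lambda>i \<omega>. real (X (Suc i) \<omega>) - real (X i \<omega>)"
  have "(\<integral>\<^sup>+\<omega>. h (\<alpha> \<omega>) * ennreal ((real (X k \<omega>) - real (X 0 \<omega>))\<^sup>2) \<partial>M)
      \<le> (\<integral>\<^sup>+\<omega>. ennreal (real k) * (\<Sum>i<k. h (\<alpha> \<omega>) * ennreal ((?d i \<omega>)\<^sup>2)) \<partial>M)"
  proof (rule nn_integral_mono)
    fix \<omega>
    have "(real (X k \<omega>) - real (X 0 \<omega>))\<^sup>2 = (\<Sum>i<k. ?d i \<omega>)\<^sup>2"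
      by (subst sum_lessThan_telescope) (rule refl)
    also have "\<dots> \<le> real k * (\<Sum>i<k. (?d i \<omega>)\<^sup>2)"
      using sum_squared_le_sum_of_squares[of "\<lambda>i. ?d i \<omega>" "{..<k}"]
      by (simp add: mult.commute del: inar1.simps)
    finally have "h (\<alpha> \<omega>) * ennreal ((real (X k \<omega>) - real (X 0 \<omega>))\<^sup>2)
      \<le> h (\<alpha> \<omega>) * ennreal (real k * (\<Sum>i<k. (?d i \<omega>)\<^sup>2))"
      by (intro mult_left_mono ennreal_leI) auto
    also have "\<dots> = ennreal (real k) * (\<Sum>i<k. h (\<alpha> \<omega>) * ennreal ((?d i \<omega>)\<^sup>2))"
      by (simp add: ennreal_mult sum_nonneg sum_ennreal[symmetric] sum_distrib_left mult_ac del: inar1.simps)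
    finally show "h (\<alpha> \<omega>) * ennreal ((real (X k \<omega>) - real (X 0 \<omega>))\<^sup>2)
      \<le> ennreal (real k) * (\<Sum>i<k. h (\<alpha> \<omega>) * ennreal ((?d i \<omega>)\<^sup>2))" .
  qed
  also have "\<dots> = ennreal (real k) * (\<Sum>i<k. \<integral>\<^sup>+\<omega>. h (\<alpha> \<omega>) * ennreal ((?d i \<omega>)\<^sup>2) \<partial>M)"
    by (simp add: nn_integral_cmult nn_integral_sum del: inar1.simps)
  also have "\<dots> \<le> ennreal (real k) * (\<Sum>i<k. ennreal (2 * (lam\<^sup>2 + lam)) * (\<integral>\<^sup>+\<omega>. h (\<alpha> \<omega>) \<partial>M))"
    by (intro mult_left_mono sum_mono increment_square_le) auto
  also have "\<dots> = ennreal (2 * (lam\<^sup>2 + lam) * (real k)\<^sup>2) * (\<integral>\<^sup>+\<omega>. h (\<alpha> \<omega>) \<partial>M)"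
    using lambda_pos
    by (simp add: ennreal_mult ennreal_of_nat_eq_real_of_nat power2_eq_square mult_ac)
  finally show ?thesis .
qed

text \<open>Both ends are compared with their common conditional mean, each contributing twice the
  stationary variance. The bound is uniform in \<open>k\<close> and complements
  \<open>displacement_square_le\<close> away from 1.\<close>

lemma displacement_square_le':
  assumes [measurable]: "h \<in> borel_measurable borel"
  shows "(\<integral>\<^sup>+\<omega>. h (\<alpha> \<omega>) * ennreal ((real (X k \<omega>) - real (X 0 \<omega>))\<^sup>2) \<partial>M)
    \<le> 4 * (\<integral>\<^sup>+\<omega>. h (\<alpha> \<omega>) * ennreal (lam / (1 - \<alpha> \<omega>)) \<partial>M)"
proof -
  let ?c = "\<lambda>i \<omega>. real (X i \<omega>) - lam / (1 - \<alpha> \<omega>)"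
  have "(\<integral>\<^sup>+\<omega>. h (\<alpha> \<omega>) * ennreal ((real (X k \<omega>) - real (X 0 \<omega>))\<^sup>2) \<partial>M)
      \<le> (\<integral>\<^sup>+\<omega>. 2 * (h (\<alpha> \<omega>) * ennreal ((?c k \<omega>)\<^sup>2)) + 2 * (h (\<alpha> \<omega>) * ennreal ((?c 0 \<omega>)\<^sup>2)) \<partial>M)"
  proof (rule nn_integral_mono)
    fix \<omega>
    have "(real (X k \<omega>) - real (X 0 \<omega>))\<^sup>2 = (?c k \<omega> - ?c 0 \<omega>)\<^sup>2" by simp
    also have "\<dots> \<le> 2 * (?c k \<omega>)\<^sup>2 + 2 * (?c 0 \<omega>)\<^sup>2"
      by (rule power2_diff_le)
    finally have "h (\<alpha> \<omega>) * ennreal ((real (X k \<omega>) - real (X 0 \<omega>))\<^sup>2)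
      \<le> h (\<alpha> \<omega>) * ennreal (2 * (?c k \<omega>)\<^sup>2 + 2 * (?c 0 \<omega>)\<^sup>2)"
      by (intro mult_left_mono ennreal_leI) auto
    then show "h (\<alpha> \<omega>) * ennreal ((real (X k \<omega>) - real (X 0 \<omega>))\<^sup>2)
      \<le> 2 * (h (\<alpha> \<omega>) * ennreal ((?c k \<omega>)\<^sup>2)) + 2 * (h (\<alpha> \<omega>) * ennreal ((?c 0 \<omega>)\<^sup>2))"
      by (simp add: ennreal_mult distrib_left mult_ac del: inar1.simps)
  qed
  also have "\<dots> = 2 * (\<integral>\<^sup>+\<omega>. h (\<alpha> \<omega>) * ennreal ((?c k \<omega>)\<^sup>2) \<partial>M) + 2 * (\<integral>\<^sup>+\<omega>. h (\<alpha> \<omega>) * ennreal ((?c 0 \<omega>)\<^sup>2) \<partial>M)"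
    by (simp add: nn_integral_add nn_integral_cmult del: inar1.simps)
  also have "\<dots> = 4 * (\<integral>\<^sup>+\<omega>. h (\<alpha> \<omega>) * ennreal (lam / (1 - \<alpha> \<omega>)) \<partial>M)"
    unfolding X_variance[OF assms] distrib_right[symmetric] by simp
  finally show ?thesis .
qed

section \<open>Characteristic function of the centred initial value\<close>

lemma integrable_norm_le_1:
  fixes f :: "'a \<Rightarrow> complex"
  assumes "f \<in> borel_measurable M" "\<And>\<omega>. \<omega> \<in> space M \<Longrightarrow> norm (f \<omega>) \<le> 1"
  shows "integrable M f"
  using assms by (intro integrable_const_bound[of _ 1]) auto

text \<open>Given \<alpha> the initial value is Poisson, whose characteristic series sums to an
  exponential; centring contributes the term \<open>\<i> * u\<close> of \<open>z\<close>. The work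
  lies in exchanging sum and integral for complex integrands, both before and after the events are
  replaced by their weights.\<close>

lemma char_centred:
  fixes u :: real
  defines "z \<equiv> complex_of_real lam * (1 + \<i> * u - iexp u)"
  shows "(\<integral>\<omega>. iexp (u * (real (X0 \<omega>) - lam / (1 - \<alpha> \<omega>))) \<partial>M) = (\<integral>\<omega>. exp (- z / (1 - \<alpha> \<omega>)) \<partial>M)"
proof -
  let ?E = "\<lambda>x. {\<omega> \<in> space M. X0 \<omega> = x}"
  let ?g = "\<lambda>x p. iexp (u * (real x - lam / (1 - p)))"
  have X0: "has_cond_prob (?E x) (\<lambda>p. ennreal (poi x (lam / (1 - p))))" for x
    using X_law[of 0 x] by simp
  have [measurable]: "?E x \<in> sets M" for x by measurable
  have norm_E: "(\<lambda>x. norm (indicator (?E x) \<omega> *\<^sub>R ?g x (\<alpha> \<omega>))) sums 1" if "\<omega> \<in> space M" for \<omega>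
  proof -
    have "(\<lambda>x. if x \<in> {X0 \<omega>} then 1 else 0 :: real) sums (\<Sum>x\<in>{X0 \<omega>}. 1)"
      by (rule sums_If_finite_set) auto
    also have "(\<lambda>x. if x \<in> {X0 \<omega>} then 1 else 0 :: real) = (\<lambda>x. norm (indicator (?E x) \<omega> *\<^sub>R ?g x (\<alpha> \<omega>)))"
      using that by (auto simp: fun_eq_iff)
    finally show ?thesis by simp
  qed
  have norm_p: "(\<lambda>x. norm (poi x (lam / (1 - \<alpha> \<omega>)) *\<^sub>R ?g x (\<alpha> \<omega>))) sums 1" if "\<omega> \<in> space M" for \<omega>
    using poi_sums[of "lam / (1 - \<alpha> \<omega>)"] alpha_range[OF that] lambda_pos
    by (simp add: poi_nonneg)
  have int_E: "integrable M (\<lambda>\<omega>. indicator (?E x) \<omega> *\<^sub>R ?g x (\<alpha> \<omega>))" for x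
    by (intro integrable_norm_le_1) (auto simp: indicator_def)
  have poi_le: "poi x (lam / (1 - \<alpha> \<omega>)) \<le> 1" "0 \<le> poi x (lam / (1 - \<alpha> \<omega>))" if "\<omega> \<in> space M" for x \<omega>
  proof -
    have nn: "0 \<le> poi i (lam / (1 - \<alpha> \<omega>))" for i
      using alpha_range[OF that] lambda_pos by (simp add: poi_nonneg)
    then show "poi x (lam / (1 - \<alpha> \<omega>)) \<le> 1" "0 \<le> poi x (lam / (1 - \<alpha> \<omega>))"
      using sum_le_suminf[OF sums_summable[OF poi_sums[of "lam / (1 - \<alpha> \<omega>)"]], of "{x}"]
        sums_unique[OF poi_sums[of "lam / (1 - \<alpha> \<omega>)"]] by auto
  qed
  have int_p: "integrable M (\<lambda>\<omega>. poi x (lam / (1 - \<alpha> \<omega>)) *\<^sub>R ?g x (\<alpha> \<omega>))" for x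
    by (intro integrable_norm_le_1) (auto simp: poi_le)
  \<comment> \<open>Total mass 1 supplies the domination: for each \<omega> the norms of the terms
    add up to 1.\<close>
  have bnd_E: "summable (\<lambda>x. \<integral>\<omega>. norm (indicator (?E x) \<omega> *\<^sub>R ?g x (\<alpha> \<omega>)) \<partial>M)"
  proof -
    have "(\<Sum>x. ennreal (\<integral>\<omega>. norm (indicator (?E x) \<omega> *\<^sub>R ?g x (\<alpha> \<omega>)) \<partial>M))
        = (\<Sum>x. \<integral>\<^sup>+\<omega>. norm (indicator (?E x) \<omega> *\<^sub>R ?g x (\<alpha> \<omega>)) \<partial>M)"
      by (intro suminf_cong nn_integral_eq_integral[symmetric] integrable_norm int_E AE_I2 norm_ge_zero)
    also have "\<dots> = (\<integral>\<^sup>+\<omega>. (\<Sum>x. ennreal (norm (indicator (?E x) \<omega> *\<^sub>R ?g x (\<alpha> \<omega>)))) \<partial>M)"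
      by (rule nn_integral_suminf[symmetric]) measurable
    also have "\<dots> = (\<integral>\<^sup>+\<omega>. ennreal 1 \<partial>M)"
      by (intro nn_integral_cong suminf_ennreal_sums norm_E) auto
    finally show ?thesis
      by (intro summable_suminf_not_top) (auto simp: emeasure_space_1)
  qed
  have bnd_p: "summable (\<lambda>x. \<integral>\<omega>. norm (poi x (lam / (1 - \<alpha> \<omega>)) *\<^sub>R ?g x (\<alpha> \<omega>)) \<partial>M)"
  proof -
    have "(\<Sum>x. ennreal (\<integral>\<omega>. norm (poi x (lam / (1 - \<alpha> \<omega>)) *\<^sub>R ?g x (\<alpha> \<omega>)) \<partial>M))
        = (\<Sum>x. \<integral>\<^sup>+\<omega>. norm (poi x (lam / (1 - \<alpha> \<omega>)) *\<^sub>R ?g x (\<alpha> \<omega>)) \<partial>M)"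
      by (intro suminf_cong nn_integral_eq_integral[symmetric] integrable_norm int_p AE_I2 norm_ge_zero)
    also have "\<dots> = (\<integral>\<^sup>+\<omega>. (\<Sum>x. ennreal (norm (poi x (lam / (1 - \<alpha> \<omega>)) *\<^sub>R ?g x (\<alpha> \<omega>)))) \<partial>M)"
      by (rule nn_integral_suminf[symmetric]) measurable
    also have "\<dots> = (\<integral>\<^sup>+\<omega>. ennreal 1 \<partial>M)"
      by (intro nn_integral_cong suminf_ennreal_sums norm_p) auto
    finally show ?thesis
      by (intro summable_suminf_not_top) (auto simp: emeasure_space_1)
  qed
  have "(\<integral>\<omega>. iexp (u * (real (X0 \<omega>) - lam / (1 - \<alpha> \<omega>))) \<partial>M) = (\<integral>\<omega>. (\<Sum>x. indicator (?E x) \<omega> *\<^sub>R ?g x (\<alpha> \<omega>)) \<partial>M)"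
  proof (intro Bochner_Integration.integral_cong refl)
    fix \<omega> assume "\<omega> \<in> space M"
    then show "iexp (u * (real (X0 \<omega>) - lam / (1 - \<alpha> \<omega>))) = (\<Sum>x. indicator (?E x) \<omega> *\<^sub>R ?g x (\<alpha> \<omega>))"
      by (subst suminf_finite[of "{X0 \<omega>}"]) auto
  qed
  also have "\<dots> = (\<Sum>x. \<integral>\<omega>. indicator (?E x) \<omega> *\<^sub>R ?g x (\<alpha> \<omega>) \<partial>M)"
    using norm_E by (intro integral_suminf int_E bnd_E AE_I2) (auto dest: sums_summable)
  also have "\<dots> = (\<Sum>x. \<integral>\<omega>. poi x (lam / (1 - \<alpha> \<omega>)) *\<^sub>R ?g x (\<alpha> \<omega>) \<partial>M)"
    using lambda_pos by (intro suminf_cong has_cond_prob_integral X0) (auto simp: poi_nonneg)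
  also have "\<dots> = (\<integral>\<omega>. (\<Sum>x. poi x (lam / (1 - \<alpha> \<omega>)) *\<^sub>R ?g x (\<alpha> \<omega>)) \<partial>M)"
    using norm_p by (intro integral_suminf[symmetric] int_p bnd_p AE_I2) (auto dest: sums_summable)
  also have "\<dots> = (\<integral>\<omega>. exp (- z / (1 - \<alpha> \<omega>)) \<partial>M)"
  proof (intro Bochner_Integration.integral_cong refl)
    fix \<omega> assume "\<omega> \<in> space M"
    define \<mu> where "\<mu> = lam / (1 - \<alpha> \<omega>)"
    have eq: "poi x \<mu> *\<^sub>R ?g x (\<alpha> \<omega>) = exp (- \<mu> - \<i> * u * \<mu>) * ((complex_of_real \<mu> * iexp u) ^ x /\<^sub>R fact x)" for x
    proof -
      have "?g x (\<alpha> \<omega>) = iexp u ^ x * exp (- \<i> * u * \<mu>)"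
        by (simp add: \<mu>_def exp_of_nat_mult[symmetric] exp_add[symmetric] algebra_simps)
      then show ?thesis
        by (simp add: poi_def scaleR_conv_of_real power_mult_distrib exp_diff exp_minus exp_of_real field_simps)
    qed
    have "(\<lambda>x. poi x \<mu> *\<^sub>R ?g x (\<alpha> \<omega>)) sums (exp (- \<mu> - \<i> * u * \<mu>) * exp (complex_of_real \<mu> * iexp u))"
      unfolding eq by (intro sums_mult exp_converges)
    also have "exp (- \<mu> - \<i> * u * \<mu>) * exp (complex_of_real \<mu> * iexp u) = exp (- z / (1 - \<alpha> \<omega>))"
      unfolding exp_add[symmetric] by (simp add: z_def \<mu>_def algebra_simps diff_divide_distrib add_divide_distrib)
    finally show "(\<Sum>x. poi x (lam / (1 - \<alpha> \<omega>)) *\<^sub>R ?g x (\<alpha> \<omega>)) = exp (- z / (1 - \<alpha> \<omega>))"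
      by (simp add: \<mu>_def sums_iff)
  qed
  finally show ?thesis .
qed

end

section \<open>Behaviour of the thinning parameter near 1\<close>

lemma nn_integral_inverse_Icc:
  fixes a b :: real
  assumes "a \<le> b" "b < 1"
  shows "(\<integral>\<^sup>+x. ennreal (1 / (1 - x)) * indicator {a..b} x \<partial>lborel) = ennreal (ln (1 - a) - ln (1 - b))"
proof -
  have "(\<integral>\<^sup>+x. ennreal (1 / (1 - x)) * indicator {a..b} x \<partial>lborel) = ennreal ((- ln (1 - b)) - (- ln (1 - a)))"
    using assms by (intro nn_integral_FTC_Icc) (auto intro!: derivative_eq_intros)
  then show ?thesis by simp
qed

lemma nn_integral_inverse_square_Icc:
  fixes a b :: real
  assumes "a \<le> b" "b < 1"
  shows "(\<integral>\<^sup>+x. ennreal (1 / (1 - x)\<^sup>2) * indicator {a..b} x \<partial>lborel) = ennreal (1 / (1 - b) - 1 / (1 - a))"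
proof (rule nn_integral_FTC_Icc)
  fix x assume "x \<in> {a..b}"
  then show "((\<lambda>x. 1 / (1 - x)) has_real_derivative 1 / (1 - x)\<^sup>2) (at x)"
    using assms by (auto intro!: derivative_eq_intros simp: power2_eq_square)
qed (use assms in auto)

text \<open>On the half plane of nonpositive real part the exponential and its derivatives have
  modulus at most 1, so the Taylor remainder carries no growth factor. This matters because
  \<open>z / (1 - \<alpha> \<omega>)\<close> need not be small.\<close>

lemma exp_minus_one_minus_bound:
  fixes w :: complex
  assumes "0 \<le> Re w"
  shows "norm (1 - exp (- w) - w) \<le> (norm w)\<^sup>2"
proof -
  have "norm (exp (- w) - (\<Sum>i\<le>1. exp 0 * (- w - 0) ^ i / fact i)) \<le> 1 * norm (- w - 0) ^ Suc 1 / fact 1"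
  proof (rule complex_Taylor[where S="{z. Re z \<le> 0}" and f="\<lambda>_. exp"])
    show "convex {z. Re z \<le> 0}" by (rule convex_halfspace_Re_le)
  qed (use assms in \<open>auto intro!: derivative_eq_intros DERIV_subset[OF DERIV_exp]\<close>)
  then have "norm (exp (- w) - 1 + w) \<le> (norm w)\<^sup>2"
    by (simp add: power2_eq_square algebra_simps)
  moreover have "norm (1 - exp (- w) - w) = norm (exp (- w) - 1 + w)"
    by (subst norm_minus_cancel[symmetric]) (simp add: algebra_simps)
  ultimately show ?thesis by simp
qed

locale critical_inar1 = randomized_inar1 M lam 0 \<psi>1 \<psi> \<alpha> X0 \<xi> \<epsilon>
  for M :: "'a measure" and lam \<psi>1 \<psi> \<alpha> X0 \<xi> \<epsilon>
begin

section \<open>Mass and truncated moments of the thinning parameter near 1\<close>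

definition dens :: "real \<Rightarrow> ennreal" where
  "dens x = ennreal (\<psi> x * (1 - x) powr 0 * indicator {0<..<1} x)"

lemma dens_measurable [measurable]: "dens \<in> borel_measurable borel"
  using distributed_borel_measurable[OF alpha_density] by (simp add: dens_def[abs_def])

lemma dens_eq: "x \<in> {0<..<1} \<Longrightarrow> dens x = ennreal (\<psi> x)"
  by (simp add: dens_def)

lemma nn_integral_alpha:
  "g \<in> borel_measurable borel \<Longrightarrow> (\<integral>\<^sup>+\<omega>. g (\<alpha> \<omega>) \<partial>M) = (\<integral>\<^sup>+x. dens x * g x \<partial>lborel)"
  using distributed_nn_integral[OF alpha_density, of g] by (simp add: dens_def)

lemma psi_near_1:
  assumes "0 < e"
  obtains \<delta> where "0 < \<delta>" "\<delta> < 1" "\<And>x. 1 - \<delta> \<le> x \<Longrightarrow> x < 1 \<Longrightarrow> \<bar>\<psi> x - \<psi>1\<bar> < e"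
proof -
  have "\<forall>\<^sub>F x in at_left 1. dist (\<psi> x) \<psi>1 < e"
    using psi_limit assms by (rule tendstoD)
  then obtain b where b: "b < 1" "\<And>x. b < x \<Longrightarrow> x < 1 \<Longrightarrow> dist (\<psi> x) \<psi>1 < e"
    unfolding eventually_at_left_field by auto
  \<comment> \<open>Half of the gap \<open>1 - b\<close> puts \<open>1 - \<delta>\<close> strictly
    above \<open>b\<close>, so the estimate includes the left endpoint; \<open>1 / 2\<close> keeps
    \<delta> below 1.\<close>
  define \<delta> where "\<delta> = min (1 / 2) ((1 - b) / 2)"
  have "0 < \<delta>" "\<delta> < 1" "b < 1 - \<delta>" using b(1) by (auto simp: \<delta>_def min_def field_simps)
  then show ?thesis using b(2) by (intro that[of \<delta>]) (auto simp: dist_real_def)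
qed

text \<open>\<psi> is controlled only near 1 and may be unbounded elsewhere; there a bound on
  \<open>g\<close> is enough, because \<alpha> has total mass 1. Near 1 the law of \<alpha> is
  compared with Lebesgue measure.\<close>

lemma nn_integral_alpha_le:
  assumes [measurable]: "g \<in> borel_measurable borel"
    and \<delta>: "0 < \<delta>" "\<delta> < 1" and "0 \<le> c" "0 \<le> B"
    and \<psi>: "\<And>x. 1 - \<delta> \<le> x \<Longrightarrow> x < 1 \<Longrightarrow> \<psi> x \<le> c"
    and B: "\<And>x. 0 < x \<Longrightarrow> x < 1 - \<delta> \<Longrightarrow> g x \<le> ennreal B"
  shows "(\<integral>\<^sup>+\<omega>. g (\<alpha> \<omega>) \<partial>M) \<le> ennreal c * (\<integral>\<^sup>+x. g x * indicator {0..1} x \<partial>lborel) + ennreal B"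
proof -
  have "(\<integral>\<^sup>+\<omega>. g (\<alpha> \<omega>) \<partial>M) \<le> (\<integral>\<^sup>+\<omega>. g (\<alpha> \<omega>) * indicator {1 - \<delta>..} (\<alpha> \<omega>) + ennreal B \<partial>M)"
    using B alpha_range by (intro nn_integral_mono) (auto simp: indicator_def)
  also have "\<dots> = (\<integral>\<^sup>+\<omega>. g (\<alpha> \<omega>) * indicator {1 - \<delta>..} (\<alpha> \<omega>) \<partial>M) + ennreal B"
    by (subst nn_integral_add) (auto simp: emeasure_space_1)
  also have "(\<integral>\<^sup>+\<omega>. g (\<alpha> \<omega>) * indicator {1 - \<delta>..} (\<alpha> \<omega>) \<partial>M)
      = (\<integral>\<^sup>+x. dens x * (g x * indicator {1 - \<delta>..} x) \<partial>lborel)"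
    by (rule nn_integral_alpha) measurable
  also have "\<dots> \<le> (\<integral>\<^sup>+x. ennreal c * (g x * indicator {0..1} x) \<partial>lborel)"
  proof (intro nn_integral_mono)
    fix x
    show "dens x * (g x * indicator {1 - \<delta>..} x) \<le> ennreal c * (g x * indicator {0..1} x)"
    proof (cases "1 - \<delta> \<le> x \<and> x < 1")
      case True
      then have "dens x \<le> ennreal c" using \<psi>[of x] \<delta> by (auto simp: dens_eq intro!: ennreal_leI)
      then show ?thesis using True \<delta> by (auto intro!: mult_right_mono)
    qed (auto simp: dens_def indicator_def)
  qed
  also have "\<dots> = ennreal c * (\<integral>\<^sup>+x. g x * indicator {0..1} x \<partial>lborel)"
    by (rule nn_integral_cmult) measurable
  finally show ?thesis by simp
qed

text \<open>Near 1 the density is below \<open>\<psi>1 + 1\<close>, which contributes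
  \<open>(\<psi>1 + 1) * s\<close>. If \<open>1 - s < x < 1 - \<delta>\<close> for some
  \<open>x\<close>, then \<open>s > \<delta>\<close>, and the trivial bound 1 is at most
  \<open>s / \<delta>\<close>; so one constant serves all positive \<open>s\<close>.\<close>

lemma alpha_tail:
  "\<exists>C>0. \<forall>s>0. (\<integral>\<^sup>+\<omega>. indicator {1 - s<..} (\<alpha> \<omega>) \<partial>M) \<le> ennreal (C * s)"
proof -
  obtain \<delta> where \<delta>: "0 < \<delta>" "\<delta> < 1" "\<And>x. 1 - \<delta> \<le> x \<Longrightarrow> x < 1 \<Longrightarrow> \<bar>\<psi> x - \<psi>1\<bar> < 1"
    using psi_near_1[of 1] by auto
  define C where "C = (\<psi>1 + 1) + 1 / \<delta>"
  have "(\<integral>\<^sup>+\<omega>. indicator {1 - s<..} (\<alpha> \<omega>) \<partial>M) \<le> ennreal (C * s)" if s: "0 < s" for s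
  proof -
    have "(\<integral>\<^sup>+\<omega>. indicator {1 - s<..} (\<alpha> \<omega>) \<partial>M)
        \<le> ennreal (\<psi>1 + 1) * (\<integral>\<^sup>+x. indicator {1 - s<..} x * indicator {0..1} x \<partial>lborel) + ennreal (s / \<delta>)"
    proof (rule nn_integral_alpha_le[OF _ \<delta>(1,2)])
      show "\<psi> x \<le> \<psi>1 + 1" if "1 - \<delta> \<le> x" "x < 1" for x using \<delta>(3)[OF that] by auto
      show "(indicator {1 - s<..} x :: ennreal) \<le> ennreal (s / \<delta>)" if "0 < x" "x < 1 - \<delta>" for x
      proof (cases "1 - s < x")
        case True
        then have "1 \<le> s / \<delta>" using that \<delta> by (simp add: field_simps)
        then show ?thesis using ennreal_leI[of 1 "s / \<delta>"] by (simp add: indicator_def)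
      qed auto
    qed (use psi1_pos s \<delta> in auto)
    also have "(\<integral>\<^sup>+x. indicator {1 - s<..} x * indicator {0..1} x \<partial>lborel)
        \<le> (\<integral>\<^sup>+x. indicator {1 - s..1} x \<partial>(lborel :: real measure))"
      by (intro nn_integral_mono) (auto simp: indicator_def)
    also have "\<dots> = ennreal s" using s by simp
    finally have "(\<integral>\<^sup>+\<omega>. indicator {1 - s<..} (\<alpha> \<omega>) \<partial>M) \<le> ennreal (\<psi>1 + 1) * ennreal s + ennreal (s / \<delta>)"
      by (simp add: add_mono mult_left_mono)
    also have "\<dots> = ennreal (C * s)"
      using psi1_pos s \<delta> by (simp add: C_def ennreal_mult[symmetric] ennreal_plus[symmetric] algebra_simps del: ennreal_plus)
    finally show ?thesis .
  qed
  moreover have "0 < C" using psi1_pos \<delta> by (simp add: C_def add_pos_pos)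
  ultimately show ?thesis by blast
qed

text \<open>This measures the second-order Taylor error. Integrating
  \<open>1 / (1 - x)\<^sup>2\<close> up to \<open>1 - s\<close> gives less than
  \<open>1 / s\<close>, and the constant from the region away from 1 is absorbed because
  \<open>s \<le> 1\<close>.\<close>

lemma alpha_inverse_square:
  "\<exists>C>0. \<forall>s. 0 < s \<and> s \<le> 1 \<longrightarrow>
     (\<integral>\<^sup>+\<omega>. ennreal (1 / (1 - \<alpha> \<omega>)\<^sup>2) * indicator {..1 - s} (\<alpha> \<omega>) \<partial>M) \<le> ennreal (C / s)"
proof -
  obtain \<delta> where \<delta>: "0 < \<delta>" "\<delta> < 1" "\<And>x. 1 - \<delta> \<le> x \<Longrightarrow> x < 1 \<Longrightarrow> \<bar>\<psi> x - \<psi>1\<bar> < 1"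
    using psi_near_1[of 1] by auto
  define C where "C = (\<psi>1 + 1) + 1 / \<delta>\<^sup>2"
  have "(\<integral>\<^sup>+\<omega>. ennreal (1 / (1 - \<alpha> \<omega>)\<^sup>2) * indicator {..1 - s} (\<alpha> \<omega>) \<partial>M) \<le> ennreal (C / s)"
    if s: "0 < s" "s \<le> 1" for s
  proof -
    have "(\<integral>\<^sup>+\<omega>. ennreal (1 / (1 - \<alpha> \<omega>)\<^sup>2) * indicator {..1 - s} (\<alpha> \<omega>) \<partial>M)
        \<le> ennreal (\<psi>1 + 1) * (\<integral>\<^sup>+x. ennreal (1 / (1 - x)\<^sup>2) * indicator {..1 - s} x * indicator {0..1} x \<partial>lborel) + ennreal (1 / \<delta>\<^sup>2)"
    proof (rule nn_integral_alpha_le[OF _ \<delta>(1,2), where g="\<lambda>x. ennreal (1 / (1 - x)\<^sup>2) * indicator {..1 - s} x"])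
      show "\<psi> x \<le> \<psi>1 + 1" if "1 - \<delta> \<le> x" "x < 1" for x using \<delta>(3)[OF that] by auto
      show "ennreal (1 / (1 - x)\<^sup>2) * indicator {..1 - s} x \<le> ennreal (1 / \<delta>\<^sup>2)" if "0 < x" "x < 1 - \<delta>" for x
        using that \<delta> by (auto simp: indicator_def intro!: ennreal_leI frac_le power_mono)
    qed (use psi1_pos s \<delta> in auto)
    also have "(\<integral>\<^sup>+x. ennreal (1 / (1 - x)\<^sup>2) * indicator {..1 - s} x * indicator {0..1} x \<partial>lborel)
        \<le> (\<integral>\<^sup>+x. ennreal (1 / (1 - x)\<^sup>2) * indicator {0..1 - s} x \<partial>lborel)"
      by (intro nn_integral_mono) (auto simp: indicator_def)
    also have "\<dots> = ennreal (1 / s - 1)" using s by (subst nn_integral_inverse_square_Icc) auto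
    also have "\<dots> \<le> ennreal (1 / s)" by (intro ennreal_leI) auto
    finally have "(\<integral>\<^sup>+\<omega>. ennreal (1 / (1 - \<alpha> \<omega>)\<^sup>2) * indicator {..1 - s} (\<alpha> \<omega>) \<partial>M)
        \<le> ennreal (\<psi>1 + 1) * ennreal (1 / s) + ennreal (1 / \<delta>\<^sup>2)"
      by (simp add: add_mono mult_left_mono)
    also have "\<dots> = ennreal ((\<psi>1 + 1) / s + 1 / \<delta>\<^sup>2)"
      using psi1_pos s \<delta> by (simp add: ennreal_mult[symmetric] ennreal_plus[symmetric] del: ennreal_plus)
    also have "\<dots> \<le> ennreal (C / s)"
    proof (rule ennreal_leI)
      have "1 / \<delta>\<^sup>2 \<le> (1 / \<delta>\<^sup>2) / s" using s \<delta> by (simp add: field_simps)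
      then show "(\<psi>1 + 1) / s + 1 / \<delta>\<^sup>2 \<le> C / s" by (simp add: C_def add_divide_distrib)
    qed
    finally show ?thesis .
  qed
  moreover have "0 < C" using psi1_pos \<delta> by (simp add: C_def add_pos_pos)
  ultimately show ?thesis by blast
qed

text \<open>Truncation keeps \<open>1 - \<alpha>\<close> at least \<open>s\<close>. The logarithmic
  divergence of this quantity as \<open>s\<close> tends to 0 is the source of the factor
  \<open>ln N\<close> in the norming.\<close>

definition trunc_mean :: "real \<Rightarrow> real" where
  "trunc_mean s = (\<integral>\<omega>. 1 / (1 - \<alpha> \<omega>) * indicator {..1 - s} (\<alpha> \<omega>) \<partial>M)"

lemma integrable_trunc_mean:
  assumes "0 < s"
  shows "integrable M (\<lambda>\<omega>. 1 / (1 - \<alpha> \<omega>) * indicator {..1 - s} (\<alpha> \<omega>))"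
proof (rule integrable_const_bound[of _ "1 / s"])
  show "AE \<omega> in M. norm (1 / (1 - \<alpha> \<omega>) * indicator {..1 - s} (\<alpha> \<omega>)) \<le> 1 / s"
    using alpha_range assms by (intro AE_I2) (auto simp: indicator_def intro!: frac_le)
qed measurable

lemma trunc_mean_nonneg: "0 \<le> trunc_mean s"
  unfolding trunc_mean_def using alpha_range
  by (intro integral_nonneg_AE AE_I2) (auto simp: less_imp_le)

lemma nn_integral_trunc_mean:
  assumes "0 < s"
  shows "(\<integral>\<^sup>+\<omega>. ennreal (1 / (1 - \<alpha> \<omega>)) * indicator {..1 - s} (\<alpha> \<omega>) \<partial>M) = ennreal (trunc_mean s)"
proof -
  have "(\<integral>\<^sup>+\<omega>. ennreal (1 / (1 - \<alpha> \<omega>)) * indicator {..1 - s} (\<alpha> \<omega>) \<partial>M)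
      = (\<integral>\<^sup>+\<omega>. ennreal (1 / (1 - \<alpha> \<omega>) * indicator {..1 - s} (\<alpha> \<omega>)) \<partial>M)"
    by (intro nn_integral_cong) (auto simp: indicator_def)
  also have "\<dots> = ennreal (trunc_mean s)"
    unfolding trunc_mean_def using alpha_range
    by (intro nn_integral_eq_integral integrable_trunc_mean assms AE_I2) (auto simp: less_imp_le)
  finally show ?thesis .
qed

text \<open>Between \<open>1 - \<delta>\<close> and \<open>1 - s\<close> the density is within
  \<open>e\<close> of \<open>\<psi>1\<close>, and \<open>1 / (1 - x)\<close> integrates to
  \<open>ln \<delta> - ln s\<close>; the rest is bounded independently of \<open>s\<close>. The
  condition \<open>e \<le> \<psi>1\<close> keeps the lower bound of the density nonnegative, as a
  comparison in \<open>ennreal\<close> needs.\<close>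

lemma trunc_mean_bounds:
  assumes e: "0 < e" "e \<le> \<psi>1"
  shows "\<exists>K. \<forall>s. 0 < s \<and> s < 1 \<longrightarrow>
    trunc_mean s \<le> (\<psi>1 + e) * ln (1 / s) + K \<and> (\<psi>1 - e) * ln (1 / s) - K \<le> trunc_mean s"
proof -
  obtain \<delta> where \<delta>: "0 < \<delta>" "\<delta> < 1" "\<And>x. 1 - \<delta> \<le> x \<Longrightarrow> x < 1 \<Longrightarrow> \<bar>\<psi> x - \<psi>1\<bar> < e"
    using psi_near_1[OF e(1)] by auto
  \<comment> \<open>\<open>1 / \<delta>\<close> bounds the integrand below
    \<open>1 - \<delta>\<close> in the upper estimate; \<open>\<psi>1 * ln (1 / \<delta>)\<close>
    covers what the lower estimate loses by starting at \<open>1 - \<delta>\<close>.\<close>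
  define K where "K = 1 / \<delta> + \<psi>1 * ln (1 / \<delta>)"
  have ln\<delta>: "0 \<le> ln (1 / \<delta>)" using \<delta> by simp
  have upper: "trunc_mean s \<le> (\<psi>1 + e) * ln (1 / s) + 1 / \<delta>" if s: "0 < s" "s < 1" for s
  proof -
    have ln_s: "0 \<le> ln (1 / s)" using s by simp
    have "ennreal (trunc_mean s) = (\<integral>\<^sup>+\<omega>. ennreal (1 / (1 - \<alpha> \<omega>)) * indicator {..1 - s} (\<alpha> \<omega>) \<partial>M)"
      by (rule nn_integral_trunc_mean[OF s(1), symmetric])
    also have "\<dots> \<le> ennreal (\<psi>1 + e) * (\<integral>\<^sup>+x. ennreal (1 / (1 - x)) * indicator {..1 - s} x * indicator {0..1} x \<partial>lborel) + ennreal (1 / \<delta>)"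
    proof (rule nn_integral_alpha_le[OF _ \<delta>(1,2), where g="\<lambda>x. ennreal (1 / (1 - x)) * indicator {..1 - s} x"])
      show "\<psi> x \<le> \<psi>1 + e" if "1 - \<delta> \<le> x" "x < 1" for x using \<delta>(3)[OF that] by auto
      show "ennreal (1 / (1 - x)) * indicator {..1 - s} x \<le> ennreal (1 / \<delta>)" if "0 < x" "x < 1 - \<delta>" for x
        using that \<delta> by (auto simp: indicator_def intro!: ennreal_leI frac_le)
    qed (use psi1_pos e s \<delta> in auto)
    also have "(\<integral>\<^sup>+x. ennreal (1 / (1 - x)) * indicator {..1 - s} x * indicator {0..1} x \<partial>lborel)
        \<le> (\<integral>\<^sup>+x. ennreal (1 / (1 - x)) * indicator {0..1 - s} x \<partial>lborel)"
      by (intro nn_integral_mono) (auto simp: indicator_def)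
    also have "\<dots> = ennreal (ln (1 / s))"
      using s by (subst nn_integral_inverse_Icc) (auto simp: ln_div)
    finally have "ennreal (trunc_mean s) \<le> ennreal (\<psi>1 + e) * ennreal (ln (1 / s)) + ennreal (1 / \<delta>)"
      by (simp add: add_mono mult_left_mono)
    also have "\<dots> = ennreal ((\<psi>1 + e) * ln (1 / s) + 1 / \<delta>)"
      using psi1_pos e \<delta> ln_s by (simp only: ennreal_mult[symmetric] ennreal_plus[symmetric] mult_nonneg_nonneg
        add_nonneg_nonneg less_imp_le zero_le_divide_1_iff)
    finally show ?thesis
      using psi1_pos e \<delta> ln_s by (subst (asm) ennreal_le_iff) auto
  qed
  have lower: "(\<psi>1 - e) * (ln (1 / s) - ln (1 / \<delta>)) \<le> trunc_mean s" if s: "0 < s" "s < 1" for s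
  proof (cases "s \<le> \<delta>")
    case True
    have "ennreal ((\<psi>1 - e) * (ln (1 / s) - ln (1 / \<delta>))) = ennreal (\<psi>1 - e) * ennreal (ln \<delta> - ln s)"
      using True e s \<delta> by (subst ennreal_mult[symmetric]) (auto simp: ln_div)
    also have "ennreal (ln \<delta> - ln s) = (\<integral>\<^sup>+x. ennreal (1 / (1 - x)) * indicator {1 - \<delta>..1 - s} x \<partial>lborel)"
      using True s \<delta> by (subst nn_integral_inverse_Icc) auto
    also have "ennreal (\<psi>1 - e) * \<dots> = (\<integral>\<^sup>+x. ennreal (\<psi>1 - e) * (ennreal (1 / (1 - x)) * indicator {1 - \<delta>..1 - s} x) \<partial>lborel)"
      by (rule nn_integral_cmult[symmetric]) measurable
    also have "\<dots> \<le> (\<integral>\<^sup>+x. dens x * (ennreal (1 / (1 - x)) * indicator {..1 - s} x) \<partial>lborel)"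
    proof (intro nn_integral_mono)
      fix x
      show "ennreal (\<psi>1 - e) * (ennreal (1 / (1 - x)) * indicator {1 - \<delta>..1 - s} x)
        \<le> dens x * (ennreal (1 / (1 - x)) * indicator {..1 - s} x)"
      proof (cases "x \<in> {1 - \<delta>..1 - s}")
        case x: True
        then have "ennreal (\<psi>1 - e) \<le> dens x"
          using \<delta>(1,2) \<delta>(3)[of x] s by (auto simp: dens_eq intro!: ennreal_leI)
        then show ?thesis using x by (auto intro!: mult_right_mono)
      qed auto
    qed
    also have "\<dots> = (\<integral>\<^sup>+\<omega>. ennreal (1 / (1 - \<alpha> \<omega>)) * indicator {..1 - s} (\<alpha> \<omega>) \<partial>M)"
      by (rule nn_integral_alpha[symmetric]) measurable
    also have "\<dots> = ennreal (trunc_mean s)" by (rule nn_integral_trunc_mean[OF s(1)])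
    finally show ?thesis by (subst (asm) ennreal_le_iff) (auto simp: trunc_mean_nonneg)
  next
    case False
    \<comment> \<open>For \<open>s > \<delta>\<close> there is no interval to integrate over, but
      the claimed lower bound is nonpositive.\<close>
    have "(\<psi>1 - e) * (ln (1 / s) - ln (1 / \<delta>)) \<le> 0"
      using e False s \<delta> by (intro mult_nonneg_nonpos) (auto simp: ln_div)
    also have "0 \<le> trunc_mean s" by (rule trunc_mean_nonneg)
    finally show ?thesis .
  qed
  show ?thesis
  proof (intro exI[of _ K] allI impI conjI)
    fix s :: real assume s: "0 < s \<and> s < 1"
    have "0 \<le> \<psi>1 * ln (1 / \<delta>)" using psi1_pos ln\<delta> by simp
    then show "trunc_mean s \<le> (\<psi>1 + e) * ln (1 / s) + K"
      using upper[of s] s by (simp add: K_def)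
    have "(\<psi>1 - e) * ln (1 / \<delta>) \<le> \<psi>1 * ln (1 / \<delta>)"
      using e ln\<delta> by (intro mult_right_mono) auto
    moreover have "0 \<le> 1 / \<delta>" using \<delta> by simp
    ultimately show "(\<psi>1 - e) * ln (1 / s) - K \<le> trunc_mean s"
      using lower[of s] s unfolding K_def right_diff_distrib by linarith
  qed
qed

lemma trunc_mean_asymp: "((\<lambda>s. trunc_mean s / ln (1 / s)) \<longlongrightarrow> \<psi>1) (at_right 0)"
proof (rule tendstoI)
  fix e' :: real assume "0 < e'"
  \<comment> \<open>Half of the tolerance goes to the slope; the other half absorbs
    \<open>K\<close>, which is negligible against \<open>ln (1 / s)\<close>.\<close>
  define e where "e = min (e' / 2) \<psi>1"
  have e: "0 < e" "e \<le> \<psi>1" "e \<le> e' / 2" using \<open>0 < e'\<close> psi1_pos by (auto simp: e_def)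
  obtain K where K: "\<And>s. 0 < s \<Longrightarrow> s < 1 \<Longrightarrow> trunc_mean s \<le> (\<psi>1 + e) * ln (1 / s) + K"
      "\<And>s. 0 < s \<Longrightarrow> s < 1 \<Longrightarrow> (\<psi>1 - e) * ln (1 / s) - K \<le> trunc_mean s"
    using trunc_mean_bounds[OF e(1,2)] by blast
  have "filterlim (\<lambda>s::real. ln (1 / s)) at_top (at_right 0)" by real_asymp
  then have "eventually (\<lambda>s. 2 * \<bar>K\<bar> / e' < ln (1 / s)) (at_right 0)"
    by (simp add: filterlim_at_top_dense)
  moreover have "eventually (\<lambda>s. 0 < s \<and> s < (1::real)) (at_right 0)" by (auto simp: eventually_at_right_field intro: exI[of _ 1])
  ultimately show "eventually (\<lambda>s. dist (trunc_mean s / ln (1 / s)) \<psi>1 < e') (at_right 0)"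
  proof eventually_elim
    case (elim s)
    define L where "L = ln (1 / s)"
    have L: "0 < L" using elim by (simp add: L_def)
    have KL: "\<bar>K\<bar> < e' / 2 * L" using elim(1) \<open>0 < e'\<close> by (simp add: L_def field_simps)
    have eL: "e * L \<le> e' / 2 * L" using e L by (intro mult_right_mono) auto
    have "\<bar>trunc_mean s - \<psi>1 * L\<bar> < e' * L"
      using K[of s] elim KL eL unfolding L_def[symmetric] distrib_right left_diff_distrib by linarith
    moreover have "trunc_mean s / L - \<psi>1 = (trunc_mean s - \<psi>1 * L) / L" using L by (simp add: field_simps)
    ultimately show ?case using L unfolding L_def[symmetric] dist_real_def
      by (simp add: abs_divide field_simps)
  qed
qed

lemma trunc_mean_le: "\<exists>K>0. \<forall>s. 0 < s \<and> s < 1 \<longrightarrow> trunc_mean s \<le> K * (1 + ln (1 / s))"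
proof -
  obtain K where K: "\<And>s. 0 < s \<Longrightarrow> s < 1 \<Longrightarrow> trunc_mean s \<le> (\<psi>1 + \<psi>1) * ln (1 / s) + K"
    using trunc_mean_bounds[of \<psi>1] psi1_pos by auto
  have "trunc_mean s \<le> (2 * \<psi>1 + \<bar>K\<bar>) * (1 + ln (1 / s))" if s: "0 < s" "s < 1" for s
  proof -
    have "0 \<le> \<bar>K\<bar> * ln (1 / s)" using s by simp
    then show ?thesis using K[OF s] psi1_pos unfolding distrib_left distrib_right by linarith
  qed
  then show ?thesis using psi1_pos by (intro exI[of _ "2 * \<psi>1 + \<bar>K\<bar>"]) auto
qed

text \<open>Below the threshold \<open>1 - \<alpha> < 1 / (2 m\<^sup>2)\<close> the quadratic bound in \<open>k\<close> is used,
  above it the stationary variance.\<close>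

lemma displacement_log_bound:
  "\<exists>K>0. \<forall>m\<ge>1. \<forall>k\<le>m. (\<integral>\<^sup>+\<omega>. ennreal ((real (X k \<omega>) - real (X 0 \<omega>))\<^sup>2) \<partial>M) \<le> ennreal (K * (1 + ln (real m)))"
proof -
  obtain C where C: "0 < C" "\<And>s. 0 < s \<Longrightarrow> (\<integral>\<^sup>+\<omega>. indicator {1 - s<..} (\<alpha> \<omega>) \<partial>M) \<le> ennreal (C * s)"
    using alpha_tail by blast
  obtain H where H: "0 < H" "\<And>s. 0 < s \<Longrightarrow> s < 1 \<Longrightarrow> trunc_mean s \<le> H * (1 + ln (1 / s))"
    using trunc_mean_le by blast
  define A where "A = 2 * (lam\<^sup>2 + lam)"
  define K where "K = A * C + 8 * lam * H"
  have A: "0 < A" using lambda_pos by (simp add: A_def add_pos_pos)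
  have "(\<integral>\<^sup>+\<omega>. ennreal ((real (X k \<omega>) - real (X 0 \<omega>))\<^sup>2) \<partial>M) \<le> ennreal (K * (1 + ln (real m)))"
    if m: "1 \<le> m" and k: "k \<le> m" for m k
  proof -
    \<comment> \<open>The tail bound \<open>C * s\<close> then cancels the factor
      \<open>(real m)\<^sup>2\<close>, while \<open>ln (1 / s)\<close> is still of order
      \<open>ln (real m)\<close>. The factor 2 keeps \<open>s < 1\<close> when
      \<open>m = 1\<close>.\<close>
    define s where "s = 1 / (2 * (real m)\<^sup>2)"
    have m2: "1 \<le> (real m)\<^sup>2" using m by simp
    have "1 < 2 * (real m)\<^sup>2" using m2 by linarith
    then have "s < 1" unfolding s_def by (subst divide_less_eq_1_pos) linarith+
    moreover have "0 < s" using m by (simp add: s_def)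
    ultimately have s: "0 < s" "s < 1" by auto
    have ln_m: "0 \<le> ln (real m)" using m by simp
    let ?D = "\<lambda>\<omega>. ennreal ((real (X k \<omega>) - real (X 0 \<omega>))\<^sup>2)"
    have "(\<integral>\<^sup>+\<omega>. ?D \<omega> \<partial>M) = (\<integral>\<^sup>+\<omega>. indicator {1 - s<..} (\<alpha> \<omega>) * ?D \<omega> + indicator {..1 - s} (\<alpha> \<omega>) * ?D \<omega> \<partial>M)"
      by (intro nn_integral_cong) (auto simp: indicator_def)
    also have "\<dots> = (\<integral>\<^sup>+\<omega>. indicator {1 - s<..} (\<alpha> \<omega>) * ?D \<omega> \<partial>M) + (\<integral>\<^sup>+\<omega>. indicator {..1 - s} (\<alpha> \<omega>) * ?D \<omega> \<partial>M)"
      by (rule nn_integral_add) (auto simp del: inar1.simps)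
    also have "\<dots> \<le> ennreal (A * C) + ennreal (8 * lam * H * (1 + ln (real m)))"
    proof (rule add_mono)
      have "(\<integral>\<^sup>+\<omega>. indicator {1 - s<..} (\<alpha> \<omega>) * ?D \<omega> \<partial>M)
          \<le> ennreal (A * (real k)\<^sup>2) * (\<integral>\<^sup>+\<omega>. indicator {1 - s<..} (\<alpha> \<omega>) \<partial>M)"
        unfolding A_def by (rule displacement_square_le) measurable
      also have "\<dots> \<le> ennreal (A * (real m)\<^sup>2) * ennreal (C * s)"
        using k A C s by (intro mult_mono ennreal_leI mult_left_mono power_mono) auto
      also have "\<dots> = ennreal (A * C / 2)"
        using A C s m by (subst ennreal_mult[symmetric]) (auto simp: s_def)
      also have "\<dots> \<le> ennreal (A * C)" using A C by (intro ennreal_leI) auto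
      finally show "(\<integral>\<^sup>+\<omega>. indicator {1 - s<..} (\<alpha> \<omega>) * ?D \<omega> \<partial>M) \<le> ennreal (A * C)" .
      have "(\<integral>\<^sup>+\<omega>. indicator {..1 - s} (\<alpha> \<omega>) * ?D \<omega> \<partial>M)
          \<le> 4 * (\<integral>\<^sup>+\<omega>. indicator {..1 - s} (\<alpha> \<omega>) * ennreal (lam / (1 - \<alpha> \<omega>)) \<partial>M)"
        by (rule displacement_square_le') measurable
      also have "(\<integral>\<^sup>+\<omega>. indicator {..1 - s} (\<alpha> \<omega>) * ennreal (lam / (1 - \<alpha> \<omega>)) \<partial>M)
          = (\<integral>\<^sup>+\<omega>. ennreal lam * (ennreal (1 / (1 - \<alpha> \<omega>)) * indicator {..1 - s} (\<alpha> \<omega>)) \<partial>M)"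
        using lambda_pos by (intro nn_integral_cong) (auto simp: indicator_def ennreal_mult'[symmetric])
      also have "\<dots> = ennreal lam * ennreal (trunc_mean s)"
        by (subst nn_integral_cmult) (auto simp: nn_integral_trunc_mean[OF s(1)])
      also have "4 * (ennreal lam * ennreal (trunc_mean s)) = ennreal (4 * lam * trunc_mean s)"
        using lambda_pos by (simp add: ennreal_mult' trunc_mean_nonneg mult.assoc)
      also have "\<dots> \<le> ennreal (8 * lam * H * (1 + ln (real m)))"
      proof (rule ennreal_leI)
        have eq: "ln (1 / s) = ln 2 + 2 * ln (real m)"
          using m by (simp add: s_def ln_mult ln_realpow)
        have "1 + ln (1 / s) \<le> 2 * (1 + ln (real m))"
          unfolding eq using ln_2_less_1 by simp
        then have "H * (1 + ln (1 / s)) \<le> H * (2 * (1 + ln (real m)))"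
          using H by (intro mult_left_mono) auto
        with H(2)[OF s] have "trunc_mean s \<le> H * (2 * (1 + ln (real m)))" by linarith
        then have "4 * lam * trunc_mean s \<le> 4 * lam * (H * (2 * (1 + ln (real m))))"
          using lambda_pos by (intro mult_left_mono) auto
        then show "4 * lam * trunc_mean s \<le> 8 * lam * H * (1 + ln (real m))" by (simp add: mult_ac)
      qed
      finally show "(\<integral>\<^sup>+\<omega>. indicator {..1 - s} (\<alpha> \<omega>) * ?D \<omega> \<partial>M) \<le> ennreal (8 * lam * H * (1 + ln (real m)))" .
    qed
    also have "\<dots> = ennreal (A * C + 8 * lam * H * (1 + ln (real m)))"
      using A C H lambda_pos ln_m by (intro ennreal_plus[symmetric]) auto
    also have "\<dots> \<le> ennreal (K * (1 + ln (real m)))"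
    proof (rule ennreal_leI)
      have "0 \<le> A * C * ln (real m)" using A C ln_m by simp
      then show "A * C + 8 * lam * H * (1 + ln (real m)) \<le> K * (1 + ln (real m))"
        unfolding K_def distrib_left distrib_right by linarith
    qed
    finally show ?thesis .
  qed
  moreover have "0 < K" using A C H lambda_pos by (simp add: K_def add_pos_pos)
  ultimately show ?thesis by blast
qed

section \<open>The characteristic function under the norming\<close>

definition cumulant :: "real \<Rightarrow> complex" where
  "cumulant u = complex_of_real lam * (1 + \<i> * u - iexp u)"

definition centred_char :: "real \<Rightarrow> complex" where
  "centred_char u = (\<integral>\<omega>. iexp (u * (real (X0 \<omega>) - lam / (1 - \<alpha> \<omega>))) \<partial>M)"

lemma centred_char_eq: "centred_char u = (\<integral>\<omega>. exp (- cumulant u / (1 - \<alpha> \<omega>)) \<partial>M)"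
  unfolding centred_char_def cumulant_def by (rule char_centred)

text \<open>The real part is \<open>lam * (1 - cos u)\<close>. \<open>cumulant\<close> is minus the
  usual exponent so that \<open>exp (- cumulant u / (1 - \<alpha> \<omega>))\<close> has modulus at
  most 1, as \<open>exp_minus_one_minus_bound\<close> requires.\<close>

lemma Re_cumulant: "0 \<le> Re (cumulant u)"
  using lambda_pos by (simp add: cumulant_def Re_exp)

lemma cumulant_bound: "norm (cumulant u) \<le> lam * u\<^sup>2"
proof -
  have "norm (1 + \<i> * u - iexp u) \<le> u\<^sup>2 / 2"
    using iexp_approx1[of u 1] by (simp add: norm_minus_commute power2_eq_square)
  also have "\<dots> \<le> u\<^sup>2" by simp
  finally show ?thesis using lambda_pos by (simp add: cumulant_def norm_mult)
qed

lemma cumulant_approx: "norm (cumulant u - lam * u\<^sup>2 / 2) \<le> lam * \<bar>u\<bar> ^ 3"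
proof -
  have "norm (iexp u - (1 + \<i> * u + (\<i> * u)\<^sup>2 / 2)) \<le> \<bar>u\<bar> ^ 3 / 6"
    using iexp_approx1[of u 2] by (simp add: eval_nat_numeral add.assoc)
  also have "(\<i> * u)\<^sup>2 = - (complex_of_real (u\<^sup>2))" by (simp add: power_mult_distrib)
  also have "iexp u - (1 + \<i> * u + - (complex_of_real (u\<^sup>2)) / 2) = - (1 + \<i> * u - iexp u - u\<^sup>2 / 2)"
    by simp
  also have "norm \<dots> = norm (1 + \<i> * u - iexp u - u\<^sup>2 / 2)" by (rule norm_minus_cancel)
  finally have "norm (1 + \<i> * u - iexp u - u\<^sup>2 / 2) \<le> \<bar>u\<bar> ^ 3"
    by (rule order_trans) simp
  moreover have "cumulant u - lam * u\<^sup>2 / 2 = lam * (1 + \<i> * u - iexp u - u\<^sup>2 / 2)"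
    by (simp add: cumulant_def right_diff_distrib)
  ultimately show ?thesis using lambda_pos by (simp add: norm_mult)
qed

text \<open>Split at \<open>1 - \<alpha> = s\<close>. Closer to 1 the integrand is at most 2 on an
  event of probability \<open>O(s)\<close>; elsewhere the Taylor remainder is at most \<open>(norm
  (cumulant u))\<^sup>2 / (1 - \<alpha> \<omega>)\<^sup>2\<close>, whose truncated mean is of order
  \<open>1 / s\<close>. The level \<open>s\<close> stays free, to be chosen together with
  \<open>u\<close>.\<close>

lemma centred_char_approx:
  "\<exists>C>0. \<forall>u s. 0 < s \<and> s < 1 \<longrightarrow>
    norm (1 - centred_char u - cumulant u * trunc_mean s) \<le> C * (s + (norm (cumulant u))\<^sup>2 / s)"
proof -
  obtain C1 where C1: "0 < C1" "\<And>s. 0 < s \<Longrightarrow> (\<integral>\<^sup>+\<omega>. indicator {1 - s<..} (\<alpha> \<omega>) \<partial>M) \<le> ennreal (C1 * s)"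
    using alpha_tail by blast
  obtain C2 where C2: "0 < C2" "\<And>s. 0 < s \<Longrightarrow> s \<le> 1 \<Longrightarrow>
      (\<integral>\<^sup>+\<omega>. ennreal (1 / (1 - \<alpha> \<omega>)\<^sup>2) * indicator {..1 - s} (\<alpha> \<omega>) \<partial>M) \<le> ennreal (C2 / s)"
    using alpha_inverse_square by blast
  have "norm (1 - centred_char u - cumulant u * trunc_mean s) \<le> (2 * C1 + C2) * (s + (norm (cumulant u))\<^sup>2 / s)"
    if s: "0 < s" "s < 1" for u s
  proof -
    define z where "z = cumulant u"
    have z: "0 \<le> Re z" by (simp add: z_def Re_cumulant)
    let ?y = "\<lambda>\<omega>. 1 - \<alpha> \<omega>" and ?I = "\<lambda>\<omega>. indicator {..1 - s} (\<alpha> \<omega>) :: real"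
    have Re_zy: "0 \<le> Re (z / ?y \<omega>)" if "\<omega> \<in> space M" for \<omega>
      unfolding Re_divide_of_real using z alpha_range[OF that] by simp
    have norm_exp: "norm (exp (- z / ?y \<omega>)) \<le> 1" if "\<omega> \<in> space M" for \<omega>
      using Re_zy[OF that] by (simp del: of_real_diff)
    have int1: "integrable M (\<lambda>\<omega>. exp (- z / ?y \<omega>))"
      by (rule integrable_norm_le_1) (use norm_exp in \<open>auto\<close>)
    have int2: "integrable M (\<lambda>\<omega>. z * complex_of_real (1 / ?y \<omega> * ?I \<omega>))"
      by (intro integrable_mult_right integrable_of_real integrable_trunc_mean s)
    let ?f = "\<lambda>\<omega>. 1 - exp (- z / ?y \<omega>) - z * complex_of_real (1 / ?y \<omega> * ?I \<omega>)"
    have "1 - centred_char u - cumulant u * trunc_mean s = (\<integral>\<omega>. ?f \<omega> \<partial>M)"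
      using int1 int2 unfolding centred_char_eq trunc_mean_def z_def[symmetric]
      by (simp add: prob_space del: of_real_mult of_real_divide)
    then have "ennreal (norm (1 - centred_char u - cumulant u * trunc_mean s)) \<le> (\<integral>\<^sup>+\<omega>. norm (?f \<omega>) \<partial>M)"
      using int1 int2 by (simp only:) (intro integral_norm_bound_ennreal Bochner_Integration.integrable_diff integrable_const)
    also have "\<dots> \<le> (\<integral>\<^sup>+\<omega>. 2 * indicator {1 - s<..} (\<alpha> \<omega>) + ennreal ((norm z)\<^sup>2) * (ennreal (1 / (1 - \<alpha> \<omega>)\<^sup>2) * indicator {..1 - s} (\<alpha> \<omega>)) \<partial>M)"
    proof (rule nn_integral_mono)
      fix \<omega> assume \<omega>: "\<omega> \<in> space M"
      show "ennreal (norm (?f \<omega>)) \<le> 2 * indicator {1 - s<..} (\<alpha> \<omega>) + ennreal ((norm z)\<^sup>2) * (ennreal (1 / (1 - \<alpha> \<omega>)\<^sup>2) * indicator {..1 - s} (\<alpha> \<omega>))"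
      proof (cases "\<alpha> \<omega> \<le> 1 - s")
        case True
        have "norm (?f \<omega>) = norm (1 - exp (- (z / ?y \<omega>)) - z / ?y \<omega>)" using True by simp
        also have "\<dots> \<le> (norm (z / ?y \<omega>))\<^sup>2" by (rule exp_minus_one_minus_bound[OF Re_zy[OF \<omega>]])
        also have "\<dots> = (norm z)\<^sup>2 * (1 / (1 - \<alpha> \<omega>)\<^sup>2)"
          by (simp add: norm_divide power_divide del: of_real_diff)
        finally show ?thesis using True by (simp add: ennreal_leI ennreal_mult[symmetric])
      next
        case False
        have "norm (?f \<omega>) \<le> norm (1::complex) + norm (exp (- z / ?y \<omega>))"
          using False norm_triangle_ineq4[of 1 "exp (- z / ?y \<omega>)"] by simp
        also have "\<dots> \<le> 2" using norm_exp[OF \<omega>] by simp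
        finally show ?thesis using False ennreal_leI[of _ 2] by simp
      qed
    qed
    also have "\<dots> = 2 * (\<integral>\<^sup>+\<omega>. indicator {1 - s<..} (\<alpha> \<omega>) \<partial>M)
        + ennreal ((norm z)\<^sup>2) * (\<integral>\<^sup>+\<omega>. ennreal (1 / (1 - \<alpha> \<omega>)\<^sup>2) * indicator {..1 - s} (\<alpha> \<omega>) \<partial>M)"
      by (simp add: nn_integral_add nn_integral_cmult)
    also have "\<dots> \<le> 2 * ennreal (C1 * s) + ennreal ((norm z)\<^sup>2) * ennreal (C2 / s)"
      using s by (intro add_mono mult_left_mono C1 C2) auto
    also have "\<dots> = ennreal (2 * (C1 * s) + (norm z)\<^sup>2 * (C2 / s))"
    proof -
      have "2 * ennreal (C1 * s) = ennreal (2 * (C1 * s))" by (subst ennreal_mult') auto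
      moreover have "ennreal ((norm z)\<^sup>2) * ennreal (C2 / s) = ennreal ((norm z)\<^sup>2 * (C2 / s))"
        by (rule ennreal_mult'[symmetric]) auto
      ultimately show ?thesis
        using C1 C2 s by (simp only:) (intro ennreal_plus[symmetric]; simp)
    qed
    finally have "norm (1 - centred_char u - cumulant u * trunc_mean s) \<le> 2 * (C1 * s) + (norm z)\<^sup>2 * (C2 / s)"
      using C1 C2 s by (subst (asm) ennreal_le_iff) auto
    also have "\<dots> \<le> (2 * C1 + C2) * (s + (norm z)\<^sup>2 / s)"
    proof -
      have "0 \<le> C2 * s" "0 \<le> 2 * C1 * ((norm z)\<^sup>2 / s)" using C1 C2 s by auto
      moreover have "(norm z)\<^sup>2 * (C2 / s) = C2 * ((norm z)\<^sup>2 / s)" by simp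
      ultimately show ?thesis unfolding distrib_left distrib_right by linarith
    qed
    finally show ?thesis by (simp add: z_def)
  qed
  then show ?thesis using C1 C2 by (intro exI[of _ "2 * C1 + C2"]) auto
qed

text \<open>Complex logarithms are avoided: \<open>n * (1 - centred_char (v n))\<close> and
  \<open>n * (1 - exp (- c / n))\<close> have the same limit \<open>c\<close>, and n-th powers of
  two numbers in the unit disc differ by at most \<open>n\<close> times the difference of the
  numbers.\<close>

lemma centred_char_power_limit:
  "(\<lambda>n. centred_char (u / sqrt (real n * ln (real n))) ^ n) \<longlonglongrightarrow> complex_of_real (exp (- (lam * \<psi>1 * u\<^sup>2 / 2)))"
proof -
  define c where "c = lam * \<psi>1 * u\<^sup>2 / 2"
  \<comment> \<open>The truncation level is the square of the norming, so
    \<open>(v n)\<^sup>2 = u\<^sup>2 * s n\<close> and the cumulant is of order \<open>s n\<close>.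
    Both errors of \<open>centred_char_approx\<close> are then \<open>O(s n)\<close> and vanish even
    after multiplication by \<open>n\<close>.\<close>
  define s where "s n = 1 / (real n * ln (real n))" for n :: nat
  define v where "v n = u / sqrt (real n * ln (real n))" for n :: nat
  define z where "z n = cumulant (v n)" for n
  have c: "0 \<le> c" using lambda_pos psi1_pos by (simp add: c_def)
  have ev: "eventually (\<lambda>n. 0 < s n \<and> s n < 1 \<and> 0 < n) sequentially"
  proof -
    have "eventually (\<lambda>n. 1 < real n * ln (real n)) sequentially" by real_asymp
    then show ?thesis
      using eventually_gt_at_top[of 1] by eventually_elim (auto simp: s_def)
  qed
  have v2: "(v n)\<^sup>2 = u\<^sup>2 * s n" if "0 < s n" for n
  proof -
    have "0 \<le> real n * ln (real n)" using that unfolding s_def by (metis less_imp_le zero_less_divide_1_iff)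
    then show ?thesis by (simp add: v_def s_def power_divide)
  qed
  have s_at_right: "filterlim s (at_right 0) sequentially"
    unfolding s_def by real_asymp
  have lim_H: "(\<lambda>n. trunc_mean (s n) / ln (1 / s n)) \<longlonglongrightarrow> \<psi>1"
    by (rule filterlim_compose[OF trunc_mean_asymp s_at_right])
  have lim_ln: "(\<lambda>n. real n * s n * ln (1 / s n)) \<longlonglongrightarrow> 1"
    unfolding s_def by real_asymp
  have lim_z: "(\<lambda>n. z n / s n) \<longlonglongrightarrow> complex_of_real (lam * u\<^sup>2 / 2)"
  proof (rule LIM_zero_cancel, rule Lim_null_comparison)
    show "eventually (\<lambda>n. norm (z n / s n - complex_of_real (lam * u\<^sup>2 / 2)) \<le> lam * u\<^sup>2 * \<bar>v n\<bar>) sequentially"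
      using ev
    proof eventually_elim
      case (elim n)
      have "norm (z n / s n - complex_of_real (lam * u\<^sup>2 / 2)) = norm (z n - lam * (v n)\<^sup>2 / 2) / s n"
      proof -
        have "z n / s n - complex_of_real (lam * u\<^sup>2 / 2) = (z n - lam * (v n)\<^sup>2 / 2) / s n"
          using elim by (simp add: v2 diff_divide_distrib)
        then show ?thesis using elim by (simp add: norm_divide)
      qed
      also have "\<dots> \<le> (lam * \<bar>v n\<bar> ^ 3) / s n"
        unfolding z_def using elim cumulant_approx[of "v n"] by (intro divide_right_mono) auto
      also have "\<dots> = lam * (\<bar>v n\<bar> * (v n)\<^sup>2) / s n" by (simp add: power3_eq_cube power2_eq_square abs_mult_self_eq)
      also have "\<dots> = lam * u\<^sup>2 * \<bar>v n\<bar>" using elim lambda_pos by (simp add: v2 abs_mult)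
      finally show ?case .
    qed
    have "v \<longlonglongrightarrow> 0" unfolding v_def by real_asymp
    then have "(\<lambda>n. lam * u\<^sup>2 * \<bar>v n\<bar>) \<longlonglongrightarrow> lam * u\<^sup>2 * \<bar>0\<bar>" by (intro tendsto_intros)
    then show "(\<lambda>n. lam * u\<^sup>2 * \<bar>v n\<bar>) \<longlonglongrightarrow> 0" by simp
  qed
  \<comment> \<open>Three factors are separated: the quadratic behaviour of the cumulant, the
    scaling \<open>n * s n * ln (1 / s n)\<close> tending to 1, and the logarithmic growth of
    \<open>trunc_mean\<close>.\<close>
  have lim_main: "(\<lambda>n. real n * (z n * trunc_mean (s n))) \<longlonglongrightarrow> complex_of_real c"
  proof -
    have "(\<lambda>n. (z n / s n) * complex_of_real ((real n * s n * ln (1 / s n)) * (trunc_mean (s n) / ln (1 / s n))))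
        \<longlonglongrightarrow> complex_of_real (lam * u\<^sup>2 / 2) * complex_of_real (1 * \<psi>1)"
      by (intro tendsto_mult[OF lim_z] tendsto_of_real tendsto_mult[OF lim_ln lim_H])
    also have "complex_of_real (lam * u\<^sup>2 / 2) * complex_of_real (1 * \<psi>1) = complex_of_real c"
      by (simp add: c_def)
    finally show ?thesis
    proof (rule Lim_transform_eventually)
      show "eventually (\<lambda>n. (z n / s n) * complex_of_real ((real n * s n * ln (1 / s n)) * (trunc_mean (s n) / ln (1 / s n)))
          = real n * (z n * trunc_mean (s n))) sequentially"
        using ev
      proof eventually_elim
        case (elim n)
        then have "ln (1 / s n) \<noteq> 0" "s n \<noteq> 0" by auto
        then have "(real n * s n * ln (1 / s n)) * (trunc_mean (s n) / ln (1 / s n)) = real n * s n * trunc_mean (s n)"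
          by (simp add: field_simps del: ln_inverse)
        then show ?case using \<open>s n \<noteq> 0\<close> by simp
      qed
    qed
  qed
  have lim_err: "(\<lambda>n. real n * (1 - centred_char (v n)) - real n * (z n * trunc_mean (s n))) \<longlonglongrightarrow> 0"
  proof -
    obtain C where C: "0 < C" "\<And>u s. 0 < s \<Longrightarrow> s < 1 \<Longrightarrow>
        norm (1 - centred_char u - cumulant u * trunc_mean s) \<le> C * (s + (norm (cumulant u))\<^sup>2 / s)"
      using centred_char_approx by blast
    show ?thesis
    proof (rule Lim_null_comparison)
      show "eventually (\<lambda>n. norm (real n * (1 - centred_char (v n)) - real n * (z n * trunc_mean (s n)))
          \<le> C * (1 + (lam * u\<^sup>2)\<^sup>2) * (real n * s n)) sequentially"
        using ev
      proof eventually_elim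
        case (elim n)
        have "norm (real n * (1 - centred_char (v n)) - real n * (z n * trunc_mean (s n)))
            = real n * norm (1 - centred_char (v n) - cumulant (v n) * trunc_mean (s n))"
          by (simp add: z_def right_diff_distrib[symmetric] norm_mult)
        also have "\<dots> \<le> real n * (C * (s n + (norm (cumulant (v n)))\<^sup>2 / s n))"
          using elim by (intro mult_left_mono C) auto
        also have "\<dots> \<le> real n * (C * (s n + (lam * (u\<^sup>2 * s n))\<^sup>2 / s n))"
          using elim C cumulant_bound[of "v n"] v2[of n]
          by (intro mult_left_mono add_left_mono divide_right_mono power_mono) auto
        also have "\<dots> = C * (1 + (lam * u\<^sup>2)\<^sup>2) * (real n * s n)"
          using elim by (simp add: power2_eq_square field_simps)
        finally show ?case .
      qed
      have "(\<lambda>n. real n * s n) \<longlonglongrightarrow> 0" unfolding s_def by real_asymp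
      then have "(\<lambda>n. C * (1 + (lam * u\<^sup>2)\<^sup>2) * (real n * s n)) \<longlonglongrightarrow> C * (1 + (lam * u\<^sup>2)\<^sup>2) * 0"
        by (intro tendsto_intros)
      then show "(\<lambda>n. C * (1 + (lam * u\<^sup>2)\<^sup>2) * (real n * s n)) \<longlonglongrightarrow> 0" by simp
    qed
  qed
  have lim_char: "(\<lambda>n. real n * (1 - centred_char (v n))) \<longlonglongrightarrow> complex_of_real c"
    using tendsto_add[OF lim_err lim_main] by simp
  \<comment> \<open>\<open>exp (- c / n)\<close> is preferred to \<open>1 - c / n\<close>: its
    modulus is at most 1 for every \<open>n\<close>, and its n-th power is exactly
    \<open>exp (- c)\<close> for positive \<open>n\<close>.\<close>
  have lim_exp: "(\<lambda>n. complex_of_real (real n * (1 - exp (- c / real n)))) \<longlonglongrightarrow> complex_of_real c"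
    by (intro tendsto_of_real) real_asymp
  have lim_diff: "(\<lambda>n. real n * (1 - centred_char (v n)) - complex_of_real (real n * (1 - exp (- c / real n)))) \<longlonglongrightarrow> 0"
    using tendsto_diff[OF lim_char lim_exp] by simp
  have "(\<lambda>n. centred_char (v n) ^ n - complex_of_real (exp (- c / real n)) ^ n) \<longlonglongrightarrow> 0"
  proof (rule Lim_null_comparison[OF _ tendsto_norm_zero[OF lim_diff]], intro always_eventually allI)
    fix n
    have "norm (centred_char (v n)) \<le> (\<integral>\<omega>. norm (iexp (v n * (real (X0 \<omega>) - lam / (1 - \<alpha> \<omega>)))) \<partial>M)"
      unfolding centred_char_def by (rule integral_norm_bound)
    also have "\<dots> = 1" by (simp add: prob_space)
    finally have "norm (centred_char (v n) ^ n - complex_of_real (exp (- c / real n)) ^ n)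
        \<le> real n * norm (centred_char (v n) - complex_of_real (exp (- c / real n)))"
      using c by (intro norm_power_diff) auto
    also have "\<dots> = norm (real n * (1 - centred_char (v n)) - complex_of_real (real n * (1 - exp (- c / real n))))"
    proof -
      have "real n * (1 - centred_char (v n)) - complex_of_real (real n * (1 - exp (- c / real n)))
          = of_real (real n) * - (centred_char (v n) - complex_of_real (exp (- c / real n)))"
        by (simp add: algebra_simps)
      then show ?thesis by (simp only: norm_mult norm_of_real norm_minus_cancel abs_of_nat)
    qed
    finally show "norm (centred_char (v n) ^ n - complex_of_real (exp (- c / real n)) ^ n)
      \<le> norm (real n * (1 - centred_char (v n)) - complex_of_real (real n * (1 - exp (- c / real n))))" .
  qed
  moreover have "(\<lambda>n. complex_of_real (exp (- c / real n)) ^ n) \<longlonglongrightarrow> complex_of_real (exp (- c))"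
  proof (rule Lim_transform_eventually[OF tendsto_const])
    show "eventually (\<lambda>n. complex_of_real (exp (- c)) = complex_of_real (exp (- c / real n)) ^ n) sequentially"
      using eventually_gt_at_top[of 0]
      by eventually_elim (simp flip: of_real_power exp_of_nat_mult)
  qed
  ultimately have "(\<lambda>n. centred_char (v n) ^ n) \<longlonglongrightarrow> complex_of_real (exp (- c))"
    using tendsto_add by fastforce
  then show ?thesis by (simp add: v_def c_def)
qed

end

section \<open>Second moments, tightness and a Slutsky theorem\<close>

text \<open>After expanding the square, independence enters for pairs: centred independent factors
  make the off-diagonal expectations vanish.\<close>

lemma (in prob_space) second_moment_indep_sum:
  fixes D :: "'i \<Rightarrow> 'a \<Rightarrow> real"
  assumes fin: "finite I" and indep: "indep_vars (\<lambda>_. borel) D I"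
    and sq: "\<And>i. i \<in> I \<Longrightarrow> integrable M (\<lambda>\<omega>. (D i \<omega>)\<^sup>2)"
    and mean: "\<And>i. i \<in> I \<Longrightarrow> expectation (D i) = 0"
  shows "integrable M (\<lambda>\<omega>. (\<Sum>i\<in>I. D i \<omega>)\<^sup>2)"
    and "expectation (\<lambda>\<omega>. (\<Sum>i\<in>I. D i \<omega>)\<^sup>2) = (\<Sum>i\<in>I. expectation (\<lambda>\<omega>. (D i \<omega>)\<^sup>2))"
proof -
  have meas: "D i \<in> borel_measurable M" if "i \<in> I" for i
    by (rule bspec[OF indep[unfolded indep_vars_def2, THEN conjunct1] that])
  have int: "integrable M (D i)" if "i \<in> I" for i
    by (rule square_integrable_imp_integrable[OF meas[OF that] sq[OF that]])
  have pair: "integrable M (\<lambda>\<omega>. D i \<omega> * D j \<omega>)"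
      "expectation (\<lambda>\<omega>. D i \<omega> * D j \<omega>) = (if i = j then expectation (\<lambda>\<omega>. (D i \<omega>)\<^sup>2) else 0)"
    if "i \<in> I" "j \<in> I" for i j
  proof -
    have "integrable M (\<lambda>\<omega>. D i \<omega> * D j \<omega>) \<and> expectation (\<lambda>\<omega>. D i \<omega> * D j \<omega>) = 0" if ij: "i \<noteq> j"
    proof -
      have sub: "indep_vars (\<lambda>_. borel) D {i, j}"
        using \<open>i \<in> I\<close> \<open>j \<in> I\<close> by (intro indep_vars_subset[OF indep]) auto
      have i2: "\<And>k. k \<in> {i, j} \<Longrightarrow> integrable M (D k)" using int \<open>i \<in> I\<close> \<open>j \<in> I\<close> by auto
      show ?thesis
        using indep_vars_integrable[OF _ sub i2] indep_vars_lebesgue_integral[OF _ sub i2] ij mean[OF \<open>i \<in> I\<close>] by simp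
    qed
    then show "integrable M (\<lambda>\<omega>. D i \<omega> * D j \<omega>)"
      "expectation (\<lambda>\<omega>. D i \<omega> * D j \<omega>) = (if i = j then expectation (\<lambda>\<omega>. (D i \<omega>)\<^sup>2) else 0)"
      using sq[OF \<open>i \<in> I\<close>] by (auto simp: power2_eq_square)
  qed
  have eq: "(\<lambda>\<omega>. (\<Sum>i\<in>I. D i \<omega>)\<^sup>2) = (\<lambda>\<omega>. \<Sum>i\<in>I. \<Sum>j\<in>I. D i \<omega> * D j \<omega>)"
    by (simp add: power2_eq_square sum_product)
  show "integrable M (\<lambda>\<omega>. (\<Sum>i\<in>I. D i \<omega>)\<^sup>2)"
    unfolding eq by (intro Bochner_Integration.integrable_sum pair)
  have "expectation (\<lambda>\<omega>. (\<Sum>i\<in>I. D i \<omega>)\<^sup>2) = (\<Sum>i\<in>I. \<Sum>j\<in>I. expectation (\<lambda>\<omega>. D i \<omega> * D j \<omega>))"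
    unfolding eq
    by (subst Bochner_Integration.integral_sum, intro Bochner_Integration.integrable_sum pair)
       (auto intro!: sum.cong Bochner_Integration.integral_sum pair)
  also have "\<dots> = (\<Sum>i\<in>I. expectation (\<lambda>\<omega>. (D i \<omega>)\<^sup>2))"
    using fin by (simp add: pair)
  finally show "expectation (\<lambda>\<omega>. (\<Sum>i\<in>I. D i \<omega>)\<^sup>2) = (\<Sum>i\<in>I. expectation (\<lambda>\<omega>. (D i \<omega>)\<^sup>2))" .
qed

section \<open>Test functions on a product topology\<close>

lemma continuous_on_restrict_product:
  fixes f :: "(nat \<Rightarrow> real) \<Rightarrow> real"
  assumes "continuous_map (product_topology (\<lambda>_. euclideanreal) I) euclideanreal f"
  shows "continuous_on UNIV (\<lambda>x. f (restrict x I))"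
proof -
  have "continuous_map (product_topology (\<lambda>_. euclideanreal) UNIV) (product_topology (\<lambda>_. euclideanreal) I) (\<lambda>x. restrict x I)"
    by (auto simp: continuous_map_componentwise restrict_def extensional_def intro: continuous_map_product_projection)
  from continuous_map_compose[OF this assms]
  show ?thesis
    unfolding euclidean_product_topology comp_def by simp
qed

text \<open>\<open>f\<close> is continuous on functions undefined off \<open>I\<close>, whereas
  Borel sets of \<open>nat \<Rightarrow> real\<close> refer to the full product. Composition with
  \<open>restrict\<close> moves \<open>f\<close> to the full product, where continuity gives
  measurability.\<close>

lemma borel_measurable_product_topology:
  fixes f :: "(nat \<Rightarrow> real) \<Rightarrow> real"
  assumes "continuous_map (product_topology (\<lambda>_. euclideanreal) I) euclideanreal f"
  shows "f \<in> borel_measurable (\<Pi>\<^sub>M i\<in>I. borel)"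
proof -
  \<comment> \<open>The value 0 off \<open>I\<close> is arbitrary: restricting to \<open>I\<close>
    erases it and returns \<open>x\<close>.\<close>
  let ?ext = "\<lambda>x i. if i \<in> I then x i else 0 :: real"
  have "?ext \<in> borel_measurable (\<Pi>\<^sub>M i\<in>I. borel)"
  proof (rule measurable_coordinatewise_then_product)
    fix i show "(\<lambda>x. ?ext x i) \<in> borel_measurable (\<Pi>\<^sub>M i\<in>I. borel)"
      by (cases "i \<in> I") auto
  qed
  moreover have "(\<lambda>x. f (restrict x I)) \<in> borel_measurable borel"
    by (rule borel_measurable_continuous_onI[OF continuous_on_restrict_product[OF assms]])
  ultimately have "(\<lambda>x. f (restrict (?ext x) I)) \<in> borel_measurable (\<Pi>\<^sub>M i\<in>I. borel)"
    by (rule measurable_compose)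
  also have "?this \<longleftrightarrow> f \<in> borel_measurable (\<Pi>\<^sub>M i\<in>I. borel)"
  proof (rule measurable_cong)
    fix x :: "nat \<Rightarrow> real" assume "x \<in> space (\<Pi>\<^sub>M i\<in>I. borel)"
    then have "restrict (?ext x) I = x" by (auto simp: space_PiM PiE_def extensional_def restrict_def)
    then show "f (restrict (?ext x) I) = f x" by simp
  qed
  finally show ?thesis .
qed

text \<open>A continuous \<open>f\<close> need not be uniformly continuous, so \<open>v\<close> is
  confined to a compact interval. If the claim failed, take counterexamples with \<eta> = 1/(n+1):
  along a subsequence \<open>v\<close> converges, \<open>b\<close> tends to 0 and \<open>r\<close>
  to \<open>t\<close> by their bounds, and both arguments of \<open>f\<close> reach the same
  limit.\<close>

lemma product_topology_uniform:
  fixes f :: "(nat \<Rightarrow> real) \<Rightarrow> real" and t :: "nat \<Rightarrow> real"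
  assumes f: "continuous_map (product_topology (\<lambda>_. euclideanreal) I) euclideanreal f" and e: "0 < e"
  shows "\<exists>\<eta>>0. \<forall>v b r. \<bar>v\<bar> \<le> R \<and> (\<forall>i\<in>I. \<bar>b i\<bar> \<le> \<eta> \<and> \<bar>r i - t i\<bar> \<le> \<eta>) \<longrightarrow>
    \<bar>f (\<lambda>i\<in>I. b i + r i * v) - f (\<lambda>i\<in>I. t i * v)\<bar> < e"
proof (rule ccontr)
  assume contra: "\<not> ?thesis"
  define close where "close \<eta> v b r \<longleftrightarrow> \<bar>v\<bar> \<le> R \<and> (\<forall>i\<in>I. \<bar>b i\<bar> \<le> \<eta> \<and> \<bar>r i - t i\<bar> \<le> \<eta>)"
    for \<eta> v :: real and b r :: "nat \<Rightarrow> real"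
  define far where "far v b r \<longleftrightarrow> \<not> \<bar>f (\<lambda>i\<in>I. b i + r i * v) - f (\<lambda>i\<in>I. t i * v)\<bar> < e" for v b r
  have "\<exists>v b r. close (1 / real (Suc n)) v b r \<and> far v b r" for n
  proof (rule ccontr)
    assume "\<not> ?thesis"
    then have *: "\<forall>v b r. close (1 / real (Suc n)) v b r \<longrightarrow> \<not> far v b r" by blast
    show False
    proof (rule notE[OF contra], rule exI[of _ "1 / real (Suc n)"], rule conjI)
      show "0 < 1 / real (Suc n)" by simp
    qed (rule *[unfolded close_def far_def not_not])
  qed
  then obtain v b r where vbr: "\<And>n. close (1 / real (Suc n)) (v n) (b n) (r n) \<and> far (v n) (b n) (r n)"
    by metis
  have v: "\<bar>v n\<bar> \<le> R"
    and br: "i \<in> I \<Longrightarrow> \<bar>b n i\<bar> \<le> 1 / real (Suc n) \<and> \<bar>r n i - t i\<bar> \<le> 1 / real (Suc n)"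
    and far: "e \<le> \<bar>f (\<lambda>i\<in>I. b n i + r n i * v n) - f (\<lambda>i\<in>I. t i * v n)\<bar>" for n i
    using vbr[of n] unfolding close_def far_def by auto
  have "compact {-R..R}" by simp
  moreover have "\<forall>n. v n \<in> {-R..R}" using v by (auto simp: abs_le_iff minus_le_iff)
  ultimately obtain l \<sigma> where l: "strict_mono \<sigma>" "(v \<circ> \<sigma>) \<longlonglongrightarrow> l"
    unfolding compact_def by meson
  have inv: "(\<lambda>n. 1 / real (Suc (\<sigma> n))) \<longlonglongrightarrow> 0"
    using LIMSEQ_subseq_LIMSEQ[OF LIMSEQ_inverse_real_of_nat l(1)] by (simp add: comp_def inverse_eq_divide)
  have b: "(\<lambda>n. b (\<sigma> n) i) \<longlonglongrightarrow> 0" if "i \<in> I" for i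
    by (rule Lim_null_comparison[OF _ inv]) (use br[OF that] in auto)
  have r: "(\<lambda>n. r (\<sigma> n) i) \<longlonglongrightarrow> t i" if "i \<in> I" for i
    by (rule LIM_zero_cancel, rule Lim_null_comparison[OF _ inv]) (use br[OF that] in auto)
  have vl: "(\<lambda>n. v (\<sigma> n)) \<longlonglongrightarrow> l" using l(2) by (simp add: comp_def)
  have lim1: "(\<lambda>n. f (\<lambda>i\<in>I. b (\<sigma> n) i + r (\<sigma> n) i * v (\<sigma> n))) \<longlonglongrightarrow> f (\<lambda>i\<in>I. t i * l)"
  proof -
    have "(\<lambda>n. b (\<sigma> n) i + r (\<sigma> n) i * v (\<sigma> n)) \<longlonglongrightarrow> 0 + t i * l" if "i \<in> I" for i
      using that by (intro tendsto_intros b r vl)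
    then have "limitin (product_topology (\<lambda>_. euclideanreal) I)
        (\<lambda>n. \<lambda>i\<in>I. b (\<sigma> n) i + r (\<sigma> n) i * v (\<sigma> n)) (\<lambda>i\<in>I. t i * l) sequentially"
      by (simp add: limitin_componentwise)
    from continuous_map_limit[OF f this] show ?thesis by (simp add: comp_def)
  qed
  have lim2: "(\<lambda>n. f (\<lambda>i\<in>I. t i * v (\<sigma> n))) \<longlonglongrightarrow> f (\<lambda>i\<in>I. t i * l)"
  proof -
    have "(\<lambda>n. t i * v (\<sigma> n)) \<longlonglongrightarrow> t i * l" for i
      by (intro tendsto_intros vl)
    then have "limitin (product_topology (\<lambda>_. euclideanreal) I)
        (\<lambda>n. \<lambda>i\<in>I. t i * v (\<sigma> n)) (\<lambda>i\<in>I. t i * l) sequentially"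
      by (simp add: limitin_componentwise)
    from continuous_map_limit[OF f this] show ?thesis by (simp add: comp_def)
  qed
  have "(\<lambda>n. \<bar>f (\<lambda>i\<in>I. b (\<sigma> n) i + r (\<sigma> n) i * v (\<sigma> n)) - f (\<lambda>i\<in>I. t i * v (\<sigma> n))\<bar>) \<longlonglongrightarrow> \<bar>f (\<lambda>i\<in>I. t i * l) - f (\<lambda>i\<in>I. t i * l)\<bar>"
    by (intro tendsto_intros lim1 lim2)
  then have "e \<le> \<bar>f (\<lambda>i\<in>I. t i * l) - f (\<lambda>i\<in>I. t i * l)\<bar>"
    by (rule Lim_bounded2) (use far in auto)
  then show False using e by simp
qed

text \<open>Convergence is known for continuous test functions only, so tail probabilities are
  dominated by continuous ramps. One ramp is chosen small in mean under the single variable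
  \<open>W\<close>, and convergence carries it to all large \<open>n\<close>.\<close>

lemma tight_of_bounded_continuous_conv:
  fixes V :: "nat \<Rightarrow> 'b \<Rightarrow> real" and W :: "'c \<Rightarrow> real"
  assumes "prob_space P" "prob_space Q"
    and [measurable]: "\<And>n. V n \<in> borel_measurable P" "W \<in> borel_measurable Q"
    and conv: "\<And>g B. (\<And>x. isCont g x) \<Longrightarrow> (\<And>x. \<bar>g x\<bar> \<le> B) \<Longrightarrow>
      (\<lambda>n. \<integral>\<omega>. g (V n \<omega>) \<partial>P) \<longlonglongrightarrow> (\<integral>\<omega>. (g (W \<omega>) :: real) \<partial>Q)"
    and e: "0 < e"
  shows "\<exists>R. eventually (\<lambda>n. measure P {\<omega> \<in> space P. R < \<bar>V n \<omega>\<bar>} < e) sequentially"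
proof -
  interpret P: prob_space P by fact
  interpret Q: prob_space Q by fact
  \<comment> \<open>The ramp is 0 up to \<open>\<bar>x\<bar> = m\<close> and 1 from
    \<open>m + 1\<close> on; hence the final radius \<open>m + 1\<close>.\<close>
  define g where "g m x = min 1 (max 0 (\<bar>x\<bar> - real m))" for m :: nat and x :: real
  have g01: "0 \<le> g m x" "g m x \<le> 1" for m x by (auto simp: g_def)
  have [measurable]: "g m \<in> borel_measurable borel" for m unfolding g_def by measurable
  have "(\<lambda>m. \<integral>\<omega>. g m (W \<omega>) \<partial>Q) \<longlonglongrightarrow> (\<integral>\<omega>. 0 \<partial>Q)"
  proof (rule integral_dominated_convergence[where w="\<lambda>_. 1"])
    show "AE \<omega> in Q. (\<lambda>m. g m (W \<omega>)) \<longlonglongrightarrow> 0"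
    proof (rule AE_I2)
      fix \<omega>
      obtain k :: nat where "\<bar>W \<omega>\<bar> \<le> real k" using real_arch_simple by blast
      then have "eventually (\<lambda>m. g m (W \<omega>) = 0) sequentially"
        by (intro eventually_sequentiallyI[of k]) (auto simp: g_def)
      then show "(\<lambda>m. g m (W \<omega>)) \<longlonglongrightarrow> 0" by (rule tendsto_eventually)
    qed
  qed (use g01 in auto)
  then have "eventually (\<lambda>m. (\<integral>\<omega>. g m (W \<omega>) \<partial>Q) < e) sequentially"
    using e by (intro order_tendstoD(2)) auto
  then obtain m where m: "(\<integral>\<omega>. g m (W \<omega>) \<partial>Q) < e"
    using eventually_happens'[OF sequentially_bot] by blast
  have "(\<lambda>n. \<integral>\<omega>. g m (V n \<omega>) \<partial>P) \<longlonglongrightarrow> (\<integral>\<omega>. g m (W \<omega>) \<partial>Q)"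
    using g01 by (intro conv[of _ 1]) (auto simp: g_def[abs_def] intro!: continuous_intros)
  then have "eventually (\<lambda>n. (\<integral>\<omega>. g m (V n \<omega>) \<partial>P) < e) sequentially"
    using m by (rule order_tendstoD(2))
  then show ?thesis
  proof (intro exI[of _ "real m + 1"], eventually_elim)
    case (elim n)
    have "measure P {\<omega> \<in> space P. real m + 1 < \<bar>V n \<omega>\<bar>} = (\<integral>\<omega>. indicator {\<omega> \<in> space P. real m + 1 < \<bar>V n \<omega>\<bar>} \<omega> \<partial>P)"
      by simp
    also have "\<dots> \<le> (\<integral>\<omega>. g m (V n \<omega>) \<partial>P)"
    proof (rule integral_mono)
      show "integrable P (\<lambda>\<omega>. g m (V n \<omega>))"
        using g01 by (intro P.integrable_const_bound[of _ 1]) auto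
      show "integrable P (indicat_real {\<omega> \<in> space P. real m + 1 < \<bar>V n \<omega>\<bar>})"
        by (intro P.integrable_const_bound[of _ 1]) (auto simp: indicator_def)
    qed (auto simp: indicator_def g_def P.emeasure_eq_measure)
    finally show ?case using elim by simp
  qed
qed

text \<open>A Slutsky theorem: the error terms \<open>A n i\<close> are not coupled with any almost surely
  convergent version of \<open>V n\<close>, so uniform continuity on compact sets and tightness replace the
  continuous mapping theorem.\<close>

lemma slutsky_product:
  fixes V :: "nat \<Rightarrow> 'b \<Rightarrow> real" and A :: "nat \<Rightarrow> nat \<Rightarrow> 'b \<Rightarrow> real" and W :: "'c \<Rightarrow> real"
  assumes "prob_space P" "prob_space Q" and fin: "finite I"
    and [measurable]: "\<And>n. V n \<in> borel_measurable P" "W \<in> borel_measurable Q" "\<And>n i. A n i \<in> borel_measurable P"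
    and conv: "\<And>g B. (\<And>x. isCont g x) \<Longrightarrow> (\<And>x. \<bar>g x\<bar> \<le> B) \<Longrightarrow>
      (\<lambda>n. \<integral>\<omega>. g (V n \<omega>) \<partial>P) \<longlonglongrightarrow> (\<integral>\<omega>. (g (W \<omega>) :: real) \<partial>Q)"
    and A: "\<And>i \<eta>. i \<in> I \<Longrightarrow> 0 < \<eta> \<Longrightarrow> (\<lambda>n. measure P {\<omega> \<in> space P. \<eta> \<le> \<bar>A n i \<omega>\<bar>}) \<longlonglongrightarrow> 0"
    and r: "\<And>i. i \<in> I \<Longrightarrow> (\<lambda>n. r n i) \<longlonglongrightarrow> t i"
    and f: "continuous_map (product_topology (\<lambda>_. euclideanreal) I) euclideanreal f"
    and bdd: "bounded (f ` topspace (product_topology (\<lambda>_. euclideanreal) I))"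
  shows "(\<lambda>n. \<integral>\<omega>. f (\<lambda>i\<in>I. A n i \<omega> + r n i * V n \<omega>) \<partial>P) \<longlonglongrightarrow> (\<integral>\<omega>. f (\<lambda>i\<in>I. t i * W \<omega>) \<partial>Q)"
proof -
  interpret P: prob_space P by fact
  interpret Q: prob_space Q by fact
  obtain B where "0 < B" and B: "\<And>x. x \<in> extensional I \<Longrightarrow> \<bar>f x\<bar> \<le> B"
    using bdd by (auto simp: bounded_pos PiE_def)
  define g where "g v = f (\<lambda>i\<in>I. t i * v)" for v
  have g_cont: "isCont g v" for v
  proof -
    have "continuous_on UNIV (\<lambda>v i. t i * v)"
      by (intro continuous_on_coordinatewise_then_product continuous_intros)
    then have "continuous_on UNIV g"
      unfolding g_def using continuous_on_compose2[OF continuous_on_restrict_product[OF f]] by auto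
    then show ?thesis by (simp add: continuous_on_eq_continuous_at)
  qed
  have g_bdd: "\<bar>g v\<bar> \<le> B" for v unfolding g_def by (rule B) auto
  have [measurable]: "g \<in> borel_measurable borel"
    using g_cont by (intro borel_measurable_continuous_onI continuous_at_imp_continuous_on) auto
  define F where "F n \<omega> = f (\<lambda>i\<in>I. A n i \<omega> + r n i * V n \<omega>)" for n \<omega>
  have F_bdd: "\<bar>F n \<omega>\<bar> \<le> B" for n \<omega> unfolding F_def by (rule B) auto
  have [measurable]: "F n \<in> borel_measurable P" for n
    unfolding F_def
    by (rule measurable_compose[OF _ borel_measurable_product_topology[OF f]])
       (rule measurable_restrict, measurable)
  have int_F: "integrable P (F n)" and int_g: "integrable P (\<lambda>\<omega>. g (V n \<omega>))" for n
    using F_bdd g_bdd by (auto intro!: P.integrable_const_bound[of _ B])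
  have "(\<lambda>n. (\<integral>\<omega>. F n \<omega> \<partial>P) - (\<integral>\<omega>. g (V n \<omega>) \<partial>P)) \<longlonglongrightarrow> 0"
  proof (rule tendstoI)
    fix e :: real assume e: "0 < e"
    define e1 where "e1 = e / 2"
    \<comment> \<open>On the two kinds of bad events, each of total probability below
      \<open>e2\<close>, the integrands differ by at most \<open>2 * B\<close>; so
      \<open>2 * B * (e2 + e2) = e / 2\<close>.\<close>
    define e2 where "e2 = e / (8 * B)"
    have e12: "0 < e1" "0 < e2" using e \<open>0 < B\<close> by (auto simp: e1_def e2_def)
    have "\<exists>R. eventually (\<lambda>n. measure P {\<omega> \<in> space P. R < \<bar>V n \<omega>\<bar>} < e2) sequentially"
    proof (rule tight_of_bounded_continuous_conv[where V=V and W=W, OF assms(1,2)])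
      show "(\<lambda>n. \<integral>\<omega>. g (V n \<omega>) \<partial>P) \<longlonglongrightarrow> (\<integral>\<omega>. (g (W \<omega>) :: real) \<partial>Q)"
        if "\<And>x. isCont g x" "\<And>x. \<bar>g x\<bar> \<le> B" for g B
        using that by (rule conv)
    qed (use e12 in auto)
    then obtain R where R: "eventually (\<lambda>n. measure P {\<omega> \<in> space P. R < \<bar>V n \<omega>\<bar>} < e2) sequentially"
      by blast
    obtain \<eta> where \<eta>: "0 < \<eta>" "\<And>v b r. \<bar>v\<bar> \<le> R \<Longrightarrow> (\<And>i. i \<in> I \<Longrightarrow> \<bar>b i\<bar> \<le> \<eta>) \<Longrightarrow> (\<And>i. i \<in> I \<Longrightarrow> \<bar>r i - t i\<bar> \<le> \<eta>) \<Longrightarrow>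
        \<bar>f (\<lambda>i\<in>I. b i + r i * v) - f (\<lambda>i\<in>I. t i * v)\<bar> < e1"
      using product_topology_uniform[OF f e12(1), of R t] by blast
    have ev_r: "eventually (\<lambda>n. \<forall>i\<in>I. \<bar>r n i - t i\<bar> \<le> \<eta>) sequentially"
    proof (intro eventually_ball_finite fin ballI)
      fix i assume "i \<in> I"
      from tendstoD[OF r[OF this] \<eta>(1)] show "eventually (\<lambda>n. \<bar>r n i - t i\<bar> \<le> \<eta>) sequentially"
        by eventually_elim (simp add: dist_real_def)
    qed
    let ?bad = "\<lambda>n i. {\<omega> \<in> space P. \<eta> \<le> \<bar>A n i \<omega>\<bar>}" and ?big = "\<lambda>n. {\<omega> \<in> space P. R < \<bar>V n \<omega>\<bar>}"
    have "(\<lambda>n. \<Sum>i\<in>I. measure P (?bad n i)) \<longlonglongrightarrow> (\<Sum>i\<in>I. 0)"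
      using \<eta>(1) by (intro tendsto_sum A)
    then have "eventually (\<lambda>n. (\<Sum>i\<in>I. measure P (?bad n i)) < e2) sequentially"
      using e12 by (intro order_tendstoD(2)) auto
    with R ev_r show "eventually (\<lambda>n. dist ((\<integral>\<omega>. F n \<omega> \<partial>P) - (\<integral>\<omega>. g (V n \<omega>) \<partial>P)) 0 < e) sequentially"
    proof eventually_elim
      case (elim n)
      \<comment> \<open>A pointwise majorant: off the bad events the difference is below
        \<open>e1\<close>, and on them the sum of indicators is at least 1.\<close>
      let ?h = "\<lambda>\<omega>. e1 + 2 * B * (indicator (?big n) \<omega> + (\<Sum>i\<in>I. indicator (?bad n i) \<omega>))"
      have int_ind: "integrable P (indicator S :: 'b \<Rightarrow> real)" if "S \<in> sets P" for S
        using that by (simp add: P.emeasure_eq_measure)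
      have [measurable]: "?big n \<in> sets P" "?bad n i \<in> sets P" for i by measurable
      have "\<bar>(\<integral>\<omega>. F n \<omega> \<partial>P) - (\<integral>\<omega>. g (V n \<omega>) \<partial>P)\<bar> = \<bar>\<integral>\<omega>. F n \<omega> - g (V n \<omega>) \<partial>P\<bar>"
        using int_F int_g by simp
      also have "\<dots> \<le> (\<integral>\<omega>. \<bar>F n \<omega> - g (V n \<omega>)\<bar> \<partial>P)"
        by (rule integral_abs_bound)
      also have "\<dots> \<le> (\<integral>\<omega>. ?h \<omega> \<partial>P)"
      proof (rule integral_mono)
        show "integrable P (\<lambda>\<omega>. \<bar>F n \<omega> - g (V n \<omega>)\<bar>)" using int_F int_g by auto
        show "integrable P ?h"
          by (intro Bochner_Integration.integrable_add integrable_mult_right Bochner_Integration.integrable_sum int_ind) auto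
        fix \<omega> assume \<omega>: "\<omega> \<in> space P"
        show "\<bar>F n \<omega> - g (V n \<omega>)\<bar> \<le> ?h \<omega>"
        proof (cases "\<omega> \<in> ?big n \<or> (\<exists>i\<in>I. \<omega> \<in> ?bad n i)")
          case False
          then have "\<bar>V n \<omega>\<bar> \<le> R" "\<And>i. i \<in> I \<Longrightarrow> \<bar>A n i \<omega>\<bar> \<le> \<eta>" using \<omega> by force+
          then have "\<bar>F n \<omega> - g (V n \<omega>)\<bar> < e1"
            unfolding F_def g_def using elim by (intro \<eta>(2)) auto
          moreover have "0 \<le> 2 * B * (indicator (?big n) \<omega> + (\<Sum>i\<in>I. indicator (?bad n i) \<omega>))"
            using \<open>0 < B\<close> by (intro mult_nonneg_nonneg add_nonneg_nonneg sum_nonneg) auto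
          ultimately show ?thesis by linarith
        next
          case True
          have "1 \<le> indicator (?big n) \<omega> + (\<Sum>i\<in>I. indicator (?bad n i) \<omega> :: real)"
          proof (cases "\<omega> \<in> ?big n")
            case True
            then show ?thesis by (simp add: sum_nonneg)
          next
            case False
            with True obtain i where i: "i \<in> I" "\<omega> \<in> ?bad n i" by blast
            have "indicator (?bad n i) \<omega> \<le> (\<Sum>i\<in>I. indicator (?bad n i) \<omega> :: real)"
              using i fin by (intro member_le_sum) auto
            then show ?thesis using i(2) False by simp
          qed
          then have "2 * B * 1 \<le> 2 * B * (indicator (?big n) \<omega> + (\<Sum>i\<in>I. indicator (?bad n i) \<omega>))"
            using \<open>0 < B\<close> by (intro mult_left_mono) auto
          moreover have "\<bar>F n \<omega> - g (V n \<omega>)\<bar> \<le> 2 * B"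
            using F_bdd[of n \<omega>] g_bdd[of "V n \<omega>"] by linarith
          ultimately show ?thesis using e12 by linarith
        qed
      qed
      also have "\<dots> = e1 + 2 * B * (measure P (?big n) + (\<Sum>i\<in>I. measure P (?bad n i)))"
        by (simp add: int_ind P.prob_space)
      also have "\<dots> < e1 + 2 * B * (e2 + e2)"
        using elim \<open>0 < B\<close> by (intro add_strict_left_mono mult_strict_left_mono add_strict_mono) auto
      also have "\<dots> = e" using \<open>0 < B\<close> by (simp add: e1_def e2_def)
      finally show ?case by (simp add: dist_real_def)
    qed
  qed
  from tendsto_add[OF this conv[of g B, OF g_cont g_bdd]]
  show ?thesis by (simp add: F_def g_def)
qed

section \<open>Aggregation of independent copies\<close>

locale aggregated_inar1 = critical_inar1 M lam \<psi>1 \<psi> \<alpha> X0 \<xi> \<epsilon>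
  for M :: "'a measure" and lam \<psi>1 \<psi> \<alpha> X0 \<xi> \<epsilon> +
  fixes P :: "'b measure" and a :: "nat \<Rightarrow> 'b \<Rightarrow> real" and Y :: "nat \<Rightarrow> nat \<Rightarrow> 'b \<Rightarrow> nat"
  assumes copies: "independent_copies P a Y M \<alpha> (inar1 X0 \<xi> \<epsilon>)"
begin

sublocale P: prob_space P
  using copies by (simp add: independent_copies_def)

abbreviation copy :: "nat \<Rightarrow> 'b \<Rightarrow> real \<times> (nat \<Rightarrow> nat)" where
  "copy j \<omega> \<equiv> (a j \<omega>, \<lambda>k. Y j k \<omega>)"

lemma indep_copies: "P.indep_vars (\<lambda>_. path_space) copy {1..}"
  using copies by (simp add: independent_copies_def)

lemma copy_measurable: "1 \<le> j \<Longrightarrow> copy j \<in> P \<rightarrow>\<^sub>M path_space"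
  using indep_copies by (simp add: P.indep_vars_def2)

lemma copy_distr: "1 \<le> j \<Longrightarrow> distr P path_space (copy j) = distr M path_space (\<lambda>\<omega>. (\<alpha> \<omega>, \<lambda>k. X k \<omega>))"
  using copies by (simp add: independent_copies_def)

lemma path_measurable: "(\<lambda>\<omega>. (\<alpha> \<omega>, \<lambda>k. X k \<omega>)) \<in> M \<rightarrow>\<^sub>M path_space"
  unfolding path_space_def
  by (intro measurable_Pair alpha_measurable measurable_PiM_single') (auto simp: space_PiM)

lemma path_space_components [measurable]:
  "fst \<in> path_space \<rightarrow>\<^sub>M borel" "(\<lambda>p. snd p k) \<in> path_space \<rightarrow>\<^sub>M count_space UNIV"
  unfolding path_space_def by measurable

text \<open>\<open>P\<close> and \<open>M\<close> share only the joint law on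
  \<open>path_space\<close>; functionals of a single copy are transferred through it.\<close>

lemma copy_nn_integral:
  "1 \<le> j \<Longrightarrow> g \<in> borel_measurable path_space \<Longrightarrow>
    (\<integral>\<^sup>+\<omega>. g (copy j \<omega>) \<partial>P) = (\<integral>\<^sup>+\<omega>. g (\<alpha> \<omega>, \<lambda>k. X k \<omega>) \<partial>M)"
  using nn_integral_distr[OF copy_measurable, of j g] nn_integral_distr[OF path_measurable, of g]
  by (simp add: copy_distr)

lemma copy_integral:
  fixes g :: "_ \<Rightarrow> 'd::{banach, second_countable_topology}"
  shows "1 \<le> j \<Longrightarrow> g \<in> borel_measurable path_space \<Longrightarrow>
    (\<integral>\<omega>. g (copy j \<omega>) \<partial>P) = (\<integral>\<omega>. g (\<alpha> \<omega>, \<lambda>k. X k \<omega>) \<partial>M)"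
  using integral_distr[OF copy_measurable, of j g] integral_distr[OF path_measurable, of g]
  by (simp add: copy_distr)

section \<open>Initial part and displacement part of the aggregate\<close>

definition centred :: "real \<times> (nat \<Rightarrow> nat) \<Rightarrow> real" where
  "centred p = real (snd p 0) - lam / (1 - fst p)"

definition displacement :: "nat \<Rightarrow> real \<times> (nat \<Rightarrow> nat) \<Rightarrow> real" where
  "displacement m p = (\<Sum>k = 1..m. real (snd p k) - real (snd p 0))"

lemma centred_measurable [measurable]: "centred \<in> borel_measurable path_space"
  unfolding centred_def[abs_def] by measurable

lemma displacement_measurable [measurable]: "displacement m \<in> borel_measurable path_space"
  unfolding displacement_def[abs_def] by measurable

definition norming :: "nat \<Rightarrow> real" where
  "norming N = (real N * ln (real N)) powr (-1/2)"

definition initial_part :: "nat \<Rightarrow> 'b \<Rightarrow> real" where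
  "initial_part N \<omega> = (\<Sum>j = 1..N. norming N * centred (copy j \<omega>))"

definition displacement_part :: "nat \<Rightarrow> nat \<Rightarrow> nat \<Rightarrow> 'b \<Rightarrow> real" where
  "displacement_part N n m \<omega> = inverse (real n) * norming N * (\<Sum>j = 1..N. displacement m (copy j \<omega>))"

lemma initial_part_measurable [measurable]: "initial_part N \<in> borel_measurable P"
  unfolding initial_part_def by (intro borel_measurable_sum borel_measurable_times measurable_const
    measurable_compose[OF copy_measurable centred_measurable]) auto

lemma displacement_part_measurable [measurable]: "displacement_part N n m \<in> borel_measurable P"
  unfolding displacement_part_def by (intro borel_measurable_sum borel_measurable_times measurable_const
    measurable_compose[OF copy_measurable displacement_measurable]) auto

lemma aggregated_decomposition:
  "inverse (real n) * norming N * aggregated lam a Y N n t \<omega>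
    = displacement_part N n (nat \<lfloor>real n * t\<rfloor>) \<omega> + real (nat \<lfloor>real n * t\<rfloor>) / real n * initial_part N \<omega>"
proof -
  let ?m = "nat \<lfloor>real n * t\<rfloor>"
  have "(\<Sum>k = 1..?m. real (Y j k \<omega>) - lam / (1 - a j \<omega>)) = displacement ?m (copy j \<omega>) + real ?m * centred (copy j \<omega>)" for j
    by (simp add: displacement_def centred_def sum_subtractf algebra_simps)
  then have "aggregated lam a Y N n t \<omega>
      = (\<Sum>j = 1..N. displacement ?m (copy j \<omega>)) + real ?m * (\<Sum>j = 1..N. centred (copy j \<omega>))"
    by (simp add: aggregated_def sum.distrib sum_distrib_left)
  then show ?thesis
    by (simp add: displacement_part_def initial_part_def sum_distrib_left[symmetric] distrib_left divide_inverse mult_ac)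
qed

lemma norming_eq: "norming N = 1 / sqrt (real N * ln (real N))"
proof -
  have nn: "0 \<le> real N * ln (real N)" by (cases N) auto
  have "norming N = (real N * ln (real N)) powr (- (1 / 2))" by (simp add: norming_def)
  also have "\<dots> = 1 / (real N * ln (real N)) powr (1 / 2)" by (rule powr_minus_divide)
  also have "\<dots> = 1 / sqrt (real N * ln (real N))" by (simp only: powr_half_sqrt[OF nn])
  finally show ?thesis .
qed

lemma char_initial_part: "char (distr P borel (initial_part N)) u = centred_char (u / sqrt (real N * ln (real N))) ^ N"
proof -
  have indep: "P.indep_vars (\<lambda>_. borel) (\<lambda>j \<omega>. norming N * centred (copy j \<omega>)) {1..N}"
    by (rule P.indep_vars_compose2[OF P.indep_vars_subset[OF indep_copies]]) auto
  have "char (distr P borel (\<lambda>\<omega>. norming N * centred (copy j \<omega>))) u = centred_char (u / sqrt (real N * ln (real N)))"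
    if "j \<in> {1..N}" for j
  proof -
    have [measurable]: "(\<lambda>\<omega>. norming N * centred (copy j \<omega>)) \<in> borel_measurable P"
      using that by (intro borel_measurable_times measurable_const measurable_compose[OF copy_measurable centred_measurable]) auto
    have "char (distr P borel (\<lambda>\<omega>. norming N * centred (copy j \<omega>))) u
        = (\<integral>\<omega>. iexp (u * (norming N * centred (copy j \<omega>))) \<partial>P)"
      unfolding char_def by (rule integral_distr) measurable
    also have "\<dots> = (\<integral>\<omega>. iexp (u * (norming N * centred (\<alpha> \<omega>, \<lambda>k. X k \<omega>))) \<partial>M)"
      using that by (intro copy_integral[where g="\<lambda>p. iexp (u * (norming N * centred p))"]) auto
    also have "\<dots> = centred_char (u * norming N)"
      by (simp add: centred_char_def centred_def mult.assoc)
    finally show ?thesis by (simp add: norming_eq)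
  qed
  then have "(\<Prod>j = 1..N. char (distr P borel (\<lambda>\<omega>. norming N * centred (copy j \<omega>))) u)
      = centred_char (u / sqrt (real N * ln (real N))) ^ N"
    by simp
  then show ?thesis
    unfolding initial_part_def using P.char_distr_sum[OF indep, of u] by simp
qed

text \<open>Cauchy-Schwarz over \<open>m\<close> displacements gives
  \<open>m\<^sup>2 * (1 + ln m)\<close>. The logarithm is traded for a square root so that the bound
  is a pure power of \<open>m\<close>: inserting \<open>m \<le> n * t\<close> then separates
  \<open>n\<close> from \<open>t\<close>, and the case \<open>m = 0\<close> is covered.\<close>

lemma displacement_moments:
  "\<exists>K>0. \<forall>m j. 1 \<le> j \<longrightarrow> integrable P (\<lambda>\<omega>. (displacement m (copy j \<omega>))\<^sup>2) \<and>
    P.expectation (\<lambda>\<omega>. displacement m (copy j \<omega>)) = 0 \<and>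
    P.expectation (\<lambda>\<omega>. (displacement m (copy j \<omega>))\<^sup>2) \<le> K * (real m)\<^sup>2 * sqrt (real m)"
proof -
  obtain K where K: "0 < K" "\<And>m k. 1 \<le> m \<Longrightarrow> k \<le> m \<Longrightarrow>
      (\<integral>\<^sup>+\<omega>. ennreal ((real (X k \<omega>) - real (X 0 \<omega>))\<^sup>2) \<partial>M) \<le> ennreal (K * (1 + ln (real m)))"
    using displacement_log_bound by blast
  have "integrable P (\<lambda>\<omega>. (displacement m (copy j \<omega>))\<^sup>2) \<and>
    P.expectation (\<lambda>\<omega>. displacement m (copy j \<omega>)) = 0 \<and>
    P.expectation (\<lambda>\<omega>. (displacement m (copy j \<omega>))\<^sup>2) \<le> (2 * K) * (real m)\<^sup>2 * sqrt (real m)"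
    if j: "1 \<le> j" for j m
  proof (cases "m = 0")
    case False
    then have m: "1 \<le> m" by simp
    have ln_m: "0 \<le> ln (real m)" using m by simp
    have [measurable]: "copy j \<in> P \<rightarrow>\<^sub>M path_space" by (rule copy_measurable[OF j])
    let ?d = "\<lambda>k \<omega>. real (X k \<omega>) - real (X 0 \<omega>)"
    have "(\<integral>\<^sup>+\<omega>. ennreal ((displacement m (copy j \<omega>))\<^sup>2) \<partial>P)
        = (\<integral>\<^sup>+\<omega>. ennreal ((\<Sum>k = 1..m. ?d k \<omega>)\<^sup>2) \<partial>M)"
      using copy_nn_integral[OF j, of "\<lambda>p. ennreal ((displacement m p)\<^sup>2)"]
      by (simp add: displacement_def del: inar1.simps)
    also have "\<dots> \<le> (\<integral>\<^sup>+\<omega>. ennreal (real m) * (\<Sum>k = 1..m. ennreal ((?d k \<omega>)\<^sup>2)) \<partial>M)"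
    proof (rule nn_integral_mono)
      fix \<omega>
      have "(\<Sum>k = 1..m. ?d k \<omega>)\<^sup>2 \<le> real m * (\<Sum>k = 1..m. (?d k \<omega>)\<^sup>2)"
        using sum_squared_le_sum_of_squares[of "\<lambda>k. ?d k \<omega>" "{1..m}"] by (simp add: mult.commute del: inar1.simps)
      then show "ennreal ((\<Sum>k = 1..m. ?d k \<omega>)\<^sup>2) \<le> ennreal (real m) * (\<Sum>k = 1..m. ennreal ((?d k \<omega>)\<^sup>2))"
        by (simp add: sum_ennreal ennreal_mult[symmetric] sum_nonneg ennreal_leI del: inar1.simps)
    qed
    also have "\<dots> = ennreal (real m) * (\<Sum>k = 1..m. \<integral>\<^sup>+\<omega>. ennreal ((?d k \<omega>)\<^sup>2) \<partial>M)"
      by (simp add: nn_integral_cmult nn_integral_sum del: inar1.simps sum_ennreal)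
    also have "\<dots> \<le> ennreal (real m) * (\<Sum>k = 1..m. ennreal (K * (1 + ln (real m))))"
      using m by (intro mult_left_mono sum_mono K(2)) auto
    also have "\<dots> = ennreal (real m * (real m * (K * (1 + ln (real m)))))"
      using K(1) ln_m by (simp add: ennreal_mult ennreal_of_nat_eq_real_of_nat)
    also have "\<dots> \<le> ennreal ((2 * K) * (real m)\<^sup>2 * sqrt (real m))"
    proof (rule ennreal_leI)
      \<comment> \<open>Applied to the square root, \<open>ln x \<le> x - 1\<close> gives
        \<open>ln m \<le> 2 * sqrt m - 2\<close>.\<close>
      have "ln (sqrt (real m)) \<le> sqrt (real m) - 1" using m by (intro ln_le_minus_one) simp
      then have "1 + ln (real m) \<le> 2 * sqrt (real m)" using m by (simp add: ln_sqrt)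
      then have "real m * (real m * (K * (1 + ln (real m)))) \<le> real m * (real m * (K * (2 * sqrt (real m))))"
        using K(1) by (intro mult_left_mono) auto
      then show "real m * (real m * (K * (1 + ln (real m)))) \<le> (2 * K) * (real m)\<^sup>2 * sqrt (real m)"
        by (simp add: power2_eq_square mult_ac)
    qed
    finally have bound: "(\<integral>\<^sup>+\<omega>. ennreal ((displacement m (copy j \<omega>))\<^sup>2) \<partial>P) \<le> ennreal ((2 * K) * (real m)\<^sup>2 * sqrt (real m))" .
    have int: "integrable P (\<lambda>\<omega>. (displacement m (copy j \<omega>))\<^sup>2)"
      using bound by (intro integrableI_nonneg) (auto simp: top_unique less_top intro: le_less_trans)
    have "P.expectation (\<lambda>\<omega>. displacement m (copy j \<omega>)) = (\<integral>\<omega>. (\<Sum>k = 1..m. ?d k \<omega>) \<partial>M)"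
      using copy_integral[OF j, of "displacement m"] by (simp add: displacement_def del: inar1.simps)
    also have "\<dots> = 0"
    proof -
      have "has_bochner_integral M (\<lambda>\<omega>. \<Sum>k = 1..m. ?d k \<omega>) (\<Sum>k = 1..m. 0)"
        by (intro has_bochner_integral_sum displacement_mean)
      then show ?thesis by (simp add: has_bochner_integral_integral_eq del: inar1.simps)
    qed
    finally have mean: "P.expectation (\<lambda>\<omega>. displacement m (copy j \<omega>)) = 0" .
    have "ennreal (P.expectation (\<lambda>\<omega>. (displacement m (copy j \<omega>))\<^sup>2)) \<le> ennreal ((2 * K) * (real m)\<^sup>2 * sqrt (real m))"
      using bound by (subst (asm) nn_integral_eq_integral[OF int]) auto
    then show ?thesis using int mean K(1) by (subst (asm) ennreal_le_iff) auto
  qed (simp add: displacement_def)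
  then show ?thesis using K(1) by (intro exI[of _ "2 * K"]) auto
qed

text \<open>Chebyshev: the variance of the sum is at most
  \<open>K * N * (n * t)\<^sup>2 * sqrt (n * t)\<close>, and the squared norming divides by
  \<open>n\<^sup>2 * N * ln N\<close>. What remains is a constant times
  \<open>sqrt n / ln N\<close>, the square root of the reciprocal of the quantity assumed to
  diverge.\<close>

lemma displacement_part_tendsto_0:
  fixes Nn :: "nat \<Rightarrow> nat"
  assumes N: "filterlim (\<lambda>n. (ln (real (Nn n)))\<^sup>2 / real n) at_top sequentially"
    and "0 \<le> t" "0 < \<eta>"
  shows "(\<lambda>n. P.prob {\<omega> \<in> space P. \<eta> \<le> \<bar>displacement_part (Nn n) n (nat \<lfloor>real n * t\<rfloor>) \<omega>\<bar>}) \<longlonglongrightarrow> 0"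
proof -
  obtain K where K: "0 < K" and mom: "\<And>m j. 1 \<le> j \<Longrightarrow> integrable P (\<lambda>\<omega>. (displacement m (copy j \<omega>))\<^sup>2)"
    "\<And>m j. 1 \<le> j \<Longrightarrow> P.expectation (\<lambda>\<omega>. displacement m (copy j \<omega>)) = 0"
    "\<And>m j. 1 \<le> j \<Longrightarrow> P.expectation (\<lambda>\<omega>. (displacement m (copy j \<omega>))\<^sup>2) \<le> K * (real m)\<^sup>2 * sqrt (real m)"
    using displacement_moments by blast
  define C where "C = K * t\<^sup>2 * sqrt t / \<eta>\<^sup>2"
  have "(\<lambda>n. sqrt (inverse ((ln (real (Nn n)))\<^sup>2 / real n))) \<longlonglongrightarrow> sqrt 0"
    by (intro tendsto_real_sqrt filterlim_compose[OF tendsto_inverse_0_at_top N] tendsto_inverse_0_at_top N)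
  then have lim: "(\<lambda>n. C * sqrt (inverse ((ln (real (Nn n)))\<^sup>2 / real n))) \<longlonglongrightarrow> 0"
    using tendsto_mult_right_zero by fastforce
  \<comment> \<open>A positive quotient forces \<open>ln (real (Nn n))\<close> to be nonzero, hence
    \<open>Nn n\<close> to be at least 2, so that the norming is not degenerate.\<close>
  have ev: "eventually (\<lambda>n. 1 \<le> (ln (real (Nn n)))\<^sup>2 / real n) sequentially"
    using N by (simp add: filterlim_at_top)
  show ?thesis
  proof (rule tendsto_sandwich[OF _ _ tendsto_const lim])
    show "eventually (\<lambda>n. P.prob {\<omega> \<in> space P. \<eta> \<le> \<bar>displacement_part (Nn n) n (nat \<lfloor>real n * t\<rfloor>) \<omega>\<bar>}
        \<le> C * sqrt (inverse ((ln (real (Nn n)))\<^sup>2 / real n))) sequentially"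
      using ev eventually_gt_at_top[of 0]
    proof eventually_elim
      case (elim n)
      define N' where "N' = Nn n"
      define m where "m = nat \<lfloor>real n * t\<rfloor>"
      define L where "L = ln (real N')"
      have "L \<noteq> 0" using elim by (auto simp: L_def N'_def)
      then have N2: "2 \<le> N'" unfolding L_def by (cases N'; cases "N' - 1") auto
      then have L: "0 < L" by (simp add: L_def)
      have m: "real m \<le> real n * t" using assms(2) by (simp add: m_def)
      have norming2: "(norming N')\<^sup>2 = 1 / (real N' * L)"
        using N2 L by (simp add: norming_eq L_def[symmetric] power_divide)
      let ?S = "\<lambda>\<omega>. \<Sum>j = 1..N'. displacement m (copy j \<omega>)"
      have indep: "P.indep_vars (\<lambda>_. borel) (\<lambda>j \<omega>. displacement m (copy j \<omega>)) {1..N'}"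
        by (rule P.indep_vars_compose2[OF P.indep_vars_subset[OF indep_copies]]) auto
      have int_S: "integrable P (\<lambda>\<omega>. (?S \<omega>)\<^sup>2)"
        and exp_S: "P.expectation (\<lambda>\<omega>. (?S \<omega>)\<^sup>2) = (\<Sum>j = 1..N'. P.expectation (\<lambda>\<omega>. (displacement m (copy j \<omega>))\<^sup>2))"
        using P.second_moment_indep_sum[OF _ indep] mom by auto
      have "P.expectation (\<lambda>\<omega>. (?S \<omega>)\<^sup>2) \<le> (\<Sum>j = 1..N'. K * (real m)\<^sup>2 * sqrt (real m))"
        unfolding exp_S by (intro sum_mono mom) auto
      also have "\<dots> = real N' * (K * (real m)\<^sup>2 * sqrt (real m))" by simp
      also have "\<dots> \<le> real N' * (K * (real n * t)\<^sup>2 * sqrt (real n * t))"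
        using m K by (intro mult_left_mono mult_mono power_mono real_sqrt_le_mono) auto
      finally have S_le: "P.expectation (\<lambda>\<omega>. (?S \<omega>)\<^sup>2) \<le> real N' * (K * (real n * t)\<^sup>2 * sqrt (real n * t))" .
      have A2: "(\<lambda>\<omega>. (displacement_part N' n m \<omega>)\<^sup>2) = (\<lambda>\<omega>. (inverse (real n) * norming N')\<^sup>2 * (?S \<omega>)\<^sup>2)"
        by (simp add: displacement_part_def power_mult_distrib)
      have int_A: "integrable P (\<lambda>\<omega>. (displacement_part N' n m \<omega>)\<^sup>2)"
        unfolding A2 by (intro integrable_mult_right int_S)
      have "P.prob {\<omega> \<in> space P. \<eta> \<le> \<bar>displacement_part N' n m \<omega>\<bar>} \<le> P.expectation (\<lambda>\<omega>. (displacement_part N' n m \<omega>)\<^sup>2) / \<eta>\<^sup>2"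
        by (intro P.second_moment_method displacement_part_measurable int_A assms(3))
      also have "P.expectation (\<lambda>\<omega>. (displacement_part N' n m \<omega>)\<^sup>2) = (inverse (real n) * norming N')\<^sup>2 * P.expectation (\<lambda>\<omega>. (?S \<omega>)\<^sup>2)"
        unfolding A2 by simp
      also have "\<dots> / \<eta>\<^sup>2 \<le> (inverse (real n) * norming N')\<^sup>2 * (real N' * (K * (real n * t)\<^sup>2 * sqrt (real n * t))) / \<eta>\<^sup>2"
        by (intro divide_right_mono mult_left_mono S_le) auto
      also have "\<dots> = C * (sqrt (real n) / L)"
        using elim N2 L unfolding C_def power_mult_distrib norming2
        by (simp add: field_simps real_sqrt_mult)
      also have "sqrt (real n) / L = sqrt (inverse ((ln (real (Nn n)))\<^sup>2 / real n))"
        using L unfolding N'_def[symmetric] L_def[symmetric] by (simp add: real_sqrt_divide)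
      finally show ?case by (simp add: N'_def m_def)
    qed
  qed auto
qed

text \<open>\<open>initial_part\<close> depends on \<open>n\<close> only through
  \<open>Nn n\<close>, so the limit of characteristic functions along all integers can be composed
  with \<open>Nn\<close>. Levy continuity then gives weak convergence, tested against bounded
  continuous \<open>g\<close>.\<close>

lemma initial_part_conv:
  fixes Nn :: "nat \<Rightarrow> nat" and g :: "real \<Rightarrow> real"
  assumes Q: "prob_space Q" and W: "distributed Q lborel W (normal_density 0 (sqrt (lam * \<psi>1)))"
    and N: "filterlim Nn at_top sequentially"
    and g: "\<And>x. isCont g x" "\<And>x. \<bar>g x\<bar> \<le> B"
  shows "(\<lambda>n. \<integral>\<omega>. g (initial_part (Nn n) \<omega>) \<partial>P) \<longlonglongrightarrow> (\<integral>\<omega>. g (W \<omega>) \<partial>Q)"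
proof -
  interpret Q: prob_space Q by fact
  define \<sigma> where "\<sigma> = sqrt (lam * \<psi>1)"
  have \<sigma>: "0 < \<sigma>" using lambda_pos psi1_pos by (simp add: \<sigma>_def)
  have [measurable]: "W \<in> borel_measurable Q" using distributed_measurable[OF W] by simp
  have [measurable]: "g \<in> borel_measurable borel"
    using g(1) by (intro borel_measurable_continuous_onI continuous_at_imp_continuous_on) auto
  \<comment> \<open>Standardising reduces the characteristic function of \<open>W\<close> to that of
    the standard normal law at \<open>\<sigma> * u\<close>.\<close>
  have std: "distr Q lborel (\<lambda>\<omega>. W \<omega> / \<sigma>) = std_normal_distribution"
    using W Q.normal_standard_normal_convert[OF \<sigma>, of W 0]
    by (auto simp: \<sigma>_def[symmetric] distributed_def)
  have char_W: "char (distr Q borel W) u = complex_of_real (exp (- (lam * \<psi>1 * u\<^sup>2 / 2)))" for u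
  proof -
    have "char (distr Q borel W) u = (\<integral>\<omega>. iexp (u * W \<omega>) \<partial>Q)"
      unfolding char_def by (rule integral_distr) measurable
    also have "\<dots> = (\<integral>\<omega>. iexp ((\<sigma> * u) * (W \<omega> / \<sigma>)) \<partial>Q)"
      using \<sigma> by simp
    also have "\<dots> = char (distr Q lborel (\<lambda>\<omega>. W \<omega> / \<sigma>)) (\<sigma> * u)"
      unfolding char_def by (rule integral_distr[symmetric]) measurable
    also have "\<dots> = complex_of_real (exp (- ((\<sigma> * u)\<^sup>2) / 2))"
      unfolding std char_std_normal_distribution by simp
    also have "(\<sigma> * u)\<^sup>2 = lam * \<psi>1 * u\<^sup>2"
      using lambda_pos psi1_pos by (simp add: \<sigma>_def power_mult_distrib)
    finally show ?thesis by simp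
  qed
  have rd: "real_distribution (distr P borel (initial_part (Nn n)))" "real_distribution (distr Q borel W)" for n
    by (auto intro!: P.real_distribution_distr Q.real_distribution_distr)
  have "weak_conv_m (\<lambda>n. distr P borel (initial_part (Nn n))) (distr Q borel W)"
  proof (rule levy_continuity[OF rd])
    fix u
    have "(\<lambda>n. centred_char (u / sqrt (real (Nn n) * ln (real (Nn n)))) ^ Nn n) \<longlonglongrightarrow> char (distr Q borel W) u"
      unfolding char_W by (rule filterlim_compose[OF centred_char_power_limit N])
    then show "(\<lambda>n. char (distr P borel (initial_part (Nn n))) u) \<longlonglongrightarrow> char (distr Q borel W) u"
    proof (rule Lim_transform_eventually)
      have "eventually (\<lambda>n. 2 \<le> Nn n) sequentially" using N by (simp add: filterlim_at_top)
      then show "eventually (\<lambda>n. centred_char (u / sqrt (real (Nn n) * ln (real (Nn n)))) ^ Nn n = char (distr P borel (initial_part (Nn n))) u) sequentially"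
        by eventually_elim (simp add: char_initial_part)
    qed
  qed
  from weak_conv_imp_integral_bdd_continuous_conv[OF rd this g(1), of B] g(2)
  have "(\<lambda>n. integral\<^sup>L (distr P borel (initial_part (Nn n))) g) \<longlonglongrightarrow> integral\<^sup>L (distr Q borel W) g"
    by simp
  then show ?thesis by (simp add: integral_distr)
qed

end

section \<open>Elementary limits and conclusion\<close>

lemma floor_ratio_tendsto:
  assumes "0 \<le> t"
  shows "(\<lambda>n. real (nat \<lfloor>real n * t\<rfloor>) / real n) \<longlonglongrightarrow> t"
proof (rule LIM_zero_cancel, rule Lim_null_comparison)
  show "eventually (\<lambda>n. norm (real (nat \<lfloor>real n * t\<rfloor>) / real n - t) \<le> 1 / real n) sequentially"
    using eventually_gt_at_top[of 0]
  proof eventually_elim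
    case (elim n)
    have "0 \<le> real n * t" using assms by simp
    then have "\<bar>real (nat \<lfloor>real n * t\<rfloor>) - real n * t\<bar> \<le> 1" by (simp add: of_nat_nat) linarith
    moreover have "real (nat \<lfloor>real n * t\<rfloor>) / real n - t = (real (nat \<lfloor>real n * t\<rfloor>) - real n * t) / real n"
      using elim by (simp add: field_simps)
    ultimately show ?case using elim by (simp add: divide_right_mono)
  qed
qed (rule lim_1_over_n)

text \<open>For \<open>n \<ge> 1\<close> dividing by \<open>n\<close> only decreases, so
  \<open>N n < Z\<close> would keep the quotient below \<open>(ln Z)\<^sup>2\<close>. As
  \<open>ln 0\<close> is 0, the value \<open>N n = 0\<close> obeys the same bounds.\<close>

lemma filterlim_of_ln_square:
  fixes N :: "nat \<Rightarrow> nat"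
  assumes "filterlim (\<lambda>n. (ln (real (N n)))\<^sup>2 / real n) at_top sequentially"
  shows "filterlim N at_top sequentially"
proof (subst filterlim_at_top, intro allI)
  fix Z :: nat
  \<comment> \<open>The summand 1 makes the contradiction strict.\<close>
  have "eventually (\<lambda>n. (ln (real Z))\<^sup>2 + 1 \<le> (ln (real (N n)))\<^sup>2 / real n) sequentially"
    using assms by (simp add: filterlim_at_top)
  then show "eventually (\<lambda>n. Z \<le> N n) sequentially"
    using eventually_ge_at_top[of 1]
  proof eventually_elim
    case (elim n)
    show ?case
    proof (rule ccontr)
      assume "\<not> Z \<le> N n"
      then have "ln (real (N n)) \<le> ln (real Z)" "0 \<le> ln (real (N n))"
        by (cases "N n = 0"; simp)+
      then have "(ln (real (N n)))\<^sup>2 \<le> (ln (real Z))\<^sup>2" by (intro power_mono) auto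
      moreover have "(ln (real (N n)))\<^sup>2 / real n \<le> (ln (real (N n)))\<^sup>2"
        using elim(2) by (simp add: divide_le_eq mult_le_cancel_left1)
      ultimately show False using elim(1) by linarith
    qed
  qed
qed

theorem theorem1p2:
  fixes M :: "'a measure" and P :: "'b measure" and Q :: "'c measure"
    and lam \<psi>1 :: real and \<psi> :: "real \<Rightarrow> real"
    and \<alpha> :: "'a \<Rightarrow> real" and X0 :: "'a \<Rightarrow> nat"
    and \<xi> :: "nat \<Rightarrow> nat \<Rightarrow> 'a \<Rightarrow> nat" and \<epsilon> :: "nat \<Rightarrow> 'a \<Rightarrow> nat"
    and a :: "nat \<Rightarrow> 'b \<Rightarrow> real" and X :: "nat \<Rightarrow> nat \<Rightarrow> 'b \<Rightarrow> nat"
    and W :: "'c \<Rightarrow> real" and N :: "nat \<Rightarrow> nat"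
  assumes "randomized_inar1 M lam 0 \<psi>1 \<psi> \<alpha> X0 \<xi> \<epsilon>"
    and "independent_copies P a X M \<alpha> (inar1 X0 \<xi> \<epsilon>)"
    and "prob_space Q"
    and "distributed Q lborel W (normal_density 0 (sqrt (lam * \<psi>1)))"
    and "\<And>n. 1 \<le> n \<Longrightarrow> 1 \<le> N n"
    and "filterlim (\<lambda>n. (ln (real (N n)))\<^sup>2 / real n) at_top sequentially"
  shows "fin_dim_conv P
           (\<lambda>n t \<omega>. inverse (real n) * (real (N n) * ln (real (N n))) powr (-1/2)
                    * aggregated lam a X (N n) n t \<omega>)
           Q (\<lambda>t \<omega>. W \<omega> * t)"
proof -
  interpret aggregated_inar1 M lam \<psi>1 \<psi> \<alpha> X0 \<xi> \<epsilon> P a X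
    using assms(1,2) by (simp add: aggregated_inar1_def critical_inar1_def aggregated_inar1_axioms_def)
  have [measurable]: "W \<in> borel_measurable Q" using distributed_measurable[OF assms(4)] by simp
  show ?thesis
    unfolding fin_dim_conv_def weak_conv_in_def
  proof (intro allI impI, elim conjE)
    fix d :: nat and t :: "nat \<Rightarrow> real" and f :: "(nat \<Rightarrow> real) \<Rightarrow> real"
    assume t: "\<forall>i<d. 0 \<le> t i"
      and f: "continuous_map (product_topology (\<lambda>_. euclideanreal) {..<d}) euclideanreal f"
      and bdd: "bounded (f ` topspace (product_topology (\<lambda>_. euclideanreal) {..<d}))"
    define m where "m n i = nat \<lfloor>real n * t i\<rfloor>" for n i
    have [measurable]: "f \<in> borel_measurable (\<Pi>\<^sub>M i\<in>{..<d}. borel)"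
      by (rule borel_measurable_product_topology[OF f])
    have lhs: "integral\<^sup>L (fin_dim_distr P (\<lambda>t \<omega>. inverse (real n) * (real (N n) * ln (real (N n))) powr (-1/2)
          * aggregated lam a X (N n) n t \<omega>) d t) f
        = (\<integral>\<omega>. f (\<lambda>i\<in>{..<d}. displacement_part (N n) n (m n i) \<omega> + real (m n i) / real n * initial_part (N n) \<omega>) \<partial>P)" for n
      unfolding fin_dim_distr_def norming_def[symmetric] aggregated_decomposition m_def[symmetric]
      by (rule integral_distr) measurable
    have rhs: "integral\<^sup>L (fin_dim_distr Q (\<lambda>t \<omega>. W \<omega> * t) d t) f = (\<integral>\<omega>. f (\<lambda>i\<in>{..<d}. t i * W \<omega>) \<partial>Q)"
      unfolding fin_dim_distr_def by (subst integral_distr) (auto simp: mult.commute)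
    show "(\<lambda>n. integral\<^sup>L (fin_dim_distr P (\<lambda>t \<omega>. inverse (real n) * (real (N n) * ln (real (N n))) powr (-1/2)
          * aggregated lam a X (N n) n t \<omega>) d t) f) \<longlonglongrightarrow> integral\<^sup>L (fin_dim_distr Q (\<lambda>t \<omega>. W \<omega> * t) d t) f"
      unfolding lhs rhs
    \<comment> \<open>All time points share the one variable \<open>V n\<close>, the initial part,
      with coefficients \<open>m n i / n\<close> tending to \<open>t i\<close>; the displacement
      parts are the errors. This is why the limit runs along a random line through 0.\<close>
    proof (rule slutsky_product[OF P.prob_space_axioms assms(3) _ _ _ _ _ _ _ f bdd])
      show "(\<lambda>n. \<integral>\<omega>. g (initial_part (N n) \<omega>) \<partial>P) \<longlonglongrightarrow> (\<integral>\<omega>. g (W \<omega>) \<partial>Q)"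
        if "\<And>x. isCont g x" "\<And>x. \<bar>g x\<bar> \<le> B" for g :: "real \<Rightarrow> real" and B
        by (rule initial_part_conv[OF assms(3,4) filterlim_of_ln_square[OF assms(6)]]) (rule that)+
      show "(\<lambda>n. P.prob {\<omega> \<in> space P. \<eta> \<le> \<bar>displacement_part (N n) n (m n i) \<omega>\<bar>}) \<longlonglongrightarrow> 0" if "i \<in> {..<d}" "0 < \<eta>" for i \<eta>
        unfolding m_def using t that by (intro displacement_part_tendsto_0[OF assms(6)]) auto
      show "(\<lambda>n. real (m n i) / real n) \<longlonglongrightarrow> t i" if "i \<in> {..<d}" for i
        unfolding m_def using t that by (intro floor_ratio_tendsto) auto
    qed measurable
  qed
qed

end
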